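(* Let $T>t_0$ be given. Consider the closed-loop system $$\begin{cases}v_t(x,t)=\alpha v_{xx}(x,t)+\lambda(x,t)v(x,t),&0<x<l(t),\ t>t_0,\\ v(0,t)=0,\\ v_x(l(t),t)+\dfrac{\dot l(t)}{2\alpha}v(l(t),t)=\hat U(t),\end{cases}$$ with initial value $v(\cdot,t_0)=v_0$, where $\lambda(x,t)=\lambda_0-\frac{\dot l^2(t)+2\ddot l(t)x}{4\alpha}$ and $\hat U$ is the feedback law $$\hat U(t)=\int_0^{l(t)}\Bigl[\frac{\dot l(t)}{2\alpha}\hat k(l(t),y,t)+\hat k_x(l(t),y,t)\Bigr]v(y,t)\,dy+\hat k(l(t),l(t),t)\,v(l(t),t)$$ built from an approximate kernel $\hat k$, which corresponds to $\hat K$ as in the context. There exists a sufficiently small $\varepsilon^*>0$ such that, if for some $\varepsilon\in(0,\varepsilon^* )$ the approximate kernel satisfies, for all $(\xi,\eta,t)\in\bar S\times[t_0,T]$, $$|(K-\hat K)(\xi,\eta,t)|+\Bigl|\frac{4\alpha}{l(t)}\partial_\xi(K-\hat K)(\xi,0,t)\Bigr|+\Bigl|\Bigl(\partial_t-\frac{4\alpha}{l^2(t)}\partial_\xi\partial_\eta-\frac{\dot l(t)}{l(t)}(\xi\partial_\xi+\eta\partial_\eta)+\bar\lambda(\xi,\eta,t)\Bigr)(K-\hat K)(\xi,\eta,t)\Bigr|<\varepsilon,$$ then the closed-loop system satisfies $$\|v(\cdot,t)\|_{L^2(0,l(t))}\le C_IC_D\,e^{-\frac{\mu_0-C_0\varepsilon}{2}(t-t_0)}\,\|v(\cdot,t_0)\|_{L^2(0,l(t_0))},\qquad\forall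 t\in[t_0,T],$$ where $C_I:=1+\frac{\tau_Ql^*}{\sqrt2}$, $C_D:=1+\frac{\tau_Kl^*}{\sqrt2}$, $\mu_0:=\frac{4\alpha}{(l^* )^2}+2c$ and $C_0:=2C_I(1+l^* )$.
   Context: Constants: $t_0\ge0$, $\alpha>0$, $\lambda_0>0$, and $c\in\mathbb R$ (a tuning parameter). Standing assumption on $l$: $l$ is strictly positive and analytic, and there is a constant $\bar D>0$, independent of $t$ and $j$, with $|\partial_t^jl(t)|\le\bar D^{j+1}j!$ for all $t>t_0$ and all integers $j\ge0$. The constant $l^*>0$ is an upper bound: $\sup_{t\ge t_0}l(t)\le l^*$. Exact kernel: let $\bar S:=\{(\xi,\eta):0\le\eta\le\xi\le2-\eta\}$ and $$\bar\lambda(\xi,\eta,t)=-\frac{\dot l^2(t)+l(t)\ddot l(t)(\xi-\eta)}{4\alpha}+\lambda_0+c,\qquad f(\xi,t)=\frac{\xi\, l(t)}{4\alpha}\left[\frac{2\dot l^2(t)+\xi\, l(t)\ddot l(t)}{8\alpha}-(\lambda_0+c)\right].$$ $K\in C^2(\bar S\times[t_0,T])$ is the unique solution (existence and uniqueness known from the literature) of $$\partial_tK=\frac{4\alpha}{l^2(t)}\partial_\xi\partial_\eta K+\frac{\dot l(t)}{l(t)}\bigl(\xi\partial_\xi K+\eta\partial_\eta K\bigr)-\bar\lambda K,\qquad K(\xi,\xi,t)=0,\qquad K(\xi,0,t)=f(\xi,t),$$ and it is known that there is $M>0$ with $\|K(\cdot,\cdot,t)\|_{L^\infty(\bar S)}+\|\partial_tK(\cdot,\cdot,t)\|_{L^\infty(\bar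 S)}\le M$ for all $t\in[t_0,T]$. In the original variables $x=\frac{l(t)}2(\xi+\eta)$, $y=\frac{l(t)}2(\xi-\eta)$, the kernel $k(x,y,t):=K(\xi,\eta,t)$ on $S(t)=\{(x,y):0\le y\le x\le l(t)\}$ satisfies $k_t=\alpha(k_{xx}-k_{yy})-(\lambda(y,t)+c)k$, $k(x,0,t)=0$, $k(x,x,t)=-\frac1{2\alpha}\int_0^x(\lambda(s,t)+c)\,ds$. Approximate kernel: $\hat K$ is a (sufficiently smooth) function on $\bar S\times[t_0,T]$ produced by a neural operator, and $\hat k$ on $S(t)$ is defined by $\hat k\bigl(\tfrac{l(t)}2(\xi+\eta),\tfrac{l(t)}2(\xi-\eta),t\bigr):=\hat K(\xi,\eta,t)$. Let $\hat q$ be the kernel of the inverse $v(x,t)=\hat w(x,t)+\int_0^x\hat q(x,y,t)\hat w(y,t)\,dy$ of the transformation $\hat w(x,t)=v(x,t)-\int_0^x\hat k(x,y,t)v(y,t)\,dy$. Constants $\tau_K,\tau_Q$: positive constants with $\sup_{t\in[t_0,T]}\|\hat k(\cdot,\cdot,t)\|_{L^\infty(S(t))}\le\tau_K$ and $\sup_{t\in[t_0,T]}\|\hat q(\cdot,\cdot,t)\|_{L^\infty(S(t))}\le\tau_Q$; the paper takes $\tau_K:=M+\varepsilon$ and $\tau_Q:=\tau_Ke^{\tau_Kl^*}$. *)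

theory Defs
  imports "HOL-Analysis.Analysis"
begin

text \<open>Real-analyticity at \<open>t\<^sub>0\<close> itself is two-sided, i.e. on a neighbourhood of the closed half line
  \<open>[t\<^sub>0, \<infinity>)\<close>; this makes \<open>deriv l t\<^sub>0\<close> and \<open>deriv (deriv l) t\<^sub>0\<close> meaningful.\<close>

definition real_analytic_on :: "(real \<Rightarrow> real) \<Rightarrow> real set \<Rightarrow> bool" where
  "real_analytic_on f S \<longleftrightarrow>
     (\<forall>x\<in>S. \<exists>r>0. \<exists>a. \<forall>y. \<bar>y - x\<bar> < r \<longrightarrow> (\<lambda>n. a n * (y - x) ^ n) sums f y)"

text \<open>\<open>C\<^sup>2\<close> up to the boundary, and derivative of \<open>F\<close> in the direction \<open>u\<close>. The derivatives are
  Frechet derivatives within \<open>S\<close>; they are uniquely determined on the convex sets with nonempty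
  interior used below. One-dimensional sections of \<open>S\<close> are avoided because they degenerate to a
  point at some of its corners.\<close>

definition C2_on :: "('a::real_normed_vector \<Rightarrow> 'b::real_normed_vector) \<Rightarrow> 'a set \<Rightarrow> bool" where
  "C2_on F S \<longleftrightarrow>
     (\<exists>F' F''. (\<forall>p\<in>S. (F has_derivative blinfun_apply (F' p)) (at p within S)) \<and>
               (\<forall>p\<in>S. (F' has_derivative blinfun_apply (F'' p)) (at p within S)) \<and>
               continuous_on S F' \<and> continuous_on S F'')"

definition pd :: "'a set \<Rightarrow> 'a \<Rightarrow> ('a::real_normed_vector \<Rightarrow> 'b::real_normed_vector) \<Rightarrow> 'a \<Rightarrow> 'b" where
  "pd S u F p = frechet_derivative F (at p within S) u"

definition Sbar :: "(real \<times> real) set" where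
  "Sbar = {(\<xi>, \<eta>). 0 \<le> \<eta> \<and> \<eta> \<le> \<xi> \<and> \<xi> \<le> 2 - \<eta>}"

definition Dom :: "real \<Rightarrow> real \<Rightarrow> (real \<times> real \<times> real) set" where
  "Dom t0 T = {(\<xi>, \<eta>, t). (\<xi>, \<eta>) \<in> Sbar \<and> t \<in> {t0..T}}"

definition Stri :: "(real \<Rightarrow> real) \<Rightarrow> real \<Rightarrow> (real \<times> real) set" where
  "Stri l t = {(x, y). 0 \<le> y \<and> y \<le> x \<and> x \<le> l t}"

definition lam :: "real \<Rightarrow> real \<Rightarrow> (real \<Rightarrow> real) \<Rightarrow> real \<Rightarrow> real \<Rightarrow> real" where
  "lam \<alpha> lam0 l x t = lam0 - ((deriv l t)\<^sup>2 + 2 * deriv (deriv l) t * x) / (4 * \<alpha>)"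

definition lambar :: "real \<Rightarrow> real \<Rightarrow> real \<Rightarrow> (real \<Rightarrow> real) \<Rightarrow> real \<Rightarrow> real \<Rightarrow> real \<Rightarrow> real" where
  "lambar \<alpha> lam0 c l \<xi> \<eta> t =
     - (((deriv l t)\<^sup>2 + l t * deriv (deriv l) t * (\<xi> - \<eta>)) / (4 * \<alpha>)) + lam0 + c"

definition fbd :: "real \<Rightarrow> real \<Rightarrow> real \<Rightarrow> (real \<Rightarrow> real) \<Rightarrow> real \<Rightarrow> real \<Rightarrow> real" where
  "fbd \<alpha> lam0 c l \<xi> t =
     \<xi> * l t / (4 * \<alpha>) *
       ((2 * (deriv l t)\<^sup>2 + \<xi> * l t * deriv (deriv l) t) / (8 * \<alpha>) - (lam0 + c))"

definition kernel_solution ::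
  "real \<Rightarrow> real \<Rightarrow> real \<Rightarrow> (real \<Rightarrow> real) \<Rightarrow> real \<Rightarrow> real \<Rightarrow> (real \<times> real \<times> real \<Rightarrow> real) \<Rightarrow> bool" where
  "kernel_solution \<alpha> lam0 c l t0 T K \<longleftrightarrow>
     C2_on K (Dom t0 T) \<and>
     (\<forall>\<xi> \<eta> t. (\<xi>, \<eta>, t) \<in> Dom t0 T \<longrightarrow>
        pd (Dom t0 T) (0, 0, 1) K (\<xi>, \<eta>, t) =
          4 * \<alpha> / (l t)\<^sup>2 * pd (Dom t0 T) (1, 0, 0) (pd (Dom t0 T) (0, 1, 0) K) (\<xi>, \<eta>, t)
          + deriv l t / l t * (\<xi> * pd (Dom t0 T) (1, 0, 0) K (\<xi>, \<eta>, t)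
                               + \<eta> * pd (Dom t0 T) (0, 1, 0) K (\<xi>, \<eta>, t))
          - lambar \<alpha> lam0 c l \<xi> \<eta> t * K (\<xi>, \<eta>, t)) \<and>
     (\<forall>\<xi>\<in>{0..1}. \<forall>t\<in>{t0..T}. K (\<xi>, \<xi>, t) = 0) \<and>
     (\<forall>\<xi>\<in>{0..2}. \<forall>t\<in>{t0..T}. K (\<xi>, 0, t) = fbd \<alpha> lam0 c l \<xi> t)"

definition kernel_residual ::
  "real \<Rightarrow> real \<Rightarrow> real \<Rightarrow> (real \<Rightarrow> real) \<Rightarrow> real \<Rightarrow> real \<Rightarrow> (real \<times> real \<times> real \<Rightarrow> real)
     \<Rightarrow> real \<Rightarrow> real \<Rightarrow> real \<Rightarrow> real" where
  "kernel_residual \<alpha> lam0 c l t0 T G \<xi> \<eta> t =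
     pd (Dom t0 T) (0, 0, 1) G (\<xi>, \<eta>, t)
     - 4 * \<alpha> / (l t)\<^sup>2 * pd (Dom t0 T) (1, 0, 0) (pd (Dom t0 T) (0, 1, 0) G) (\<xi>, \<eta>, t)
     - deriv l t / l t * (\<xi> * pd (Dom t0 T) (1, 0, 0) G (\<xi>, \<eta>, t)
                          + \<eta> * pd (Dom t0 T) (0, 1, 0) G (\<xi>, \<eta>, t))
     + lambar \<alpha> lam0 c l \<xi> \<eta> t * G (\<xi>, \<eta>, t)"

text \<open>The kernel in the original variables: \<open>x = l(t)(\<xi>+\<eta>)/2\<close>, \<open>y = l(t)(\<xi>-\<eta>)/2\<close> solved for \<open>\<xi>, \<eta>\<close>.\<close>

definition orig_kernel ::
  "(real \<Rightarrow> real) \<Rightarrow> (real \<times> real \<times> real \<Rightarrow> real) \<Rightarrow> real \<Rightarrow> real \<Rightarrow> real \<Rightarrow> real" where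
  "orig_kernel l G x y t = G ((x + y) / l t, (x - y) / l t, t)"

definition feedback ::
  "real \<Rightarrow> (real \<Rightarrow> real) \<Rightarrow> (real \<Rightarrow> real \<Rightarrow> real \<Rightarrow> real) \<Rightarrow> (real \<Rightarrow> real \<Rightarrow> real) \<Rightarrow> real \<Rightarrow> real" where
  "feedback \<alpha> l k v t =
     (LINT y:{0..l t}|lborel.
        (deriv l t / (2 * \<alpha>) * k (l t) y t
         + pd (Stri l t) (1, 0) (\<lambda>(x, z). k x z t) (l t, y)) * v y t)
     + k (l t) (l t) t * v (l t) t"

definition L2norm :: "real \<Rightarrow> (real \<Rightarrow> real) \<Rightarrow> real" where
  "L2norm b g = sqrt (LINT x:{0<..<b}|lborel. (g x)\<^sup>2)"

definition in_L2 :: "real \<Rightarrow> (real \<Rightarrow> real) \<Rightarrow> bool" where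
  "in_L2 b g \<longleftrightarrow> set_borel_measurable lborel {0<..<b} g \<and>
                set_integrable lborel {0<..<b} (\<lambda>x. (g x)\<^sup>2)"

text \<open>Solutions on \<open>[t\<^sub>0, T]\<close> are classical up to the lateral boundaries for \<open>t > t\<^sub>0\<close>
  (\<open>v, v\<^sub>x, v\<^sub>x\<^sub>x, v\<^sub>t\<close> continuous), while the initial value is an arbitrary \<open>L\<^sup>2\<close> function that is
  attained in \<open>L\<^sup>2\<close>, functions on different intervals being compared after extension by zero.
  The time derivative is only required at interior \<open>x\<close>, since \<open>{s. x \<le> l s}\<close> need not be a
  neighbourhood of \<open>t\<close> when \<open>x = l t\<close>; the continuous function \<open>vt\<close> extends it to the boundary.\<close>

definition closed_loop_solution ::
  "real \<Rightarrow> real \<Rightarrow> (real \<Rightarrow> real) \<Rightarrow> real \<Rightarrow> real \<Rightarrow> (real \<Rightarrow> real \<Rightarrow> real \<Rightarrow> real)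
     \<Rightarrow> (real \<Rightarrow> real) \<Rightarrow> (real \<Rightarrow> real \<Rightarrow> real) \<Rightarrow> bool" where
  "closed_loop_solution \<alpha> lam0 l t0 T k v0 v \<longleftrightarrow>
     (\<exists>vx vxx vt.
        (let Q = {(x, t). t0 < t \<and> t \<le> T \<and> 0 \<le> x \<and> x \<le> l t} in
           continuous_on Q (\<lambda>(x, t). v x t) \<and> continuous_on Q (\<lambda>(x, t). vx x t) \<and>
           continuous_on Q (\<lambda>(x, t). vxx x t) \<and> continuous_on Q (\<lambda>(x, t). vt x t)) \<and>
        (\<forall>t\<in>{t0<..T}.
           (\<forall>x\<in>{0..l t}.
              ((\<lambda>z. v z t) has_real_derivative vx x t) (at x within {0..l t}) \<and>
              ((\<lambda>z. vx z t) has_real_derivative vxx x t) (at x within {0..l t})) \<and>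
           (\<forall>x\<in>{0<..<l t}.
              ((\<lambda>s. v x s) has_real_derivative vt x t) (at t within {t0<..T}) \<and>
              vt x t = \<alpha> * vxx x t + lam \<alpha> lam0 l x t * v x t) \<and>
           v 0 t = 0 \<and>
           vx (l t) t + deriv l t / (2 * \<alpha>) * v (l t) t = feedback \<alpha> l k v t)) \<and>
     in_L2 (l t0) v0 \<and>
     (\<forall>x\<in>{0<..<l t0}. v x t0 = v0 x) \<and>
     ((\<lambda>t. LINT x|lborel. (indicator {0<..<l t} x * v x t - indicator {0<..<l t0} x * v0 x)\<^sup>2)
        \<longlongrightarrow> 0) (at_right t0)"

definition tauK :: "real \<Rightarrow> real \<Rightarrow> real" where
  "tauK M \<epsilon> = M + \<epsilon>"

definition tauQ :: "real \<Rightarrow> real \<Rightarrow> real \<Rightarrow> real" where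
  "tauQ M lstar \<epsilon> = tauK M \<epsilon> * exp (tauK M \<epsilon> * lstar)"

definition CI :: "real \<Rightarrow> real \<Rightarrow> real \<Rightarrow> real" where
  "CI M lstar \<epsilon> = 1 + tauQ M lstar \<epsilon> * lstar / sqrt 2"

definition CD :: "real \<Rightarrow> real \<Rightarrow> real \<Rightarrow> real" where
  "CD M lstar \<epsilon> = 1 + tauK M \<epsilon> * lstar / sqrt 2"

definition mu0 :: "real \<Rightarrow> real \<Rightarrow> real \<Rightarrow> real" where
  "mu0 \<alpha> c lstar = 4 * \<alpha> / lstar\<^sup>2 + 2 * c"

definition C0 :: "real \<Rightarrow> real \<Rightarrow> real \<Rightarrow> real" where
  "C0 M lstar \<epsilon> = 2 * CI M lstar \<epsilon> * (1 + lstar)"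

end

theory Submission
  imports Defs
begin

text \<open>After rescaling to \<open>x \<in> [0, 1]\<close>, the backstepping transform \<open>z\<close> of \<open>u(t, x) = v(l(t) x, t)\<close> with
  the approximate kernel solves
  \<open>z\<^sub>t = \<alpha>/l\<^sup>2 z\<^sub>x\<^sub>x + (l'/l) x z\<^sub>x - c z + S\<close>, \<open>z(0) = 0\<close>, \<open>z\<^sub>x(1) = -(l l'/2\<alpha>) z(1)\<close>, and the source \<open>S\<close> is
  \<open>O(\<epsilon>)\<close> in terms of \<open>\<parallel>z\<parallel>\<close> and \<open>\<bar>z\<^sub>x(0)\<bar>\<close>. The trace \<open>z\<^sub>x(0)\<close> enters because the approximate kernel
  need not vanish where the exact one does (\<open>\<xi> = \<eta>\<close>); it is not controlled by the \<open>L\<^sup>2\<close> energy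
  identity. Parabolic smoothing controls it: for
  \<open>E = l \<parallel>z\<parallel>\<^sup>2 + O(\<epsilon>) (t - t\<^sub>1) (\<parallel>z\<^sub>x\<parallel>\<^sup>2 + (l l'/2\<alpha>) z(1)\<^sup>2)\<close> one finds
  \<open>E' \<le> -\<mu>\<^sub>0 E + O(\<epsilon>) (t - t\<^sub>1)\<^sup>-\<^sup>1\<^sup>/\<^sup>2 E\<close>, whose singular coefficient is integrable. This costs a factor
  \<open>1 + O(\<epsilon>)\<close>, which for small \<open>\<epsilon>\<close> is absorbed by the slack in \<open>C\<^sub>D\<close>: the integration operator on
  \<open>L\<^sup>2(0, 1)\<close> has norm at most \<open>2/3 < 1/\<surd>2\<close>. Since the solution is only classical for \<open>t > t\<^sub>0\<close>, the
  estimate starts at \<open>t\<^sub>1 > t\<^sub>0\<close>, and \<open>t\<^sub>1 \<rightarrow> t\<^sub>0\<close> in the end.\<close>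

section \<open>The \<open>L\<^sup>2\<close> norm on the unit interval\<close>

text \<open>The three summands of the closeness condition correspond to the three ways in which the
  transform can fail to be exact. The edge \<eta> = 0 is the diagonal y = x, where the tangential
  derivative of the kernel has to cancel the reaction term. The edge \<xi> = \<eta> is y = 0, where
  a nonzero kernel value multiplies the trace z_x(0). The interior carries the kernel equation. The
  exact kernel has no defect in any of them, so the defects of the approximate one are those of the
  difference. The obstacle is uniformity as t1 tends to t0. Nothing is known about z_x at t1, which
  forces the weight t - t1 on the Dirichlet energy, and constants that depend only on bounds over
  the whole of [t0, T]. The power -1/2 comes from interpolating z_x(0) between z_x and z_xx at the
  scale sqrt (t - t1). The factor l in the first energy cancels a drift term, and the boundary term
  of the second one is dictated by the Robin condition. The inverse transform is not constructed: a
  Gronwall argument on the primitive of |u| bounds it with the constant \<open>tauQ\<close>.\<close>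

definition nrm2 :: "(real \<Rightarrow> real) \<Rightarrow> real" where
  "nrm2 f = sqrt (integral {0..1} (\<lambda>x. (f x)\<^sup>2))"

lemma has_integral_real_derivative:
  fixes f :: "real \<Rightarrow> real"
  assumes "a \<le> b" "\<And>x. x \<in> {a..b} \<Longrightarrow> (f has_real_derivative f' x) (at x within {a..b})"
  shows "(f' has_integral f b - f a) {a..b}"
  using assms by (intro fundamental_theorem_of_calculus)
    (auto simp: has_real_derivative_iff_has_vector_derivative)

lemma integral_Cauchy_Schwarz:
  fixes f g :: "real \<Rightarrow> real"
  assumes f: "continuous_on {a..b} f" and g: "continuous_on {a..b} g"
  shows "(integral {a..b} (\<lambda>x. f x * g x))\<^sup>2
    \<le> integral {a..b} (\<lambda>x. (f x)\<^sup>2) * integral {a..b} (\<lambda>x. (g x)\<^sup>2)"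
proof -
  define A where "A = integral {a..b} (\<lambda>x. (f x)\<^sup>2)"
  define B where "B = integral {a..b} (\<lambda>x. f x * g x)"
  define C where "C = integral {a..b} (\<lambda>x. (g x)\<^sup>2)"
  have q: "0 \<le> A - 2 * s * B + s\<^sup>2 * C" for s
  proof -
    have "((\<lambda>x. (f x)\<^sup>2) has_integral A) {a..b}" "((\<lambda>x. f x * g x) has_integral B) {a..b}"
      "((\<lambda>x. (g x)\<^sup>2) has_integral C) {a..b}"
      unfolding A_def B_def C_def
      by (intro integrable_integral integrable_continuous_real continuous_intros f g)+
    then have "((\<lambda>x. (f x)\<^sup>2 - (2 * s) * (f x * g x) + s\<^sup>2 * (g x)\<^sup>2) has_integral
        A - (2 * s) * B + s\<^sup>2 * C) {a..b}"
      by (intro has_integral_add has_integral_diff has_integral_mult_right)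
    then have "((\<lambda>x. (f x - s * g x)\<^sup>2) has_integral A - (2 * s) * B + s\<^sup>2 * C) {a..b}"
      by (simp add: power2_eq_square algebra_simps)
    then show ?thesis by (rule has_integral_nonneg) auto
  qed
  have C0: "0 \<le> C" unfolding C_def by (intro integral_nonneg integrable_continuous_real continuous_intros g) auto
  have "B\<^sup>2 \<le> A * C"
  proof (cases "C = 0")
    case True
    \<comment> \<open>For \<open>C = 0\<close> the expression in \<open>q\<close> is affine in s;
      with a nonzero slope it would take the value -1 at the chosen s.\<close>
    have "B = 0"
    proof (rule ccontr)
      assume "B \<noteq> 0"
      then have "A - 2 * ((A + 1) / (2 * B)) * B = -1" by (simp add: field_simps)
      with q[of "(A + 1) / (2 * B)"] True show False by simp
    qed
    then show ?thesis using True by simp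
  next
    case False
    then have "C > 0" using C0 by simp
    then show ?thesis using q[of "B / C"] by (simp add: field_simps power2_eq_square)
  qed
  then show ?thesis by (simp add: A_def B_def C_def)
qed

lemma nrm2_nonneg:
  assumes f: "continuous_on {0..1} f"
  shows "0 \<le> nrm2 f"
  unfolding nrm2_def by (intro real_sqrt_ge_zero integral_nonneg integrable_continuous_real continuous_intros f) auto

lemma nrm2_square:
  assumes f: "continuous_on {0..1} f"
  shows "(nrm2 f)\<^sup>2 = integral {0..1} (\<lambda>x. (f x)\<^sup>2)"
  unfolding nrm2_def
  by (intro real_sqrt_pow2 integral_nonneg integrable_continuous_real continuous_intros f) auto

lemma nrm2_mono:
  assumes f: "continuous_on {0..1} f" and g: "continuous_on {0..1} g"
    and "\<And>x. x \<in> {0..1} \<Longrightarrow> \<bar>f x\<bar> \<le> \<bar>g x\<bar>"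
  shows "nrm2 f \<le> nrm2 g"
  unfolding nrm2_def
  by (intro real_sqrt_le_mono integral_le integrable_continuous_real continuous_intros f g)
    (use assms(3) in \<open>auto simp: abs_le_square_iff\<close>)

lemma nrm2_cmult: "nrm2 (\<lambda>x. c * f x) = \<bar>c\<bar> * nrm2 f"
  by (simp add: nrm2_def power_mult_distrib real_sqrt_mult)

lemma nrm2_const_le:
  assumes f: "continuous_on {0..1} f" and "\<And>x. x \<in> {0..1} \<Longrightarrow> \<bar>f x\<bar> \<le> c" "0 \<le> c"
  shows "nrm2 f \<le> c"
proof -
  have "(f x)\<^sup>2 \<le> c\<^sup>2" if "x \<in> {0..1}" for x
    using assms(2)[OF that] assms(3) by (metis abs_le_square_iff abs_of_nonneg)
  then have "integral {0..1} (\<lambda>x. (f x)\<^sup>2) \<le> integral {0..1} (\<lambda>x::real. c\<^sup>2)"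
    by (intro integral_le integrable_continuous_real continuous_intros f) auto
  then show ?thesis unfolding nrm2_def using assms(3)
    by (simp add: real_le_lsqrt)
qed

lemma integral_mult_le_nrm2:
  assumes f: "continuous_on {0..1} f" and g: "continuous_on {0..1} g"
  shows "\<bar>integral {0..1} (\<lambda>x. f x * g x)\<bar> \<le> nrm2 f * nrm2 g"
proof -
  have "\<bar>integral {0..1} (\<lambda>x. f x * g x)\<bar>\<^sup>2 \<le> (nrm2 f * nrm2 g)\<^sup>2"
    using integral_Cauchy_Schwarz[OF f g]
    by (simp add: power_mult_distrib nrm2_square[OF f] nrm2_square[OF g])
  then show ?thesis
    by (rule power2_le_imp_le) (simp add: nrm2_nonneg f g)
qed

lemma nrm2_triangle:
  assumes f: "continuous_on {0..1} f" and g: "continuous_on {0..1} g"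
  shows "nrm2 (\<lambda>x. f x + g x) \<le> nrm2 f + nrm2 g"
proof -
  have "((\<lambda>x. (f x)\<^sup>2) has_integral (nrm2 f)\<^sup>2) {0..1}"
    "((\<lambda>x. f x * g x) has_integral integral {0..1} (\<lambda>x. f x * g x)) {0..1}"
    "((\<lambda>x. (g x)\<^sup>2) has_integral (nrm2 g)\<^sup>2) {0..1}"
    unfolding nrm2_square[OF f] nrm2_square[OF g]
    by (intro integrable_integral integrable_continuous_real continuous_intros f g)+
  then have "((\<lambda>x. (f x)\<^sup>2 + 2 * (f x * g x) + (g x)\<^sup>2) has_integral
      (nrm2 f)\<^sup>2 + 2 * integral {0..1} (\<lambda>x. f x * g x) + (nrm2 g)\<^sup>2) {0..1}"
    by (intro has_integral_add has_integral_mult_right)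
  moreover have "(f x)\<^sup>2 + 2 * (f x * g x) + (g x)\<^sup>2 = (f x + g x)\<^sup>2" for x
    by (simp add: power2_eq_square algebra_simps)
  ultimately have "integral {0..1} (\<lambda>x. (f x + g x)\<^sup>2) = (nrm2 f)\<^sup>2 + 2 * integral {0..1} (\<lambda>x. f x * g x) + (nrm2 g)\<^sup>2"
    by (simp add: integral_unique)
  also have "\<dots> \<le> (nrm2 f + nrm2 g)\<^sup>2"
    using integral_mult_le_nrm2[OF f g] by (simp add: power2_eq_square algebra_simps abs_le_iff)
  finally show ?thesis
    unfolding nrm2_def[of "\<lambda>x. f x + g x"] by (intro real_le_lsqrt) (simp_all add: nrm2_nonneg f g)
qed

lemma Wirtinger_inequality:
  assumes F: "\<And>x. x \<in> {0..1} \<Longrightarrow> (F has_real_derivative f x) (at x within {0..1})"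
    and f: "continuous_on {0..1} f" and F0: "F 0 = 0"
  shows "nrm2 F \<le> 2 / 3 * nrm2 f"
proof -
  \<comment> \<open>\<open>\<phi>' = -(9/4 + \<phi>\<^sup>2)\<close> makes \<open>f\<^sup>2 - 9/4 F\<^sup>2 - (\<phi> F\<^sup>2)'\<close> the square of \<open>f - \<phi> F\<close>; any rate below \<open>\<pi>/2\<close>
    would do in place of \<open>3/2\<close>.\<close>
  define \<phi> where "\<phi> = (\<lambda>x::real. 3/2 * tan (3/2 * (1 - x)))"
  have cF: "continuous_on {0..1} F"
    using F by (meson DERIV_continuous continuous_on_eq_continuous_within)
  have cos_pos: "cos (3/2 * (1 - x)) > 0" if "x \<in> {0..1}" for x :: real
    using that pi_gt3 by (intro cos_gt_zero_pi) auto
  have d\<phi>: "(\<phi> has_real_derivative - (9/4 + (\<phi> x)\<^sup>2)) (at x within {0..1})" if "x \<in> {0..1}" for x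
  proof -
    have "cos (3/2 * (1 - x)) \<noteq> 0" using cos_pos[OF that] by simp
    moreover from this have "inverse ((cos (3/2 * (1 - x)))\<^sup>2) = 1 + (tan (3/2 * (1 - x)))\<^sup>2"
      by (rule tan_sec[symmetric, unfolded power_inverse])
    ultimately show ?thesis unfolding \<phi>_def
      by (auto intro!: derivative_eq_intros simp: field_simps power2_eq_square)
  qed
  then have c\<phi>: "continuous_on {0..1} \<phi>"
    by (meson DERIV_continuous continuous_on_eq_continuous_within)
  have "((\<lambda>x. - (9/4 + (\<phi> x)\<^sup>2) * (F x)\<^sup>2 + \<phi> x * (2 * F x * f x)) has_integral
      \<phi> 1 * (F 1)\<^sup>2 - \<phi> 0 * (F 0)\<^sup>2) {0..1}"
    by (rule has_integral_real_derivative) (auto intro!: derivative_eq_intros d\<phi> F)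
  \<comment> \<open>Both boundary terms vanish: \<open>\<phi> 1\<close> contains
    \<open>tan 0\<close>, and \<open>F 0 = 0\<close>.\<close>
  then have 1: "((\<lambda>x. - (9/4 + (\<phi> x)\<^sup>2) * (F x)\<^sup>2 + \<phi> x * (2 * F x * f x)) has_integral 0) {0..1}"
    by (simp add: \<phi>_def F0)
  have 2: "((\<lambda>x. (f x)\<^sup>2) has_integral (nrm2 f)\<^sup>2) {0..1}" "((\<lambda>x. (F x)\<^sup>2) has_integral (nrm2 F)\<^sup>2) {0..1}"
    unfolding nrm2_square[OF f] nrm2_square[OF cF]
    by (intro integrable_integral integrable_continuous_real continuous_intros f cF)+
  have "((\<lambda>x. (f x)\<^sup>2 - (- (9/4 + (\<phi> x)\<^sup>2) * (F x)\<^sup>2 + \<phi> x * (2 * F x * f x)) - 9/4 * (F x)\<^sup>2) has_integral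
     (nrm2 f)\<^sup>2 - 0 - 9/4 * (nrm2 F)\<^sup>2) {0..1}"
    by (intro has_integral_diff has_integral_mult_right 1 2)
  moreover have "(f x)\<^sup>2 - (- (9/4 + (\<phi> x)\<^sup>2) * (F x)\<^sup>2 + \<phi> x * (2 * F x * f x)) - 9/4 * (F x)\<^sup>2 = (f x - \<phi> x * F x)\<^sup>2" for x
    by (simp add: power2_eq_square algebra_simps)
  ultimately have "((\<lambda>x. (f x - \<phi> x * F x)\<^sup>2) has_integral (nrm2 f)\<^sup>2 - 0 - 9/4 * (nrm2 F)\<^sup>2) {0..1}"
    by simp
  then have "0 \<le> (nrm2 f)\<^sup>2 - 0 - 9/4 * (nrm2 F)\<^sup>2" by (rule has_integral_nonneg) auto
  then have "(nrm2 F)\<^sup>2 \<le> (2 / 3 * nrm2 f)\<^sup>2" by (simp add: power_mult_distrib power2_eq_square)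
  then show ?thesis by (rule power2_le_imp_le) (simp add: nrm2_nonneg f)
qed

section \<open>Energy estimate for the target system\<close>

text \<open>Here \<open>N, A, B\<close> stand for the norms of \<open>z, z\<^sub>x, z\<^sub>x\<^sub>x\<close>, \<open>g\<close> for \<open>z\<^sub>x(0)\<close>, \<open>s\<^sup>2\<close> for \<open>t - t\<^sub>1\<close>, and \<open>H\<close> bounds
  all coefficients. The weight \<open>\<delta>\<close> is chosen so that the dissipation \<open>\<delta> s\<^sup>2 B\<^sup>2 / H\<close> of the second
  energy absorbs the \<open>s\<^sup>2 B\<^sup>2\<close> produced by \<open>N g\<close>.\<close>

lemma energy_algebra:
  fixes N A B g z1 H \<epsilon> s l a c \<beta> \<beta>' \<alpha> L \<mu> J0 J1 :: real
  defines "\<delta> \<equiv> \<epsilon> * H^3" and "P \<equiv> 44 * H^7"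
  assumes nonneg: "0 \<le> N" "0 \<le> A" "0 \<le> B" and H: "1 \<le> H"
    and \<epsilon>: "0 < \<epsilon>" "300 * H^9 * \<epsilon> \<le> 1" and s: "0 < s" "s\<^sup>2 \<le> H"
    and NA: "N\<^sup>2 \<le> A\<^sup>2 / 2" and z1: "z1\<^sup>2 \<le> 2 * N * A" and g: "g\<^sup>2 \<le> A\<^sup>2 + 2 * A * B"
    and l: "1 / H \<le> l" "l \<le> H" "l \<le> L" and a: "1 / H \<le> a" "a = \<alpha> / l\<^sup>2"
    and bnds: "\<bar>\<beta>\<bar> \<le> H" "\<bar>\<beta>'\<bar> \<le> H" "\<bar>\<mu>\<bar> \<le> H" and \<mu>: "\<mu> = 4 * \<alpha> / L\<^sup>2 + 2 * c"
    and J0: "\<bar>J0\<bar> \<le> 2 * H * N * (\<epsilon> * H * (\<bar>g\<bar> + N))"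
    and J1: "\<bar>J1\<bar> \<le> 2 * B * (H * A + H * N + \<epsilon> * H * (\<bar>g\<bar> + N))"
  defines "E1 \<equiv> A\<^sup>2 + \<beta> * z1\<^sup>2"
  defines "E \<equiv> l * N\<^sup>2 + \<delta> * s\<^sup>2 * E1"
  shows "(- 2 * l * a * A\<^sup>2 - 2 * c * (l * N\<^sup>2) + J0) + \<delta> * E1
      + \<delta> * s\<^sup>2 * (- 2 * a * B\<^sup>2 - J1 + \<beta>' * z1\<^sup>2) + \<mu> * E \<le> \<epsilon> * (300 * H^9) * E / s" (is ?thesis1)
    and "(1 - \<epsilon> * H^7) * (l * N\<^sup>2) \<le> E" (is ?thesis2)
proof -
  have Hp: "H ^ m \<le> H ^ n" if "m \<le> n" for m n using H that by (rule power_increasing[rotated])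
  have Hp1: "1 \<le> H ^ n" for n using H by simp
  have H0: "0 < H" using H by simp
  have N_A: "N \<le> A" 
  proof (rule power2_le_imp_le)
    show "N\<^sup>2 \<le> A\<^sup>2" using NA zero_le_power2[of A] by linarith
  qed (use nonneg in simp)
  have sH: "s \<le> H" using s H
    by (intro power2_le_imp_le[of s H]) (auto simp: power2_eq_square intro: order_trans[of _ "H * 1"])
  have \<delta>0: "0 \<le> \<delta>" using \<epsilon> H0 by (simp add: \<delta>_def)
  have al: "\<alpha> = a * l\<^sup>2" "0 < l" "0 < a"
    using a l H0 by (auto intro: less_le_trans[of 0 "1/H"])
  have \<alpha>0: "0 < \<alpha>" using al by simp
  have gAB: "\<bar>g\<bar> \<le> A + B"
  proof (rule power2_le_imp_le)
    show "\<bar>g\<bar>\<^sup>2 \<le> (A + B)\<^sup>2" unfolding power2_sum power2_abs using g zero_le_power2[of B] by linarith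
  qed (use nonneg in simp)
  have NAA: "N * A \<le> A\<^sup>2" using N_A nonneg by (simp add: power2_eq_square mult_right_mono)
  have z1A: "z1\<^sup>2 \<le> 2 * A\<^sup>2" using z1 NAA by linarith
  have E1: "\<bar>E1\<bar> \<le> 3 * H * A\<^sup>2"
  proof -
    have "\<bar>\<beta> * z1\<^sup>2\<bar> \<le> H * (2 * A\<^sup>2)"
      unfolding abs_mult using bnds z1A H0 by (intro mult_mono) auto
    moreover have "1 * A\<^sup>2 \<le> H * A\<^sup>2" using H by (intro mult_right_mono) auto
    ultimately show ?thesis unfolding E1_def using zero_le_power2[of A] by linarith
  qed
  \<comment> \<open>The Robin term may be negative. The trace bound \<open>z1\<close> and the square
    \<open>(A - H * N)^2\<close> keep \<open>E1\<close> above a multiple of \<open>N^2\<close>,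
    which the first energy dominates once \<delta> is small.\<close>
  have E1_low: "- (H\<^sup>2 * N\<^sup>2) \<le> E1"
  proof -
    have "\<bar>\<beta> * z1\<^sup>2\<bar> \<le> H * (2 * N * A)"
      unfolding abs_mult using bnds z1 H0 by (intro mult_mono) auto
    moreover have "0 \<le> (A - H * N)\<^sup>2" by simp
    ultimately show ?thesis unfolding E1_def by (simp add: power2_eq_square algebra_simps)
  qed
  \<comment> \<open>Young's inequality at the scale s: the trace bound turns \<open>s * g^2\<close>
    into a term with \<open>s^2 * B^2\<close>, exactly the weight carried by the dissipation of the
    second energy. The price is the singular term \<open>N^2 / s\<close>.\<close>
  have Ng: "N * \<bar>g\<bar> \<le> (N\<^sup>2 / s + (H + 1) * A\<^sup>2 + s\<^sup>2 * B\<^sup>2) / 2"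
  proof -
    have "0 \<le> (N - s * \<bar>g\<bar>)\<^sup>2 / s" using s by simp
    also have "\<dots> = N\<^sup>2 / s - 2 * (N * \<bar>g\<bar>) + s * g\<^sup>2"
      using s by (simp add: power2_diff power2_eq_square field_simps)
    finally have "2 * (N * \<bar>g\<bar>) \<le> N\<^sup>2 / s + s * g\<^sup>2" by simp
    also have "s * g\<^sup>2 \<le> s * (A\<^sup>2 + 2 * A * B)" using g s by simp
    also have "\<dots> = s * A\<^sup>2 + 2 * A * (s * B)" by (simp add: algebra_simps)
    also have "2 * A * (s * B) \<le> A\<^sup>2 + (s * B)\<^sup>2" by (rule sum_squares_bound)
    also have "s * A\<^sup>2 \<le> H * A\<^sup>2" using sH by (intro mult_right_mono) auto
    finally show ?thesis by (simp add: power_mult_distrib algebra_simps)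
  qed
  have J0': "J0 \<le> \<epsilon> * H\<^sup>2 * (N\<^sup>2 / s) + \<epsilon> * (4 * H^7) * A\<^sup>2 + \<epsilon> * H\<^sup>2 * (s\<^sup>2 * B\<^sup>2)"
  proof -
    have "J0 \<le> \<epsilon> * (2 * H\<^sup>2) * (N * \<bar>g\<bar> + N\<^sup>2)"
      using J0 by (simp add: power2_eq_square algebra_simps abs_le_iff)
    also have "\<dots> \<le> \<epsilon> * (2 * H\<^sup>2) * ((N\<^sup>2 / s + (H + 1) * A\<^sup>2 + s\<^sup>2 * B\<^sup>2) / 2 + A\<^sup>2 / 2)"
      using Ng NA \<epsilon> by (intro mult_left_mono add_mono) auto
    also have "\<dots> = \<epsilon> * H\<^sup>2 * (N\<^sup>2 / s) + \<epsilon> * (H^3 + 2 * H\<^sup>2) * A\<^sup>2 + \<epsilon> * H\<^sup>2 * (s\<^sup>2 * B\<^sup>2)"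
      by (simp add: power2_eq_square power3_eq_cube algebra_simps)
    also have "\<epsilon> * (H^3 + 2 * H\<^sup>2) * A\<^sup>2 \<le> \<epsilon> * (4 * H^7) * A\<^sup>2"
      using Hp[of 3 7] Hp[of 2 7] Hp1[of 7] \<epsilon>(1) by (intro mult_right_mono mult_left_mono) auto
    finally show ?thesis by simp
  qed
  have \<epsilon>H: "\<epsilon> * (300 * H ^ n) \<le> 1" if "n \<le> 9" for n
  proof -
    have "\<epsilon> * (300 * H ^ n) \<le> \<epsilon> * (300 * H ^ 9)" using \<epsilon> Hp[OF that] by simp
    then show ?thesis using \<epsilon>(2) by (simp add: ac_simps)
  qed
  \<comment> \<open>Of the dissipation \<open>2 * B^2 / H\<close>, one quarter absorbs the cross
    term \<open>8 * (H * A) * B\<close> and one quarter the term of order \<epsilon>; half remains.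
    The constant 34 is 32 from the cross term plus 2 from the Robin term.\<close>
  have dE1: "- 2 * a * B\<^sup>2 - J1 + \<beta>' * z1\<^sup>2 \<le> - (1 / H) * B\<^sup>2 + 34 * H^3 * A\<^sup>2"
  proof -
    have "\<beta>' * z1\<^sup>2 \<le> H * (2 * A\<^sup>2)"
      using bnds z1A H0 by (intro mult_mono) auto
    moreover have "- J1 \<le> 8 * (H * A) * B + 2 * (\<epsilon> * H) * B\<^sup>2"
    proof -
      have "- J1 \<le> 2 * B * (H * A + H * N + \<epsilon> * H * (\<bar>g\<bar> + N))" using J1 by simp
      also have "\<dots> \<le> 2 * B * (H * A + H * A + \<epsilon> * H * ((A + B) + A))"
        using gAB N_A nonneg H0 \<epsilon> by (intro mult_left_mono add_mono) auto
      also have "\<dots> = 4 * (H * A * B) + 4 * (\<epsilon> * (H * A * B)) + 2 * (\<epsilon> * H) * B\<^sup>2"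
        by (simp add: power2_eq_square algebra_simps)
      also have "\<epsilon> * (H * A * B) \<le> 1 * (H * A * B)"
        using \<epsilon>H[of 0] nonneg H0 by (intro mult_right_mono) auto
      finally show ?thesis by (simp add: ac_simps)
    qed
    moreover have "8 * (H * A) * B \<le> 32 * H^3 * A\<^sup>2 + B\<^sup>2 / (2 * H)"
    proof -
      have "8 * (H * A) * B * (2 * H) = 2 * (8 * H\<^sup>2 * A) * B"
        by (simp add: power2_eq_square)
      also have "\<dots> \<le> (8 * H\<^sup>2 * A)\<^sup>2 + B\<^sup>2" by (rule sum_squares_bound)
      also have "\<dots> = (32 * H^3 * A\<^sup>2 + B\<^sup>2 / (2 * H)) * (2 * H)"
        using H0 by (simp add: distrib_right power_mult_distrib eval_nat_numeral)
      finally show ?thesis by (rule mult_right_le_imp_le) (use H0 in simp)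
    qed
    moreover have "2 * (\<epsilon> * H) * B\<^sup>2 \<le> (1 / (2 * H)) * B\<^sup>2"
    proof (intro mult_right_mono)
      have "(2 * (\<epsilon> * H)) * (2 * H) \<le> 1" using \<epsilon>H[of 2] \<epsilon> H0 by (simp add: power2_eq_square)
      then show "2 * (\<epsilon> * H) \<le> 1 / (2 * H)" using H0 by (simp add: pos_le_divide_eq)
    qed simp
    moreover have "- 2 * a * B\<^sup>2 \<le> - 2 * (1 / H) * B\<^sup>2"
      using a by (intro mult_right_mono) auto
    moreover have "H * (2 * A\<^sup>2) \<le> 2 * H^3 * A\<^sup>2"
      using Hp[of 1 3] by (simp add: mult_right_mono)
    ultimately show ?thesis by (simp add: algebra_simps)
  qed
  \<comment> \<open>Since \<open>\<delta> / H = \<epsilon> * H^2\<close>, the remaining dissipation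
    cancels the last term of \<open>J0'\<close> exactly.\<close>
  have dE1': "\<delta> * s\<^sup>2 * (- 2 * a * B\<^sup>2 - J1 + \<beta>' * z1\<^sup>2) \<le> - (\<epsilon> * H\<^sup>2 * (s\<^sup>2 * B\<^sup>2)) + \<epsilon> * (34 * H^7) * A\<^sup>2"
  proof -
    have "\<delta> * s\<^sup>2 * (- 2 * a * B\<^sup>2 - J1 + \<beta>' * z1\<^sup>2) \<le> \<delta> * s\<^sup>2 * (- (1 / H) * B\<^sup>2 + 34 * H^3 * A\<^sup>2)"
      using dE1 \<delta>0 by (intro mult_left_mono) auto
    also have "\<dots> = - (\<epsilon> * H\<^sup>2 * (s\<^sup>2 * B\<^sup>2)) + (\<delta> * (34 * H^3) * A\<^sup>2) * s\<^sup>2"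
      using H0 by (simp add: \<delta>_def field_simps power2_eq_square power3_eq_cube)
    also have "(\<delta> * (34 * H^3) * A\<^sup>2) * s\<^sup>2 \<le> (\<delta> * (34 * H^3) * A\<^sup>2) * H"
      using s \<delta>0 H0 by (intro mult_left_mono) auto
    also have "\<dots> = \<epsilon> * (34 * H^7) * A\<^sup>2" by (simp add: \<delta>_def eval_nat_numeral algebra_simps)
    finally show ?thesis by simp
  qed
  have \<delta>E1: "\<delta> * E1 \<le> \<epsilon> * (3 * H^7) * A\<^sup>2"
  proof -
    have "\<delta> * E1 \<le> \<delta> * (3 * H * A\<^sup>2)" using E1 \<delta>0 by (intro mult_left_mono) auto
    also have "\<dots> = \<epsilon> * (3 * H^4) * A\<^sup>2" by (simp add: \<delta>_def eval_nat_numeral algebra_simps)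
    also have "\<dots> \<le> \<epsilon> * (3 * H^7) * A\<^sup>2" using Hp[of 4 7] \<epsilon> by (intro mult_right_mono mult_left_mono) auto
    finally show ?thesis .
  qed
  have \<mu>E1: "\<mu> * (\<delta> * s\<^sup>2 * E1) \<le> \<epsilon> * (3 * H^7) * A\<^sup>2"
  proof -
    have "\<mu> * (\<delta> * s\<^sup>2 * E1) \<le> \<bar>\<mu>\<bar> * (\<delta> * s\<^sup>2 * \<bar>E1\<bar>)"
    proof -
      have "\<bar>\<mu> * (\<delta> * s\<^sup>2 * E1)\<bar> = \<bar>\<mu>\<bar> * (\<delta> * s\<^sup>2 * \<bar>E1\<bar>)"
        using \<delta>0 by (simp add: abs_mult)
      then show ?thesis by linarith
    qed
    also have "\<dots> \<le> H * (\<delta> * H * (3 * H * A\<^sup>2))"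
      using bnds E1 \<delta>0 s H0 by (intro mult_mono) auto
    also have "\<dots> = \<epsilon> * (3 * H^6) * A\<^sup>2" by (simp add: \<delta>_def eval_nat_numeral algebra_simps)
    also have "\<dots> \<le> \<epsilon> * (3 * H^7) * A\<^sup>2" using Hp[of 6 7] \<epsilon> by (intro mult_right_mono mult_left_mono) auto
    finally show ?thesis .
  qed
  \<comment> \<open>\<open>P\<close> collects the coefficients of \<open>A^2\<close> in
    \<open>J0'\<close>, \<open>dE1'\<close>, \<open>\<delta>E1\<close> and \<open>\<mu>E1\<close>: 4
    + 34 + 3 + 3 = 44. Smallness of \<epsilon> keeps \<open>2 * l * a - \<epsilon> * P\<close>
    nonnegative, so \<open>NA\<close> applies to all of it. The main part yields
    \<open>4 * l * a * N^2\<close>, which pays for the rate because l \<le> L; the rest is of order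
    \<epsilon>.\<close>
  have main: "- 2 * l * a * A\<^sup>2 + \<epsilon> * P * A\<^sup>2 + 4 * \<alpha> / L\<^sup>2 * (l * N\<^sup>2) \<le> \<epsilon> * (2 * P) * N\<^sup>2"
  proof -
    have "\<epsilon> * P \<le> 2 * (1 / H * (1 / H))"
    proof -
      have "\<epsilon> * P * H\<^sup>2 = \<epsilon> * (44 * H ^ 9)" by (simp add: P_def eval_nat_numeral)
      also have "\<dots> \<le> 2" using \<epsilon>H[of 9] H0 \<epsilon> by simp
      finally have "\<epsilon> * P \<le> 2 / H\<^sup>2" using H0 by (simp add: pos_le_divide_eq)
      then show ?thesis by (simp add: power2_eq_square)
    qed
    also have "\<dots> \<le> 2 * (l * a)" using a(1) l(1) H0 al(2) by (intro mult_left_mono mult_mono) auto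
    finally have "(2 * l * a - \<epsilon> * P) * (2 * N\<^sup>2) \<le> (2 * l * a - \<epsilon> * P) * A\<^sup>2"
      using NA by (intro mult_left_mono) auto
    moreover have "4 * \<alpha> / L\<^sup>2 * (l * N\<^sup>2) \<le> 4 * \<alpha> / l\<^sup>2 * (l * N\<^sup>2)"
      using l al \<alpha>0 by (intro mult_right_mono divide_left_mono) (auto intro!: power_mono)
    moreover have "4 * \<alpha> / l\<^sup>2 * (l * N\<^sup>2) = 4 * l * a * N\<^sup>2" using al(2) by (simp add: al(1))
    ultimately show ?thesis by (simp add: algebra_simps)
  qed
  have low: "(1 - \<epsilon> * H^7) * (l * N\<^sup>2) \<le> E"
  proof -
    have "\<delta> * s\<^sup>2 * (H\<^sup>2 * N\<^sup>2) \<le> \<delta> * H * (H\<^sup>2 * N\<^sup>2)"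
      using s \<delta>0 H0 by (intro mult_right_mono mult_left_mono) auto
    also have "\<dots> = \<epsilon> * H^7 * (1 / H * N\<^sup>2)" using H0 by (simp add: \<delta>_def eval_nat_numeral field_simps)
    also have "\<dots> \<le> \<epsilon> * H^7 * (l * N\<^sup>2)" using \<epsilon> H0 l by (intro mult_left_mono mult_right_mono) auto
    finally have "\<delta> * s\<^sup>2 * (H\<^sup>2 * N\<^sup>2) \<le> \<epsilon> * H^7 * (l * N\<^sup>2)" .
    moreover have "\<delta> * s\<^sup>2 * (- (H\<^sup>2 * N\<^sup>2)) \<le> \<delta> * s\<^sup>2 * E1"
      using E1_low \<delta>0 by (intro mult_left_mono) auto
    ultimately show ?thesis by (simp add: E_def algebra_simps)
  qed
  then show ?thesis2 .
  have NE: "N\<^sup>2 \<le> 2 * H * E"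
  proof -
    have "(1/2) * (l * N\<^sup>2) \<le> (1 - \<epsilon> * H^7) * (l * N\<^sup>2)"
      using \<epsilon>H[of 7] al \<epsilon> by (intro mult_right_mono) auto
    also note low
    finally have "(1/2) * (1 / H * N\<^sup>2) \<le> E"
      using mult_right_mono[OF l(1) zero_le_power2[of N]] by linarith
    then show ?thesis using H0 by (simp add: field_simps)
  qed
  have "(- 2 * l * a * A\<^sup>2 - 2 * c * (l * N\<^sup>2) + J0) + \<delta> * E1
      + \<delta> * s\<^sup>2 * (- 2 * a * B\<^sup>2 - J1 + \<beta>' * z1\<^sup>2) + \<mu> * E
    = - 2 * l * a * A\<^sup>2 + 4 * \<alpha> / L\<^sup>2 * (l * N\<^sup>2) + J0 + \<delta> * E1
      + \<delta> * s\<^sup>2 * (- 2 * a * B\<^sup>2 - J1 + \<beta>' * z1\<^sup>2) + \<mu> * (\<delta> * s\<^sup>2 * E1)"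
    unfolding \<mu> E_def by (simp add: algebra_simps)
  also have "\<dots> \<le> - 2 * l * a * A\<^sup>2 + 4 * \<alpha> / L\<^sup>2 * (l * N\<^sup>2) + \<epsilon> * H\<^sup>2 * (N\<^sup>2 / s) + \<epsilon> * P * A\<^sup>2"
    using J0' \<delta>E1 dE1' \<mu>E1 by (simp add: P_def algebra_simps)
  also have "\<dots> \<le> \<epsilon> * (2 * P) * N\<^sup>2 + \<epsilon> * H\<^sup>2 * (N\<^sup>2 / s)" using main by simp
  \<comment> \<open>As s \<le> H, the regular term can be merged into the singular one. The
    constants are 2 * 44 * H^8 + H^2 \<le> 89 * H^8, then 178 * H^9 after \<open>NE\<close>, rounded
    up to the 300 of the smallness condition.\<close>
  also have "\<dots> \<le> \<epsilon> * (2 * P) * (H * (N\<^sup>2 / s)) + \<epsilon> * H\<^sup>2 * (N\<^sup>2 / s)"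
  proof -
    have "N\<^sup>2 \<le> H * (N\<^sup>2 / s)" using mult_right_mono[OF sH zero_le_power2[of N]] s by (simp add: field_simps)
    then show ?thesis using \<epsilon> H0 by (intro add_right_mono mult_left_mono) (auto simp: P_def)
  qed
  also have "\<dots> = \<epsilon> * (88 * H^8 + H^2) * (N\<^sup>2 / s)" by (simp add: P_def eval_nat_numeral algebra_simps)
  also have "\<dots> \<le> \<epsilon> * (89 * H^8) * (N\<^sup>2 / s)"
    using Hp[of 2 8] \<epsilon> s by (intro mult_right_mono mult_left_mono) auto
  also have "\<dots> \<le> \<epsilon> * (89 * H^8) * (2 * H * E / s)"
    using NE \<epsilon> s H0 by (intro mult_left_mono divide_right_mono) auto
  also have "\<dots> = (\<epsilon> * (178 * H^9)) * (E / s)" by (simp add: eval_nat_numeral algebra_simps)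
  also have "\<dots> \<le> (\<epsilon> * (300 * H^9)) * (E / s)"
  proof -
    have "0 \<le> 2 * H * E" using NE zero_le_power2[of N] by linarith
    then have "0 \<le> E" using H0 by (simp add: zero_le_mult_iff)
    then show ?thesis using \<epsilon> H0 s by (intro mult_right_mono mult_left_mono) auto
  qed
  finally show ?thesis1 by simp
qed

section \<open>Differentiating the two energies in time\<close>

lemma continuous_on_slice:
  assumes "continuous_on (U \<times> V) (\<lambda>(t, x). f t x)" "t \<in> U"
  shows "continuous_on V (f t)"
proof -
  have "continuous_on V (\<lambda>x. (\<lambda>(t, x). f t x) (t, x))"
    by (rule continuous_on_compose2[OF assms(1)]) (use assms(2) in \<open>auto intro!: continuous_intros\<close>)
  then show ?thesis by simp
qed

lemma continuous_on_slice2: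
  assumes "continuous_on (U \<times> V) (\<lambda>(t, x). f t x)" "x \<in> V"
  shows "continuous_on U (\<lambda>t. f t x)"
proof -
  have "continuous_on U (\<lambda>t. (\<lambda>(t, x). f t x) (t, x))"
    by (rule continuous_on_compose2[OF assms(1)]) (use assms(2) in \<open>auto intro!: continuous_intros\<close>)
  then show ?thesis by simp
qed

lemma has_real_derivative_integral_square:
  fixes z zt :: "real \<Rightarrow> real \<Rightarrow> real"
  assumes z: "continuous_on ({a..b} \<times> {0..1}) (\<lambda>(t, x). z t x)"
    and zt: "continuous_on ({a..b} \<times> {0..1}) (\<lambda>(t, x). zt t x)"
    and dz: "\<And>t x. t \<in> {a..b} \<Longrightarrow> x \<in> {0..1} \<Longrightarrow>
      ((\<lambda>s. z s x) has_real_derivative zt t x) (at t within {a..b})"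
    and t: "t \<in> {a..b}"
  shows "((\<lambda>s. integral {0..1} (\<lambda>x. (z s x)\<^sup>2)) has_real_derivative
    integral {0..1} (\<lambda>x. 2 * (z t x * zt t x))) (at t within {a..b})"
proof -
  have "((\<lambda>s. integral (cbox 0 1) (\<lambda>x. (z s x)\<^sup>2)) has_real_derivative
    integral (cbox 0 1) (\<lambda>x. 2 * (z t x * zt t x))) (at t within {a..b})"
  proof (rule leibniz_rule_field_derivative)
    show "((\<lambda>s. (z s x)\<^sup>2) has_real_derivative 2 * (z t x * zt t x)) (at t within {a..b})"
      if "t \<in> {a..b}" "x \<in> cbox 0 1" for t x
      using that by (auto intro!: derivative_eq_intros dz)
    show "(\<lambda>x. (z t x)\<^sup>2) integrable_on cbox 0 1" if "t \<in> {a..b}" for t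
      using continuous_on_slice[OF z that]
      by (auto intro!: integrable_continuous_real continuous_intros)
    show "continuous_on ({a..b} \<times> cbox 0 1) (\<lambda>(t, x). 2 * (z t x * zt t x))"
      using z zt by (auto simp: split_beta intro!: continuous_intros)
  qed (use t in auto)
  then show ?thesis by simp
qed

text \<open>The quotient is the mean of \<open>zt\<close> over the segment from t to s, an integral
  over the unit interval that depends continuously on s and x. At s = t the integrand is constant,
  which gives the value on the diagonal.\<close>

lemma continuous_on_difference_quotient:
  fixes z zt :: "real \<Rightarrow> real \<Rightarrow> real"
  assumes zt: "continuous_on ({a..b} \<times> U) (\<lambda>(t, x). zt t x)"
    and dz: "\<And>t x. t \<in> {a..b} \<Longrightarrow> x \<in> U \<Longrightarrow>
      ((\<lambda>s. z s x) has_real_derivative zt t x) (at t within {a..b})"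
    and t: "t \<in> {a..b}"
  shows "continuous_on ({a..b} \<times> U) (\<lambda>(s, x). if s = t then zt t x else (z s x - z t x) / (s - t))"
proof -
  have mem: "t + \<theta> * (s - t) \<in> {a..b}" if "s \<in> {a..b}" "\<theta> \<in> {0..1}" for s \<theta>
  proof -
    have "t + \<theta> * (s - t) = (1 - \<theta>) *\<^sub>R t + \<theta> *\<^sub>R s" by (simp add: algebra_simps)
    also have "\<dots> \<in> {a..b}" using that t by (intro convexD) auto
    finally show ?thesis .
  qed
  have "continuous_on ({a..b} \<times> U) (\<lambda>p. integral (cbox 0 1) (\<lambda>\<theta>. zt (t + \<theta> * (fst p - t)) (snd p)))"
  proof (rule integral_continuous_on_param)
    have "continuous_on (({a..b} \<times> U) \<times> cbox 0 1)
       (\<lambda>q. (\<lambda>(t, x). zt t x) (t + snd q * (fst (fst q) - t), snd (fst q)))"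
      by (rule continuous_on_compose2[OF zt]) (use mem in \<open>auto intro!: continuous_intros\<close>)
    then show "continuous_on (({a..b} \<times> U) \<times> cbox 0 1)
       (\<lambda>(p, \<theta>). zt (t + \<theta> * (fst p - t)) (snd p))"
      by (simp add: split_beta)
  qed
  then show ?thesis
  proof (rule continuous_on_eq)
    fix p assume p: "p \<in> {a..b} \<times> U"
    obtain s x where sx: "p = (s, x)" "s \<in> {a..b}" "x \<in> U" using p by auto
    show "integral (cbox 0 1) (\<lambda>\<theta>. zt (t + \<theta> * (fst p - t)) (snd p))
      = (case p of (s, x) \<Rightarrow> if s = t then zt t x else (z s x - z t x) / (s - t))"
    proof (cases "s = t")
      case False
      have "((\<lambda>\<theta>. zt (t + \<theta> * (s - t)) x * (s - t)) has_integral z (t + 1 * (s - t)) x - z (t + 0 * (s - t)) x) {0..1}"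
      proof (rule has_integral_real_derivative)
        fix \<theta> :: real assume \<theta>: "\<theta> \<in> {0..1}"
        have "((\<lambda>s. z s x) has_real_derivative zt (t + \<theta> * (s - t)) x) (at (t + \<theta> * (s - t)) within (\<lambda>\<theta>. t + \<theta> * (s - t)) ` {0..1})"
          using dz[OF mem[OF sx(2) \<theta>] sx(3)]
          by (rule DERIV_subset) (use mem sx in auto)
        moreover have "((\<lambda>\<theta>. t + \<theta> * (s - t)) has_real_derivative (s - t)) (at \<theta> within {0..1})"
          by (auto intro!: derivative_eq_intros)
        ultimately have "((\<lambda>s. z s x) \<circ> (\<lambda>\<theta>. t + \<theta> * (s - t)) has_real_derivative zt (t + \<theta> * (s - t)) x * (s - t)) (at \<theta> within {0..1})"
          by (rule DERIV_image_chain)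
        then show "((\<lambda>\<theta>. z (t + \<theta> * (s - t)) x) has_real_derivative zt (t + \<theta> * (s - t)) x * (s - t)) (at \<theta> within {0..1})"
          by (simp add: o_def)
      qed simp
      then have "((\<lambda>\<theta>. (zt (t + \<theta> * (s - t)) x * (s - t)) * (1 / (s - t))) has_integral (z s x - z t x) * (1 / (s - t))) {0..1}"
        by (intro has_integral_mult_left) simp
      then have "((\<lambda>\<theta>. zt (t + \<theta> * (s - t)) x) has_integral (z s x - z t x) / (s - t)) {0..1}"
        using False by simp
      then show ?thesis using False by (simp add: sx integral_unique)
    qed (simp add: sx)
  qed
qed

text \<open>No mixed derivative \<open>\<partial>\<^sub>t \<partial>\<^sub>x z\<close> is available, so the difference quotient of the Dirichlet energy is
  integrated by parts before the limit is taken.\<close>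

lemma has_real_derivative_Dirichlet_energy:
  fixes z zx zxx zt :: "real \<Rightarrow> real \<Rightarrow> real"
  assumes z: "continuous_on ({a..b} \<times> {0..1}) (\<lambda>(t, x). z t x)"
    and zx: "continuous_on ({a..b} \<times> {0..1}) (\<lambda>(t, x). zx t x)"
    and zxx: "continuous_on ({a..b} \<times> {0..1}) (\<lambda>(t, x). zxx t x)"
    and zt: "continuous_on ({a..b} \<times> {0..1}) (\<lambda>(t, x). zt t x)"
    and dz: "\<And>t x. t \<in> {a..b} \<Longrightarrow> x \<in> {0..1} \<Longrightarrow>
      ((\<lambda>s. z s x) has_real_derivative zt t x) (at t within {a..b})"
    and dzx: "\<And>t x. t \<in> {a..b} \<Longrightarrow> x \<in> {0..1} \<Longrightarrow> (z t has_real_derivative zx t x) (at x within {0..1})"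
    and dzxx: "\<And>t x. t \<in> {a..b} \<Longrightarrow> x \<in> {0..1} \<Longrightarrow> (zx t has_real_derivative zxx t x) (at x within {0..1})"
    and t: "t \<in> {a..b}"
  shows "((\<lambda>s. integral {0..1} (\<lambda>x. (zx s x)\<^sup>2)) has_real_derivative
    2 * (zt t 1 * zx t 1 - zt t 0 * zx t 0 - integral {0..1} (\<lambda>x. zt t x * zxx t x))) (at t within {a..b})"
proof -
  define q where "q = (\<lambda>s x. if s = t then zt t x else (z s x - z t x) / (s - t))"
  have q: "continuous_on ({a..b} \<times> {0..1}) (\<lambda>(s, x). q s x)"
    unfolding q_def by (rule continuous_on_difference_quotient[OF zt dz t])
  \<comment> \<open>The difference of the squares of \<open>zx s\<close> and \<open>zx t\<close>
    factors into difference times sum. Moving the x-derivative off the difference leaves only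
    \<open>q\<close>, whose limit as s tends to t is known.\<close>
  define G where "G = (\<lambda>s. q s 1 * (zx s 1 + zx t 1) - q s 0 * (zx s 0 + zx t 0)
    - integral {0..1} (\<lambda>x. q s x * (zxx s x + zxx t x)))"
  have zxxt: "continuous_on ({a..b} \<times> {0..1}) (\<lambda>(s, x). zxx t x)"
    unfolding split_beta
    by (rule continuous_on_compose2[OF continuous_on_slice[OF zxx t]]) (auto intro!: continuous_intros)
  have "continuous_on {a..b} (\<lambda>s. integral (cbox 0 1) (\<lambda>x. q s x * (zxx s x + zxx t x)))"
    by (rule integral_continuous_on_param) (use q zxx zxxt in \<open>auto simp: split_beta intro!: continuous_intros\<close>)
  then have "continuous_on {a..b} G"
    unfolding G_def using continuous_on_slice2[OF q] continuous_on_slice2[OF zx]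
    by (auto intro!: continuous_intros)
  then have "(G \<longlongrightarrow> G t) (at t within {a..b})" using t by (simp add: continuous_on_def)
  moreover have "\<forall>\<^sub>F s in at t within {a..b}. G s =
      (integral {0..1} (\<lambda>x. (zx s x)\<^sup>2) - integral {0..1} (\<lambda>x. (zx t x)\<^sup>2)) / (s - t)"
    unfolding eventually_at_filter
  proof (intro always_eventually allI impI)
    fix s assume s: "s \<noteq> t" "s \<in> {a..b}"
    note sl = continuous_on_slice[OF zx s(2)] continuous_on_slice[OF zx t]
       continuous_on_slice[OF zxx s(2)] continuous_on_slice[OF zxx t] continuous_on_slice[OF q s(2)]
    have "((\<lambda>x. ((zx s x - zx t x) * (zx s x + zx t x) + (z s x - z t x) * (zxx s x + zxx t x))) has_integral
       (z s 1 - z t 1) * (zx s 1 + zx t 1) - (z s 0 - z t 0) * (zx s 0 + zx t 0)) {0..1}"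
      using s t by (intro has_integral_real_derivative) (auto intro!: derivative_eq_intros dzx dzxx)
    then have "((\<lambda>x. ((zx s x - zx t x) * (zx s x + zx t x) + (z s x - z t x) * (zxx s x + zxx t x)) * (1 / (s - t))) has_integral
       ((z s 1 - z t 1) * (zx s 1 + zx t 1) - (z s 0 - z t 0) * (zx s 0 + zx t 0)) * (1 / (s - t))) {0..1}"
      by (rule has_integral_mult_left)
    moreover have "((\<lambda>x. ((zx s x)\<^sup>2 - (zx t x)\<^sup>2) * (1 / (s - t)) + q s x * (zxx s x + zxx t x)) has_integral
       (integral {0..1} (\<lambda>x. (zx s x)\<^sup>2) - integral {0..1} (\<lambda>x. (zx t x)\<^sup>2)) * (1 / (s - t))
       + integral {0..1} (\<lambda>x. q s x * (zxx s x + zxx t x))) {0..1}"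
      by (intro has_integral_add has_integral_mult_left has_integral_diff integrable_integral
        integrable_continuous_real continuous_intros sl)
    moreover have "((zx s x - zx t x) * (zx s x + zx t x) + (z s x - z t x) * (zxx s x + zxx t x)) * (1 / (s - t))
      = ((zx s x)\<^sup>2 - (zx t x)\<^sup>2) * (1 / (s - t)) + q s x * (zxx s x + zxx t x)" for x
    proof -
      have "(zx s x - zx t x) * (zx s x + zx t x) = (zx s x)\<^sup>2 - (zx t x)\<^sup>2"
        by (simp add: power2_eq_square algebra_simps)
      then show ?thesis using s(1) by (simp add: q_def distrib_right add_divide_distrib)
    qed
    ultimately have "((z s 1 - z t 1) * (zx s 1 + zx t 1) - (z s 0 - z t 0) * (zx s 0 + zx t 0)) * (1 / (s - t))
      = (integral {0..1} (\<lambda>x. (zx s x)\<^sup>2) - integral {0..1} (\<lambda>x. (zx t x)\<^sup>2)) * (1 / (s - t))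
       + integral {0..1} (\<lambda>x. q s x * (zxx s x + zxx t x))"
      by (metis (no_types, lifting) ext has_integral_unique)
    then show "G s = (integral {0..1} (\<lambda>x. (zx s x)\<^sup>2) - integral {0..1} (\<lambda>x. (zx t x)\<^sup>2)) / (s - t)"
      using s(1) by (simp add: G_def q_def left_diff_distrib diff_divide_distrib)
  qed
  ultimately have "((\<lambda>s. (integral {0..1} (\<lambda>x. (zx s x)\<^sup>2) - integral {0..1} (\<lambda>x. (zx t x)\<^sup>2)) / (s - t)) \<longlongrightarrow> G t)
     (at t within {a..b})"
    by (rule Lim_transform_eventually)
  moreover have "G t = 2 * (zt t 1 * zx t 1 - zt t 0 * zx t 0 - integral {0..1} (\<lambda>x. zt t x * zxx t x))"
  proof -
    have "integral {0..1} (\<lambda>x. zt t x * (zxx t x + zxx t x)) = 2 * integral {0..1} (\<lambda>x. zt t x * zxx t x)"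
      by (subst integral_mult_right[symmetric]) (simp add: algebra_simps)
    then show ?thesis by (simp add: G_def q_def algebra_simps)
  qed
  ultimately show ?thesis by (simp add: has_field_derivative_iff)
qed

text \<open>The singular coefficient \<open>\<epsilon> * P / sqrt (t - t1)\<close> has the primitive
  \<open>2 * P * \<epsilon> * sqrt (t - t1)\<close>, at most \<open>600 * H^10 * \<epsilon>\<close>,
  which is the loss in the exponent. The factor \<open>1 - \<epsilon> * H^7\<close> pays for the
  possible negativity of the second energy. Apart from H nothing in these constants depends on
  \<open>t1\<close>, so the bound survives the limit in \<open>t1\<close>.\<close>

lemma energy_estimate:
  fixes z zx zxx zt S :: "real \<Rightarrow> real \<Rightarrow> real" and l dl ddl :: "real \<Rightarrow> real"
    and t1 T \<alpha> c L H \<epsilon> \<mu> :: real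
  defines "\<beta> \<equiv> \<lambda>t. l t * dl t / (2 * \<alpha>)"
  assumes \<alpha>: "0 < \<alpha>" and H: "1 \<le> H" "T - t1 \<le> H" and \<epsilon>: "0 < \<epsilon>" "300 * H^9 * \<epsilon> \<le> 1"
    and T: "t1 < T"
    and dl: "\<And>t. t \<in> {t1..T} \<Longrightarrow> (l has_real_derivative dl t) (at t within {t1..T})"
    and ddl: "\<And>t. t \<in> {t1..T} \<Longrightarrow> (dl has_real_derivative ddl t) (at t within {t1..T})"
    and bl: "\<And>t. t \<in> {t1..T} \<Longrightarrow> 1 / H \<le> l t \<and> l t \<le> H \<and> l t \<le> L"
    and ba: "\<And>t. t \<in> {t1..T} \<Longrightarrow> 1 / H \<le> \<alpha> / (l t)\<^sup>2"
    and bb: "\<And>t. t \<in> {t1..T} \<Longrightarrow> \<bar>dl t / l t\<bar> \<le> H"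
    and b\<beta>: "\<And>t. t \<in> {t1..T} \<Longrightarrow> \<bar>\<beta> t\<bar> \<le> H"
    and b\<beta>': "\<And>t. t \<in> {t1..T} \<Longrightarrow> \<bar>((dl t)\<^sup>2 + l t * ddl t) / (2 * \<alpha>)\<bar> \<le> H"
    and bc: "\<bar>c\<bar> \<le> H" and b\<mu>: "\<bar>\<mu>\<bar> \<le> H" and \<mu>: "\<mu> = 4 * \<alpha> / L\<^sup>2 + 2 * c"
    and cz: "continuous_on ({t1..T} \<times> {0..1}) (\<lambda>(t, x). z t x)"
    and czx: "continuous_on ({t1..T} \<times> {0..1}) (\<lambda>(t, x). zx t x)"
    and czxx: "continuous_on ({t1..T} \<times> {0..1}) (\<lambda>(t, x). zxx t x)"
    and czt: "continuous_on ({t1..T} \<times> {0..1}) (\<lambda>(t, x). zt t x)"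
    and dzt: "\<And>t x. t \<in> {t1..T} \<Longrightarrow> x \<in> {0..1} \<Longrightarrow>
      ((\<lambda>s. z s x) has_real_derivative zt t x) (at t within {t1..T})"
    and dzx: "\<And>t x. t \<in> {t1..T} \<Longrightarrow> x \<in> {0..1} \<Longrightarrow> (z t has_real_derivative zx t x) (at x within {0..1})"
    and dzxx: "\<And>t x. t \<in> {t1..T} \<Longrightarrow> x \<in> {0..1} \<Longrightarrow> (zx t has_real_derivative zxx t x) (at x within {0..1})"
    and z0: "\<And>t. t \<in> {t1..T} \<Longrightarrow> z t 0 = 0"
    and z1: "\<And>t. t \<in> {t1..T} \<Longrightarrow> zx t 1 = - \<beta> t * z t 1"
    and cS: "\<And>t. t \<in> {t1..T} \<Longrightarrow> continuous_on {0..1} (S t)"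
    and pde: "\<And>t x. t \<in> {t1..T} \<Longrightarrow> x \<in> {0..1} \<Longrightarrow>
      zt t x = \<alpha> / (l t)\<^sup>2 * zxx t x + dl t / l t * (x * zx t x) - c * z t x + S t x"
    and bS: "\<And>t. t \<in> {t1..T} \<Longrightarrow> nrm2 (S t) \<le> \<epsilon> * H * (\<bar>zx t 0\<bar> + nrm2 (z t))"
    and t: "t \<in> {t1..T}"
  shows "(1 - \<epsilon> * H^7) * (l t * (nrm2 (z t))\<^sup>2)
    \<le> exp (600 * H^10 * \<epsilon> - \<mu> * (t - t1)) * (l t1 * (nrm2 (z t1))\<^sup>2)"
proof -
  define \<beta>' where "\<beta>' = (\<lambda>t. ((dl t)\<^sup>2 + l t * ddl t) / (2 * \<alpha>))"
  define \<delta> where "\<delta> = \<epsilon> * H^3"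
  define P where "P = 300 * H^9"
  define E1 where "E1 = (\<lambda>t. integral {0..1} (\<lambda>x. (zx t x)\<^sup>2) + \<beta> t * (z t 1)\<^sup>2)"
  define E where "E = (\<lambda>t. l t * integral {0..1} (\<lambda>x. (z t x)\<^sup>2) + \<delta> * (t - t1) * E1 t)"
  define J0 where "J0 = (\<lambda>t. 2 * l t * integral {0..1} (\<lambda>x. z t x * S t x))"
  define W where "W = (\<lambda>t x. dl t / l t * (x * zx t x) - c * z t x + S t x)"
  define J1 where "J1 = (\<lambda>t. 2 * integral {0..1} (\<lambda>x. zxx t x * W t x))"
  note slz = continuous_on_slice[OF cz] and slzx = continuous_on_slice[OF czx]
    and slzxx = continuous_on_slice[OF czxx] and slzt = continuous_on_slice[OF czt]
  have lpos: "0 < l t" if "t \<in> {t1..T}" for t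
    using bl[OF that] H by (auto intro: less_le_trans[of 0 "1/H"])
  have cW: "continuous_on {0..1} (W t)" if "t \<in> {t1..T}" for t
    unfolding W_def by (intro continuous_intros slz slzx cS that)
  have d\<beta>: "(\<beta> has_real_derivative \<beta>' t) (at t within {t1..T})" if "t \<in> {t1..T}" for t
    unfolding \<beta>_def \<beta>'_def using \<alpha>
    by (auto intro!: derivative_eq_intros dl ddl that simp: power2_eq_square divide_simps algebra_simps)
  have dE0: "((\<lambda>t. l t * integral {0..1} (\<lambda>x. (z t x)\<^sup>2)) has_real_derivative
     - 2 * l t * (\<alpha> / (l t)\<^sup>2) * (nrm2 (zx t))\<^sup>2 - 2 * c * (l t * (nrm2 (z t))\<^sup>2) + J0 t) (at t within {t1..T})"
    if t: "t \<in> {t1..T}" for t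
  proof -
    define a b where "a = \<alpha> / (l t)\<^sup>2" and "b = dl t / l t"
    have lb: "l t * b = dl t" "2 * a * \<beta> t = b"
      using lpos[OF t] \<alpha> by (simp_all add: a_def b_def \<beta>_def power2_eq_square)
    \<comment> \<open>Diffusion and drift are integrated by parts together. With the Robin condition
      at 1 their boundary terms add up to \<open>(b - 2 * a * \<beta> t) * (z t 1)^2\<close>, and
      \<beta> is such that this vanishes.\<close>
    have "((\<lambda>x. 2 * a * (zx t x * zx t x + z t x * zxx t x) + b * ((z t x)\<^sup>2 + x * (2 * (z t x * zx t x)))) has_integral
      (2 * a * (z t 1 * zx t 1) + b * (1 * (z t 1)\<^sup>2)) - (2 * a * (z t 0 * zx t 0) + b * (0 * (z t 0)\<^sup>2))) {0..1}"
      using t by (intro has_integral_real_derivative)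
        (auto intro!: derivative_eq_intros dzx dzxx simp: algebra_simps)
    moreover have "(2 * a * (z t 1 * zx t 1) + b * (1 * (z t 1)\<^sup>2)) - (2 * a * (z t 0 * zx t 0) + b * (0 * (z t 0)\<^sup>2))
        = (b - 2 * a * \<beta> t) * (z t 1)\<^sup>2"
      by (simp add: z0[OF t] z1[OF t] power2_eq_square algebra_simps)
    ultimately have "((\<lambda>x. 2 * a * (zx t x * zx t x + z t x * zxx t x) + b * ((z t x)\<^sup>2 + x * (2 * (z t x * zx t x)))) has_integral 0) {0..1}"
      by (simp add: lb)
    then have "((\<lambda>x. (2 * a * (zx t x * zx t x + z t x * zxx t x) + b * ((z t x)\<^sup>2 + x * (2 * (z t x * zx t x))))
       - 2 * a * (zx t x)\<^sup>2 - (b + 2 * c) * (z t x)\<^sup>2 + 2 * (z t x * S t x)) has_integral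
       0 - 2 * a * (nrm2 (zx t))\<^sup>2 - (b + 2 * c) * (nrm2 (z t))\<^sup>2 + 2 * integral {0..1} (\<lambda>x. z t x * S t x)) {0..1}"
      unfolding nrm2_square[OF slz[OF t]] nrm2_square[OF slzx[OF t]]
      by (intro has_integral_add has_integral_mult_right has_integral_diff integrable_integral
        integrable_continuous_real continuous_intros slz slzx cS t)
    then have "((\<lambda>x. 2 * (z t x * zt t x)) has_integral
       0 - 2 * a * (nrm2 (zx t))\<^sup>2 - (b + 2 * c) * (nrm2 (z t))\<^sup>2 + 2 * integral {0..1} (\<lambda>x. z t x * S t x)) {0..1}"
    proof (rule has_integral_eq[rotated])
      fix x :: real assume "x \<in> {0..1}"
      then show "(2 * a * (zx t x * zx t x + z t x * zxx t x) + b * ((z t x)\<^sup>2 + x * (2 * (z t x * zx t x))))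
       - 2 * a * (zx t x)\<^sup>2 - (b + 2 * c) * (z t x)\<^sup>2 + 2 * (z t x * S t x) = 2 * (z t x * zt t x)"
        unfolding pde[OF t \<open>x \<in> {0..1}\<close>] a_def[symmetric] b_def[symmetric]
        by (simp add: power2_eq_square algebra_simps)
    qed
    then have i: "integral {0..1} (\<lambda>x. 2 * (z t x * zt t x)) = 0 - 2 * a * (nrm2 (zx t))\<^sup>2
       - (b + 2 * c) * (nrm2 (z t))\<^sup>2 + 2 * integral {0..1} (\<lambda>x. z t x * S t x)"
      by (rule integral_unique)
    \<comment> \<open>The drift has left \<open>- b\<close> times the squared norm; since
      \<open>l t * b = dl t\<close>, the derivative of the factor \<open>l t\<close> cancels it.
      This weighted energy is the squared norm on the moving interval.\<close>
    have "l t * integral {0..1} (\<lambda>x. 2 * (z t x * zt t x)) + dl t * integral {0..1} (\<lambda>x. (z t x)\<^sup>2)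
      = - 2 * l t * a * (nrm2 (zx t))\<^sup>2 - 2 * c * (l t * (nrm2 (z t))\<^sup>2) + J0 t"
      unfolding nrm2_square[OF slz[OF t], symmetric] lb(1)[symmetric] i J0_def
      by (simp add: algebra_simps)
    with has_real_derivative_integral_square[OF cz czt dzt t] show ?thesis
      unfolding a_def[symmetric]
      by (auto intro!: derivative_eq_intros dl t simp: algebra_simps)
  qed
  have zt0: "zt t 0 = 0" if t: "t \<in> {t1..T}" for t
  proof -
    have "((\<lambda>s. z s 0) has_real_derivative 0) (at t within {t1..T})"
      unfolding has_field_derivative_def
      by (rule has_derivative_transform[OF t, where f = "\<lambda>_. 0"]) (use z0 DERIV_const[of 0, unfolded has_field_derivative_def] in auto)
    moreover have "((\<lambda>s. z s 0) has_real_derivative zt t 0) (at t within {t1..T})"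
      by (rule dzt) (use t in auto)
    ultimately show ?thesis
      using T t unfolding has_real_derivative_iff_has_vector_derivative
      by (intro vector_derivative_unique_within_closed_interval[of t1 T t]) (auto simp: cbox_interval)
  qed
  \<comment> \<open>The boundary term \<open>2 * zt t 1 * zx t 1\<close> of the Dirichlet energy
    equals \<open>- 2 * \<beta> t * z t 1 * zt t 1\<close>. It cancels against the derivative of the
    Robin term, so that only \<open>\<beta>'\<close> survives and no time derivative of the trace
    has to be estimated.\<close>
  have dE1: "(E1 has_real_derivative
     - 2 * (\<alpha> / (l t)\<^sup>2) * (nrm2 (zxx t))\<^sup>2 - J1 t + \<beta>' t * (z t 1)\<^sup>2) (at t within {t1..T})"
    if t: "t \<in> {t1..T}" for t
  proof -
    define a where "a = \<alpha> / (l t)\<^sup>2"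
    have "((\<lambda>x. a * (zxx t x)\<^sup>2 + zxx t x * W t x) has_integral
      a * (nrm2 (zxx t))\<^sup>2 + integral {0..1} (\<lambda>x. zxx t x * W t x)) {0..1}"
      unfolding nrm2_square[OF slzxx[OF t]]
      by (intro has_integral_add has_integral_mult_right integrable_integral
        integrable_continuous_real continuous_intros slzxx cW t)
    then have "((\<lambda>x. zt t x * zxx t x) has_integral
      a * (nrm2 (zxx t))\<^sup>2 + integral {0..1} (\<lambda>x. zxx t x * W t x)) {0..1}"
    proof (rule has_integral_eq[rotated])
      fix x :: real assume x: "x \<in> {0..1}"
      show "a * (zxx t x)\<^sup>2 + zxx t x * W t x = zt t x * zxx t x"
        unfolding pde[OF t x] a_def[symmetric] W_def by (simp add: power2_eq_square algebra_simps)
    qed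
    then have "2 * integral {0..1} (\<lambda>x. zt t x * zxx t x) = 2 * a * (nrm2 (zxx t))\<^sup>2 + J1 t"
      by (simp add: integral_unique J1_def)
    moreover note has_real_derivative_Dirichlet_energy[OF cz czx czxx czt dzt dzx dzxx t]
    ultimately show ?thesis unfolding E1_def a_def[symmetric]
      by (auto intro!: derivative_eq_intros d\<beta> dzt t simp: zt0[OF t] z1[OF t] algebra_simps)
  qed
  have dE: "(E has_real_derivative
      (- 2 * l t * (\<alpha> / (l t)\<^sup>2) * (nrm2 (zx t))\<^sup>2 - 2 * c * (l t * (nrm2 (z t))\<^sup>2) + J0 t) + \<delta> * E1 t
      + \<delta> * (t - t1) * (- 2 * (\<alpha> / (l t)\<^sup>2) * (nrm2 (zxx t))\<^sup>2 - J1 t + \<beta>' t * (z t 1)\<^sup>2)) (at t within {t1..T})"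
    if t: "t \<in> {t1..T}" for t
    unfolding E_def by (rule derivative_eq_intros dE0 dE1 t refl | simp add: algebra_simps)+
  have main: "(- 2 * l t * (\<alpha> / (l t)\<^sup>2) * (nrm2 (zx t))\<^sup>2 - 2 * c * (l t * (nrm2 (z t))\<^sup>2) + J0 t) + \<delta> * E1 t
      + \<delta> * (t - t1) * (- 2 * (\<alpha> / (l t)\<^sup>2) * (nrm2 (zxx t))\<^sup>2 - J1 t + \<beta>' t * (z t 1)\<^sup>2) + \<mu> * E t
      \<le> \<epsilon> * P * E t / sqrt (t - t1)"
    and lower: "(1 - \<epsilon> * H^7) * (l t * (nrm2 (z t))\<^sup>2) \<le> E t"
    if t: "t \<in> {t1..T}" "t1 < t" for t
  proof -
    note nn = nrm2_nonneg[OF slz[OF t(1)]] nrm2_nonneg[OF slzx[OF t(1)]] nrm2_nonneg[OF slzxx[OF t(1)]]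
    have zzx: "nrm2 (z t) \<le> 2 / 3 * nrm2 (zx t)"
      by (rule Wirtinger_inequality) (use dzx slzx z0 t in auto)
    have NA: "(nrm2 (z t))\<^sup>2 \<le> (nrm2 (zx t))\<^sup>2 / 2"
    proof -
      have "(nrm2 (z t))\<^sup>2 \<le> (2 / 3 * nrm2 (zx t))\<^sup>2" using zzx nn by (intro power_mono) auto
      also have "\<dots> = 4 / 9 * (nrm2 (zx t))\<^sup>2" by (simp add: power_mult_distrib power2_eq_square)
      finally show ?thesis using zero_le_power2[of "nrm2 (zx t)"] by linarith
    qed
    have z1: "(z t 1)\<^sup>2 \<le> 2 * nrm2 (z t) * nrm2 (zx t)"
    proof -
      have "((\<lambda>x. 2 * (z t x * zx t x)) has_integral (z t 1)\<^sup>2 - (z t 0)\<^sup>2) {0..1}"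
        using t by (intro has_integral_real_derivative) (auto intro!: derivative_eq_intros dzx)
      from integral_unique[OF this] have "(z t 1)\<^sup>2 = 2 * integral {0..1} (\<lambda>x. z t x * zx t x)"
        using z0[OF t(1)] by simp
      then show ?thesis using integral_mult_le_nrm2[OF slz[OF t(1)] slzx[OF t(1)]] by simp
    qed
    \<comment> \<open>The multiplier 1 - x vanishes at the right end, so integrating the derivative
      of \<open>-(1 - x) * (zx t x)^2\<close> isolates the trace at 0.\<close>
    have g: "(zx t 0)\<^sup>2 \<le> (nrm2 (zx t))\<^sup>2 + 2 * nrm2 (zx t) * nrm2 (zxx t)"
    proof -
      have "((\<lambda>x. (zx t x)\<^sup>2 - 2 * (((1 - x) * zx t x) * zxx t x)) has_integral (1 - 1) * -(zx t 1)\<^sup>2 - (1 - 0) * - (zx t 0)\<^sup>2) {0..1}"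
        using t by (intro has_integral_real_derivative)
          (auto intro!: derivative_eq_intros dzxx simp: algebra_simps)
      moreover have "((\<lambda>x. (zx t x)\<^sup>2 - 2 * (((1 - x) * zx t x) * zxx t x)) has_integral
          (nrm2 (zx t))\<^sup>2 - 2 * integral {0..1} (\<lambda>x. ((1 - x) * zx t x) * zxx t x)) {0..1}"
        unfolding nrm2_square[OF slzx[OF t(1)]]
        by (intro has_integral_diff has_integral_mult_right integrable_integral
          integrable_continuous_real continuous_intros slzx slzxx t)
      ultimately have "(1 - 1) * -(zx t 1)\<^sup>2 - (1 - 0) * - (zx t 0)\<^sup>2
          = (nrm2 (zx t))\<^sup>2 - 2 * integral {0..1} (\<lambda>x. ((1 - x) * zx t x) * zxx t x)"
        by (rule has_integral_unique)
      then have "(zx t 0)\<^sup>2 = (nrm2 (zx t))\<^sup>2 - 2 * integral {0..1} (\<lambda>x. ((1 - x) * zx t x) * zxx t x)"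
        by simp
      moreover have "\<bar>integral {0..1} (\<lambda>x. ((1 - x) * zx t x) * zxx t x)\<bar> \<le> nrm2 (\<lambda>x. (1 - x) * zx t x) * nrm2 (zxx t)"
        by (intro integral_mult_le_nrm2 continuous_intros slzx slzxx t)
      moreover have "nrm2 (\<lambda>x. (1 - x) * zx t x) \<le> nrm2 (zx t)"
        by (intro nrm2_mono continuous_intros slzx t) (auto simp: abs_mult intro: mult_left_le_one_le)
      then have "nrm2 (\<lambda>x. (1 - x) * zx t x) * nrm2 (zxx t) \<le> nrm2 (zx t) * nrm2 (zxx t)"
        using nn(3) by (rule mult_right_mono)
      ultimately show ?thesis by (simp add: abs_le_iff)
    qed
    have J0: "\<bar>J0 t\<bar> \<le> 2 * H * nrm2 (z t) * (\<epsilon> * H * (\<bar>zx t 0\<bar> + nrm2 (z t)))"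
    proof -
      have "\<bar>integral {0..1} (\<lambda>x. z t x * S t x)\<bar> \<le> nrm2 (z t) * nrm2 (S t)"
        by (intro integral_mult_le_nrm2 slz cS t)
      also have "\<dots> \<le> nrm2 (z t) * (\<epsilon> * H * (\<bar>zx t 0\<bar> + nrm2 (z t)))"
        using bS t nn by (intro mult_left_mono) auto
      finally have "2 * l t * \<bar>integral {0..1} (\<lambda>x. z t x * S t x)\<bar>
          \<le> 2 * H * (nrm2 (z t) * (\<epsilon> * H * (\<bar>zx t 0\<bar> + nrm2 (z t))))"
        using bl[OF t(1)] H lpos[OF t(1)] by (intro mult_mono) auto
      then show ?thesis using lpos[OF t(1)] by (simp add: J0_def abs_mult mult.assoc)
    qed
    have J1: "\<bar>J1 t\<bar> \<le> 2 * nrm2 (zxx t) * (H * nrm2 (zx t) + H * nrm2 (z t) + \<epsilon> * H * (\<bar>zx t 0\<bar> + nrm2 (z t)))"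
    proof -
      have "nrm2 (W t) \<le> nrm2 (\<lambda>x. dl t / l t * (x * zx t x) - c * z t x) + nrm2 (S t)"
        unfolding W_def by (intro nrm2_triangle continuous_intros slz slzx cS t)
      also have "nrm2 (\<lambda>x. dl t / l t * (x * zx t x) - c * z t x) = nrm2 (\<lambda>x. dl t / l t * (x * zx t x) + (- c) * z t x)"
        by simp
      also have "\<dots> \<le> nrm2 (\<lambda>x. dl t / l t * (x * zx t x)) + nrm2 (\<lambda>x. (- c) * z t x)"
        by (intro nrm2_triangle continuous_intros slz slzx cS t)
      also have "\<dots> = \<bar>dl t / l t\<bar> * nrm2 (\<lambda>x. x * zx t x) + \<bar>- c\<bar> * nrm2 (z t)"
        by (simp only: nrm2_cmult)
      also have "\<dots> \<le> H * nrm2 (zx t) + H * nrm2 (z t)"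
      proof (intro add_mono mult_mono)
        show "nrm2 (\<lambda>x. x * zx t x) \<le> nrm2 (zx t)"
          by (intro nrm2_mono continuous_intros slzx t) (auto simp: abs_mult intro: mult_left_le_one_le)
      qed (use bb[OF t(1)] bc nn H nrm2_nonneg[of "\<lambda>x. x * zx t x"] slzx[OF t(1)] in \<open>auto intro!: continuous_intros nrm2_nonneg\<close>)
      finally have W: "nrm2 (W t) \<le> H * nrm2 (zx t) + H * nrm2 (z t) + \<epsilon> * H * (\<bar>zx t 0\<bar> + nrm2 (z t))"
        using bS[OF t(1)] by simp
      have "\<bar>integral {0..1} (\<lambda>x. zxx t x * W t x)\<bar> \<le> nrm2 (zxx t) * nrm2 (W t)"
        by (intro integral_mult_le_nrm2 slzxx cW t)
      also have "\<dots> \<le> nrm2 (zxx t) * (H * nrm2 (zx t) + H * nrm2 (z t) + \<epsilon> * H * (\<bar>zx t 0\<bar> + nrm2 (z t)))"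
        using W nn by (intro mult_left_mono) auto
      finally show ?thesis by (simp add: J1_def abs_mult)
    qed
    have s: "0 < sqrt (t - t1)" "(sqrt (t - t1))\<^sup>2 \<le> H"
      using t H by auto
    note alg = energy_algebra[OF nn H(1) \<epsilon> s NA z1 g _ _ _ ba[OF t(1)] refl b\<beta>[OF t(1)] b\<beta>'[OF t(1)] b\<mu> \<mu> J0 J1]
    have s2: "(sqrt (t - t1))\<^sup>2 = t - t1" using t by simp
    show "(- 2 * l t * (\<alpha> / (l t)\<^sup>2) * (nrm2 (zx t))\<^sup>2 - 2 * c * (l t * (nrm2 (z t))\<^sup>2) + J0 t) + \<delta> * E1 t
      + \<delta> * (t - t1) * (- 2 * (\<alpha> / (l t)\<^sup>2) * (nrm2 (zxx t))\<^sup>2 - J1 t + \<beta>' t * (z t 1)\<^sup>2) + \<mu> * E t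
      \<le> \<epsilon> * P * E t / sqrt (t - t1)"
      unfolding E_def E1_def \<delta>_def P_def \<beta>'_def nrm2_square[OF slz[OF t(1)], symmetric] nrm2_square[OF slzx[OF t(1)], symmetric]
      using alg(1)[unfolded s2] bl[OF t(1)] by blast
    show "(1 - \<epsilon> * H^7) * (l t * (nrm2 (z t))\<^sup>2) \<le> E t"
      unfolding E_def E1_def \<delta>_def nrm2_square[OF slz[OF t(1)], symmetric] nrm2_square[OF slzx[OF t(1)], symmetric]
      using alg(2)[unfolded s2] bl[OF t(1)] by blast
  qed
  \<comment> \<open>Integrating factor for the inequality \<open>main\<close>. The square root is
    not differentiable at \<open>t1\<close>, so monotonicity is deduced from the sign of the
    derivative on the open interval and continuity at its ends.\<close>
  define G where "G = (\<lambda>t. E t * exp (\<mu> * (t - t1) - 2 * P * \<epsilon> * sqrt (t - t1)))"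
  have Et1: "E t1 = l t1 * (nrm2 (z t1))\<^sup>2"
    using T by (simp add: E_def nrm2_square[OF slz])
  show ?thesis
  proof (cases "t = t1")
    case True
    have "(1 - \<epsilon> * H^7) * (l t1 * (nrm2 (z t1))\<^sup>2) \<le> 1 * (l t1 * (nrm2 (z t1))\<^sup>2)"
      using \<epsilon> H lpos[of t1] T by (intro mult_right_mono) auto
    also have "\<dots> \<le> exp (600 * H^10 * \<epsilon>) * (l t1 * (nrm2 (z t1))\<^sup>2)"
      using \<epsilon> H lpos[of t1] T by (intro mult_right_mono) auto
    finally show ?thesis using True by simp
  next
    case False
    then have tt: "t1 < t" "t \<le> T" using t by auto
    have "G t \<le> G t1"
    proof (rule DERIV_nonpos_imp_decreasing_open[of t1 t G])
      show "t1 \<le> t" using tt by simp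
      have "continuous_on {t1..T} E"
        using dE by (meson DERIV_continuous continuous_on_eq_continuous_within)
      then have "continuous_on {t1..t} E" by (rule continuous_on_subset) (use tt in auto)
      then show "continuous_on {t1..t} G"
        unfolding G_def by (intro continuous_intros)
      fix r assume r: "t1 < r" "r < t"
      then have r': "r \<in> {t1..T}" "r \<in> interior {t1..T}" using tt by auto
      define D where "D = (- 2 * l r * (\<alpha> / (l r)\<^sup>2) * (nrm2 (zx r))\<^sup>2 - 2 * c * (l r * (nrm2 (z r))\<^sup>2) + J0 r) + \<delta> * E1 r
      + \<delta> * (r - t1) * (- 2 * (\<alpha> / (l r)\<^sup>2) * (nrm2 (zxx r))\<^sup>2 - J1 r + \<beta>' r * (z r 1)\<^sup>2)"
      have "(E has_real_derivative D) (at r)"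
        using dE[OF r'(1)] at_within_interior[OF r'(2)] by (simp add: D_def)
      then have "(G has_real_derivative (D + \<mu> * E r - P * \<epsilon> * E r / sqrt (r - t1)) * exp (\<mu> * (r - t1) - 2 * P * \<epsilon> * sqrt (r - t1))) (at r)"
        unfolding G_def using r
        by (auto intro!: derivative_eq_intros simp: field_simps)
      moreover have "D + \<mu> * E r - P * \<epsilon> * E r / sqrt (r - t1) \<le> 0"
        using main[OF r'(1) r(1)] by (simp add: D_def mult.commute)
      ultimately show "\<exists>y. (G has_real_derivative y) (at r) \<and> y \<le> 0"
        by (auto intro!: exI mult_nonpos_nonneg)
    qed
    then have "E t * exp (\<mu> * (t - t1) - 2 * P * \<epsilon> * sqrt (t - t1)) \<le> E t1" by (simp add: G_def)
    then have "E t \<le> E t1 / exp (\<mu> * (t - t1) - 2 * P * \<epsilon> * sqrt (t - t1))"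
      by (simp add: field_simps)
    also have "\<dots> = exp (2 * P * \<epsilon> * sqrt (t - t1) - \<mu> * (t - t1)) * E t1"
      by (simp add: exp_diff)
    also have "\<dots> \<le> exp (600 * H^10 * \<epsilon> - \<mu> * (t - t1)) * E t1"
    proof (rule mult_right_mono)
      have "sqrt (t - t1) \<le> H"
      proof (rule real_le_lsqrt)
        show "t - t1 \<le> H\<^sup>2" using tt H self_le_power[of H 2] by linarith
      qed (use H in auto)
      then have "2 * P * \<epsilon> * sqrt (t - t1) \<le> 2 * P * \<epsilon> * H"
        using \<epsilon> H by (intro mult_left_mono) (auto simp: P_def)
      then show "exp (2 * P * \<epsilon> * sqrt (t - t1) - \<mu> * (t - t1)) \<le> exp (600 * H^10 * \<epsilon> - \<mu> * (t - t1))"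
        by (simp add: P_def eval_nat_numeral algebra_simps)
      show "0 \<le> E t1" unfolding Et1 using lpos[of t1] T by simp
    qed
    finally show ?thesis using lower[OF t tt(1)] Et1 by simp
  qed
qed

section \<open>The Volterra transformation on the unit interval\<close>

lemma integral_rescale:
  fixes g :: "real \<Rightarrow> real"
  assumes "continuous_on {0..s} g" "0 \<le> s"
  shows "integral {0..s} g = integral {0..1} (\<lambda>\<sigma>. s * g (s * \<sigma>))"
proof -
  have "((\<lambda>\<sigma>. s *\<^sub>R g (s * \<sigma>)) has_integral integral {s * 0..s * 1} g) {0..1}"
  proof (rule has_integral_substitution[where c = 0 and d = s])
    show "(*) s ` {0..1} \<subseteq> {0..s}" using mult_left_le[of _ s] assms(2) by auto
    show "((*) s has_real_derivative s) (at x within {0..1})" for x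
      by (auto intro!: derivative_eq_intros)
  qed (use assms in auto)
  from integral_unique[OF this] show ?thesis by simp
qed

text \<open>Rescaling to [0, 1] moves the variable limit into the integrand, and continuity of
  integrals with a parameter over a fixed interval applies.\<close>

lemma continuous_on_integral_variable_limit:
  fixes g :: "'a::topological_space \<Rightarrow> real \<Rightarrow> real"
  assumes g: "continuous_on {(p, y). p \<in> U \<and> 0 \<le> y \<and> y \<le> \<phi> p} (\<lambda>(p, y). g p y)"
    and \<phi>: "continuous_on U \<phi>" "\<And>p. p \<in> U \<Longrightarrow> 0 \<le> \<phi> p"
  shows "continuous_on U (\<lambda>p. integral {0..\<phi> p} (g p))"
proof -
  have sl: "continuous_on {0..\<phi> p} (g p)" if "p \<in> U" for p
  proof -
    have "continuous_on {0..\<phi> p} (\<lambda>y. (\<lambda>(p, y). g p y) (p, y))"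
      by (rule continuous_on_compose2[OF g]) (use that in \<open>auto intro!: continuous_intros\<close>)
    then show ?thesis by simp
  qed
  have "continuous_on U (\<lambda>p. integral (cbox 0 1) (\<lambda>\<sigma>. \<phi> p * g p (\<phi> p * \<sigma>)))"
  proof (rule integral_continuous_on_param)
    have \<phi>': "continuous_on (U \<times> {0..1::real}) (\<lambda>q. \<phi> (fst q))"
      by (rule continuous_on_compose2[OF \<phi>(1)]) (auto intro!: continuous_intros)
    have "continuous_on (U \<times> cbox 0 1) (\<lambda>q. (\<lambda>(p, y). g p y) (fst q, \<phi> (fst q) * snd q))"
      by (rule continuous_on_compose2[OF g])
        (auto intro!: continuous_intros \<phi>' mult_nonneg_nonneg mult_left_le \<phi>(2))
    then show "continuous_on (U \<times> cbox 0 1) (\<lambda>(p, \<sigma>). \<phi> p * g p (\<phi> p * \<sigma>))"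
      by (auto simp: split_beta intro!: continuous_intros \<phi>')
  qed
  then show ?thesis
    by (rule continuous_on_eq) (use sl \<phi>(2) in \<open>simp add: integral_rescale\<close>)
qed

text \<open>The kernel is only given for \<open>y \<le> x\<close>; continuing it affinely in \<open>x\<close> beyond the diagonal keeps it
  continuously differentiable in \<open>x\<close>, so that the upper limit and the parameter can be varied
  independently.\<close>

lemma has_real_derivative_Volterra:
  fixes h hx :: "real \<Rightarrow> real \<Rightarrow> real"
  assumes h: "continuous_on {(x, y). 0 \<le> y \<and> y \<le> x \<and> x \<le> 1} (\<lambda>(x, y). h x y)"
    and hx: "continuous_on {(x, y). 0 \<le> y \<and> y \<le> x \<and> x \<le> 1} (\<lambda>(x, y). hx x y)"
    and d: "\<And>x y. 0 \<le> y \<Longrightarrow> y \<le> x \<Longrightarrow> x \<le> 1 \<Longrightarrow>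
      ((\<lambda>x. h x y) has_real_derivative hx x y) (at x within {y..1})"
    and x: "x \<in> {0..1}"
  shows "((\<lambda>x. integral {0..x} (h x)) has_real_derivative h x x + integral {0..x} (hx x)) (at x within {0..1})"
proof -
  define k where "k = (\<lambda>x y. if x \<in> {y..1} then h x y else h y y + (x - y) * hx y y)"
  define kx where "kx = (\<lambda>x y. hx (max x y) y)"
  have dk: "((\<lambda>x. k x y) has_real_derivative kx x y) (at x within {0..1})"
    if y: "y \<in> {0..1}" and x: "x \<in> {0..1}" for x y
  proof -
    have cl: "closure {y..1} \<inter> closure {0..y} = {y}" using y by auto
    have "((\<lambda>x. if x \<in> {y..1} then h x y else h y y + (x - y) * hx y y) has_vector_derivative
       (if x \<in> {y..1} then hx x y else hx y y)) (at x within {0..1})"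
    proof (rule has_vector_derivative_If_within_closures[where T = "{0..y}"], goal_cases)
      case 1 then show ?case using x y by auto
    next
      case 2 then show ?case using x y by auto
    next
      case 3
      have "{y..1} \<union> {y} = {y..1}" using y by auto
      then show ?case using 3 d[of y x] y x unfolding cl
        by (auto simp: has_real_derivative_iff_has_vector_derivative)
    next
      case 4
      show ?case unfolding has_real_derivative_iff_has_vector_derivative[symmetric]
        by (auto intro!: derivative_eq_intros)
    qed (use x y in auto)
    moreover have "(if x \<in> {y..1} then hx x y else hx y y) = kx x y"
      using x y by (auto simp: kx_def max_def)
    ultimately show ?thesis
      by (simp add: k_def has_real_derivative_iff_has_vector_derivative)
  qed
  have ckx: "continuous_on ({0..1} \<times> {0..1}) (\<lambda>(x, y). kx x y)"
  proof -
    have "continuous_on ({0..1} \<times> {0..1}) (\<lambda>q. (\<lambda>(x, y). hx x y) (max (fst q) (snd q), snd q))"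
      by (rule continuous_on_compose2[OF hx]) (auto intro!: continuous_intros)
    then show ?thesis by (simp add: kx_def split_beta)
  qed
  have ck: "continuous_on {0..1} (k x)" if x: "x \<in> {0..1}" for x
  proof -
    have "continuous_on {0..1} (\<lambda>y. (\<lambda>(x, y). h x y) (max x y, y))"
      by (rule continuous_on_compose2[OF h]) (use x in \<open>auto intro!: continuous_intros\<close>)
    moreover have "continuous_on {0..1} (\<lambda>y. (\<lambda>(x, y). hx x y) (y, y))"
      by (rule continuous_on_compose2[OF hx]) (auto intro!: continuous_intros)
    \<comment> \<open>A form of \<open>k x\<close> without case distinction: for y \<le> x the
      second summand is zero, beyond the diagonal it is the affine continuation.\<close>
    ultimately have "continuous_on {0..1} (\<lambda>y. h (max x y) y + min 0 (x - y) * hx y y)"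
      by (auto intro!: continuous_intros)
    then show ?thesis
      by (rule continuous_on_eq) (use x in \<open>auto simp: k_def max_def min_def\<close>)
  qed
  define \<Phi> where "\<Phi> = (\<lambda>s x. integral {0..s} (k x))"
  define \<Phi>x where "\<Phi>x = (\<lambda>s x. integral {0..s} (kx x))"
  have "((\<lambda>(s, x). \<Phi> s x) has_derivative (\<lambda>(ts, tx). blinfun_mult_right (k x x) ts + blinfun_mult_right (\<Phi>x x x) tx))
    (at (x, x) within {0..1} \<times> {0..1})"
  proof (rule has_derivative_partialsI[where fy = "\<lambda>s x. blinfun_mult_right (\<Phi>x s x)"])
    show "((\<lambda>s. \<Phi> s x) has_derivative blinfun_mult_right (k x x)) (at x within {0..1})"
      unfolding \<Phi>_def has_field_derivative_eq_has_derivative_blinfun[symmetric]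
      by (rule integral_has_real_derivative[OF ck]) (use x in auto)
    show "(\<Phi> s has_derivative blinfun_mult_right (\<Phi>x s x)) (at x within {0..1})"
      if "s \<in> {0..1}" "x \<in> {0..1}" for s x
      unfolding \<Phi>_def \<Phi>x_def has_field_derivative_eq_has_derivative_blinfun[symmetric] cbox_interval[symmetric]
    proof (rule leibniz_rule_field_derivative)
      show "k x integrable_on cbox 0 s" if "x \<in> cbox 0 1" for x
        using ck[of x] that \<open>s \<in> {0..1}\<close> by (auto intro!: integrable_continuous_real elim: continuous_on_subset)
      show "continuous_on (cbox 0 1 \<times> cbox 0 s) (\<lambda>(x, t). kx x t)"
        using \<open>s \<in> {0..1}\<close> by (intro continuous_on_subset[OF ckx]) auto
    qed (use that dk in auto)
    have "continuous_on ({0..1} \<times> {0..1}) (\<lambda>q. \<Phi>x (fst q) (snd q))"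
      unfolding \<Phi>x_def
    proof (rule continuous_on_integral_variable_limit)
      have "continuous_on {(p, y). p \<in> {0..1} \<times> {0..1} \<and> 0 \<le> y \<and> y \<le> fst p} (\<lambda>q. (\<lambda>(x, y). kx x y) (snd (fst q), snd q))"
        by (rule continuous_on_compose2[OF ckx]) (auto intro!: continuous_intros)
      then show "continuous_on {(p, y). p \<in> {0..1} \<times> {0..1} \<and> 0 \<le> y \<and> y \<le> fst p} (\<lambda>(p, y). kx (snd p) y)"
        by (simp add: split_beta)
    qed (auto intro!: continuous_intros)
    then have "continuous_on ({0..1} \<times> {0..1}) (\<lambda>q. blinfun_mult_right (\<Phi>x (fst q) (snd q)))"
      by (rule bounded_linear.continuous_on[OF bounded_linear_blinfun_mult_right])
    then show "continuous (at (x, x) within {0..1} \<times> {0..1}) (\<lambda>(s, x). blinfun_mult_right (\<Phi>x s x))"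
      using x unfolding continuous_on_eq_continuous_within split_beta by blast
  qed (use x in auto)
  \<comment> \<open>Joint differentiability on the square is restricted to its diagonal, so that the
    chain rule along \<open>(x, x)\<close> adds the two partial derivatives.\<close>
  then have "((\<lambda>(s, x). \<Phi> s x) has_derivative (\<lambda>(ts, tx). blinfun_mult_right (k x x) ts + blinfun_mult_right (\<Phi>x x x) tx))
    (at (x, x) within (\<lambda>x. (x, x)) ` {0..1})"
    by (rule has_derivative_subset) auto
  then have "((\<lambda>x. (\<lambda>(s, x). \<Phi> s x) (x, x)) has_derivative (\<lambda>h. (\<lambda>(ts, tx). blinfun_mult_right (k x x) ts + blinfun_mult_right (\<Phi>x x x) tx) (h, h)))
     (at x within {0..1})"
    by (rule has_derivative_in_compose[where f = "\<lambda>x. (x, x)", rotated])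
      (auto intro!: derivative_eq_intros)
  moreover have "(\<lambda>h. (\<lambda>(ts, tx). blinfun_mult_right (k x x) ts + blinfun_mult_right (\<Phi>x x x) tx) (h, h)) = (*) (k x x + \<Phi>x x x)"
    by (auto simp: fun_eq_iff algebra_simps)
  ultimately have D: "((\<lambda>x. \<Phi> x x) has_real_derivative k x x + \<Phi>x x x) (at x within {0..1})"
    by (simp add: has_field_derivative_def)
  have \<Phi>: "\<Phi> x x = integral {0..x} (h x)" if "x \<in> {0..1}" for x
    unfolding \<Phi>_def by (rule integral_cong) (use that in \<open>auto simp: k_def\<close>)
  have "\<Phi>x x x = integral {0..x} (hx x)"
    unfolding \<Phi>x_def by (rule integral_cong) (auto simp: kx_def max_def)
  moreover have "k x x = h x x" using x by (simp add: k_def)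
  ultimately have "((\<lambda>x. \<Phi> x x) has_derivative (*) (h x x + integral {0..x} (hx x))) (at x within {0..1})"
    using D by (simp only: has_field_derivative_def)
  from has_derivative_transform[OF x \<Phi>[symmetric] this] show ?thesis
    by (simp only: has_field_derivative_def)
qed

text \<open>Time is the first coordinate here, but the last one in \<^const>\<open>Dom\<close>.\<close>

definition Volterra_dom :: "real \<Rightarrow> real \<Rightarrow> (real \<times> real \<times> real) set" where
  "Volterra_dom t1 T = {(t, x, y). t \<in> {t1..T} \<and> 0 \<le> y \<and> y \<le> x \<and> x \<le> 1}"

lemma Volterra_dom_slice:
  assumes q: "continuous_on (Volterra_dom t1 T) (\<lambda>(t, x, y). q t x y)" and t: "t \<in> {t1..T}"
  shows "continuous_on {(x, y). 0 \<le> y \<and> y \<le> x \<and> x \<le> 1} (\<lambda>(x, y). q t x y)"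
    and "x \<in> {0..1} \<Longrightarrow> continuous_on {0..x} (q t x)"
proof -
  have "continuous_on {(x, y). 0 \<le> y \<and> y \<le> x \<and> x \<le> 1} (\<lambda>r. (\<lambda>(t, x, y). q t x y) (t, r))"
    by (rule continuous_on_compose2[OF q]) (use t in \<open>auto simp: Volterra_dom_def intro!: continuous_intros\<close>)
  then show "continuous_on {(x, y). 0 \<le> y \<and> y \<le> x \<and> x \<le> 1} (\<lambda>(x, y). q t x y)"
    by (simp add: split_beta)
  have "continuous_on {0..x} (\<lambda>y. (\<lambda>(t, x, y). q t x y) (t, x, y))" if "x \<in> {0..1}"
    by (rule continuous_on_compose2[OF q])
      (use t that in \<open>auto simp: Volterra_dom_def intro!: continuous_intros\<close>)
  then show "x \<in> {0..1} \<Longrightarrow> continuous_on {0..x} (q t x)" by simp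
qed

lemma Volterra_dom_diagonal:
  assumes q: "continuous_on (Volterra_dom t1 T) (\<lambda>(t, x, y). q t x y)"
  shows "continuous_on ({t1..T} \<times> {0..1}) (\<lambda>(t, x). q t x x)"
proof -
  have "continuous_on ({t1..T} \<times> {0..1}) (\<lambda>r. (\<lambda>(t, x, y). q t x y) (fst r, snd r, snd r))"
    by (rule continuous_on_compose2[OF q])
      (auto simp: Volterra_dom_def intro!: continuous_intros)
  then show ?thesis by (simp add: split_beta)
qed

lemma continuous_on_Volterra:
  fixes q :: "real \<Rightarrow> real \<Rightarrow> real \<Rightarrow> real" and w :: "real \<Rightarrow> real \<Rightarrow> real"
  assumes q: "continuous_on (Volterra_dom t1 T) (\<lambda>(t, x, y). q t x y)"
    and w: "continuous_on ({t1..T} \<times> {0..1}) (\<lambda>(t, x). w t x)"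
  shows "continuous_on ({t1..T} \<times> {0..1}) (\<lambda>(t, x). integral {0..x} (\<lambda>y. q t x y * w t y))"
proof -
  let ?D = "{(r, y). r \<in> {t1..T} \<times> {0..1} \<and> 0 \<le> y \<and> y \<le> snd r}"
  have "continuous_on ?D (\<lambda>s. (\<lambda>(t, x, y). q t x y) (fst (fst s), snd (fst s), snd s))"
    by (rule continuous_on_compose2[OF q]) (auto simp: Volterra_dom_def intro!: continuous_intros)
  moreover have "continuous_on ?D (\<lambda>s. (\<lambda>(t, x). w t x) (fst (fst s), snd s))"
    by (rule continuous_on_compose2[OF w]) (auto intro!: continuous_intros)
  ultimately have "continuous_on ?D (\<lambda>(r, y). q (fst r) (snd r) y * w (fst r) y)"
    by (auto simp: split_beta intro!: continuous_intros)
  from continuous_on_integral_variable_limit[OF this continuous_on_snd[OF continuous_on_id]] show ?thesis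
    by (auto simp: split_beta)
qed

section \<open>The equation satisfied by the transformed function\<close>

locale rescaled_transform =
  fixes t1 T c :: real and l dl a :: "real \<Rightarrow> real" and lm :: "real \<Rightarrow> real \<Rightarrow> real"
    and u ux uxx ut :: "real \<Rightarrow> real \<Rightarrow> real"
    and p pX pY pt pXX pYY :: "real \<Rightarrow> real \<Rightarrow> real \<Rightarrow> real"
  assumes dl: "t \<in> {t1..T} \<Longrightarrow> (l has_real_derivative dl t) (at t within {t1..T})"
    and cdl: "continuous_on {t1..T} dl"
    and lpos: "t \<in> {t1..T} \<Longrightarrow> 0 < l t"
    and cu: "continuous_on ({t1..T} \<times> {0..1}) (\<lambda>(t, x). u t x)"
    and cux: "continuous_on ({t1..T} \<times> {0..1}) (\<lambda>(t, x). ux t x)"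
    and cuxx: "continuous_on ({t1..T} \<times> {0..1}) (\<lambda>(t, x). uxx t x)"
    and cut: "continuous_on ({t1..T} \<times> {0..1}) (\<lambda>(t, x). ut t x)"
    and dut: "t \<in> {t1..T} \<Longrightarrow> x \<in> {0..1} \<Longrightarrow> ((\<lambda>s. u s x) has_real_derivative ut t x) (at t within {t1..T})"
    and dux: "t \<in> {t1..T} \<Longrightarrow> x \<in> {0..1} \<Longrightarrow> (u t has_real_derivative ux t x) (at x within {0..1})"
    and duxx: "t \<in> {t1..T} \<Longrightarrow> x \<in> {0..1} \<Longrightarrow> (ux t has_real_derivative uxx t x) (at x within {0..1})"
    and u0: "t \<in> {t1..T} \<Longrightarrow> u t 0 = 0"
    and clm: "t \<in> {t1..T} \<Longrightarrow> continuous_on {0..1} (lm t)"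
    and pde_u: "t \<in> {t1..T} \<Longrightarrow> x \<in> {0..1} \<Longrightarrow>
      ut t x = a t * uxx t x + dl t / l t * (x * ux t x) + lm t x * u t x"
    and cp: "continuous_on (Volterra_dom t1 T) (\<lambda>(t, x, y). p t x y)"
    and cpX: "continuous_on (Volterra_dom t1 T) (\<lambda>(t, x, y). pX t x y)"
    and cpY: "continuous_on (Volterra_dom t1 T) (\<lambda>(t, x, y). pY t x y)"
    and cpt: "continuous_on (Volterra_dom t1 T) (\<lambda>(t, x, y). pt t x y)"
    and cpXX: "continuous_on (Volterra_dom t1 T) (\<lambda>(t, x, y). pXX t x y)"
    and cpYY: "continuous_on (Volterra_dom t1 T) (\<lambda>(t, x, y). pYY t x y)"
    and dpX: "t \<in> {t1..T} \<Longrightarrow> 0 \<le> y \<Longrightarrow> y \<le> x \<Longrightarrow> x \<le> 1 \<Longrightarrow>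
      ((\<lambda>x. p t x y) has_real_derivative pX t x y) (at x within {y..1})"
    and dpXX: "t \<in> {t1..T} \<Longrightarrow> 0 \<le> y \<Longrightarrow> y \<le> x \<Longrightarrow> x \<le> 1 \<Longrightarrow>
      ((\<lambda>x. pX t x y) has_real_derivative pXX t x y) (at x within {y..1})"
    and dpY: "t \<in> {t1..T} \<Longrightarrow> 0 \<le> y \<Longrightarrow> y \<le> x \<Longrightarrow> x \<le> 1 \<Longrightarrow>
      ((\<lambda>y. p t x y) has_real_derivative pY t x y) (at y within {0..x})"
    and dpYY: "t \<in> {t1..T} \<Longrightarrow> 0 \<le> y \<Longrightarrow> y \<le> x \<Longrightarrow> x \<le> 1 \<Longrightarrow>
      ((\<lambda>y. pY t x y) has_real_derivative pYY t x y) (at y within {0..x})"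
    and dpt: "t \<in> {t1..T} \<Longrightarrow> 0 \<le> y \<Longrightarrow> y \<le> x \<Longrightarrow> x \<le> 1 \<Longrightarrow>
      ((\<lambda>t. p t x y) has_real_derivative pt t x y) (at t within {t1..T})"
    and dpdiag: "t \<in> {t1..T} \<Longrightarrow> x \<in> {0..1} \<Longrightarrow>
      ((\<lambda>x. p t x x) has_real_derivative pX t x x + pY t x x) (at x within {0..1})"
begin

text \<open>\<open>p t x y\<close> stands for the kernel at the point (l x, l y), and the factor
  \<open>l t\<close> is the Jacobian of the substitution in the Volterra integral. At a diagonal
  point the x- and y-sections of the unit triangle each extend to one side only, which is why the
  derivative along the diagonal enters through the separate assumption
  \<open>dpdiag\<close>.\<close>

definition z :: "real \<Rightarrow> real \<Rightarrow> real" where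
  "z t x = u t x - l t * integral {0..x} (\<lambda>y. p t x y * u t y)"

definition zx :: "real \<Rightarrow> real \<Rightarrow> real" where
  "zx t x = ux t x - l t * (p t x x * u t x + integral {0..x} (\<lambda>y. pX t x y * u t y))"

definition zxx :: "real \<Rightarrow> real \<Rightarrow> real" where
  "zxx t x = uxx t x - l t * ((pX t x x + pY t x x) * u t x + p t x x * ux t x
     + (pX t x x * u t x + integral {0..x} (\<lambda>y. pXX t x y * u t y)))"

definition zt :: "real \<Rightarrow> real \<Rightarrow> real" where
  "zt t x = ut t x - (dl t * integral {0..x} (\<lambda>y. p t x y * u t y)
     + l t * (integral {0..x} (\<lambda>y. pt t x y * u t y) + integral {0..x} (\<lambda>y. p t x y * ut t y)))"

text \<open>Defect in the kernel equation
  \<open>k_t = \<alpha> (k_xx - k_yy) - (\<lambda>(y) + c) k\<close>. The first-order terms arise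
  because the rescaled coordinates move with the boundary.\<close>

definition residual :: "real \<Rightarrow> real \<Rightarrow> real \<Rightarrow> real" where
  "residual t x y = pt t x y - a t * (pXX t x y - pYY t x y)
     - dl t / l t * (x * pX t x y + y * pY t x y) + (lm t y + c) * p t x y"

text \<open>Each summand vanishes for the exact kernel: the first by the condition on the diagonal
  in differentiated form, the second by k(x, 0) = 0, the third by the kernel equation.\<close>

definition source :: "real \<Rightarrow> real \<Rightarrow> real" where
  "source t x = (lm t x + c + 2 * a t * l t * (pX t x x + pY t x x)) * u t x
     + a t * l t * p t x 0 * ux t 0 - l t * integral {0..x} (\<lambda>y. residual t x y * u t y)"

lemma cl: "continuous_on {t1..T} l"
  using dl by (meson DERIV_continuous continuous_on_eq_continuous_within)

lemma cl': "continuous_on ({t1..T} \<times> {0..1::real}) (\<lambda>r. l (fst r))"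
  "continuous_on ({t1..T} \<times> {0..1::real}) (\<lambda>r. dl (fst r))"
  by (rule continuous_on_compose2[OF cl] continuous_on_compose2[OF cdl];
      auto intro!: continuous_intros)+

lemmas slices = continuous_on_slice[OF cu] continuous_on_slice[OF cux] continuous_on_slice[OF cuxx]
  continuous_on_slice[OF cut]

lemma continuous_z:
  "continuous_on ({t1..T} \<times> {0..1}) (\<lambda>(t, x). z t x)"
  "continuous_on ({t1..T} \<times> {0..1}) (\<lambda>(t, x). zx t x)"
  "continuous_on ({t1..T} \<times> {0..1}) (\<lambda>(t, x). zxx t x)"
  "continuous_on ({t1..T} \<times> {0..1}) (\<lambda>(t, x). zt t x)"
  using continuous_on_Volterra[OF cp cu] continuous_on_Volterra[OF cpX cu]
    continuous_on_Volterra[OF cpXX cu] continuous_on_Volterra[OF cpt cu] continuous_on_Volterra[OF cp cut]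
    cl' cu cux cuxx cut Volterra_dom_diagonal[OF cp] Volterra_dom_diagonal[OF cpX] Volterra_dom_diagonal[OF cpY]
  unfolding split_beta z_def zx_def zxx_def zt_def
  by - (intro continuous_intros; assumption)+

lemma has_real_derivative_kernel_integral:
  assumes t: "t \<in> {t1..T}" and x: "x \<in> {0..1}"
    and q: "continuous_on (Volterra_dom t1 T) (\<lambda>(t, x, y). q t x y)"
    and qX: "continuous_on (Volterra_dom t1 T) (\<lambda>(t, x, y). qX t x y)"
    and d: "\<And>x y. 0 \<le> y \<Longrightarrow> y \<le> x \<Longrightarrow> x \<le> 1 \<Longrightarrow>
      ((\<lambda>x. q t x y) has_real_derivative qX t x y) (at x within {y..1})"
  shows "((\<lambda>x. integral {0..x} (\<lambda>y. q t x y * u t y)) has_real_derivative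
    q t x x * u t x + integral {0..x} (\<lambda>y. qX t x y * u t y)) (at x within {0..1})"
proof (rule has_real_derivative_Volterra[OF _ _ _ x])
  have *: "continuous_on {(x, y). 0 \<le> y \<and> y \<le> x \<and> x \<le> (1::real)} (\<lambda>r. u t (snd r))"
    by (rule continuous_on_compose2[OF slices(1)[OF t]]) (auto intro!: continuous_intros)
  show "continuous_on {(x, y). 0 \<le> y \<and> y \<le> x \<and> x \<le> 1} (\<lambda>(x, y). q t x y * u t y)"
    "continuous_on {(x, y). 0 \<le> y \<and> y \<le> x \<and> x \<le> 1} (\<lambda>(x, y). qX t x y * u t y)"
    using Volterra_dom_slice(1)[OF q t] Volterra_dom_slice(1)[OF qX t] *
    unfolding split_beta by - (intro continuous_intros; assumption)+
  show "((\<lambda>x. q t x y * u t y) has_real_derivative qX t x y * u t y) (at x within {y..1})"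
    if "0 \<le> y" "y \<le> x" "x \<le> 1" for x y
    by (rule DERIV_cmult_right[OF d[OF that]])
qed

lemma has_real_derivative_z:
  assumes t: "t \<in> {t1..T}" and x: "x \<in> {0..1}"
  shows "(z t has_real_derivative zx t x) (at x within {0..1})"
    and "(zx t has_real_derivative zxx t x) (at x within {0..1})"
    and "((\<lambda>t. z t x) has_real_derivative zt t x) (at t within {t1..T})"
proof -
  note d = has_real_derivative_kernel_integral[OF t x cp cpX dpX[OF t]]
    has_real_derivative_kernel_integral[OF t x cpX cpXX dpXX[OF t]]
  show "(z t has_real_derivative zx t x) (at x within {0..1})"
    unfolding z_def zx_def
    by (intro DERIV_diff dux DERIV_cmult d t x)
  show "(zx t has_real_derivative zxx t x) (at x within {0..1})"
    unfolding zxx_def zx_def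
    by (rule derivative_eq_intros d dux duxx dpdiag t x refl | simp add: algebra_simps)+
  have "((\<lambda>t. integral (cbox 0 x) (\<lambda>y. p t x y * u t y)) has_real_derivative
     integral (cbox 0 x) (\<lambda>y. pt t x y * u t y + p t x y * ut t y)) (at t within {t1..T})"
  proof (rule leibniz_rule_field_derivative)
    show "((\<lambda>t. p t x y * u t y) has_real_derivative pt t x y * u t y + p t x y * ut t y) (at t within {t1..T})"
      if "t \<in> {t1..T}" "y \<in> cbox 0 x" for t y
      using that x by (auto intro!: derivative_eq_intros dpt dut simp: algebra_simps)
    show "(\<lambda>y. p t x y * u t y) integrable_on cbox 0 x" if "t \<in> {t1..T}" for t
      unfolding cbox_interval using x
      by (intro integrable_continuous_real continuous_intros Volterra_dom_slice(2)[OF cp that]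
        continuous_on_subset[OF slices(1)[OF that]]) auto
    have *: "continuous_on ({t1..T} \<times> cbox 0 x) (\<lambda>(t, y). q t x y)"
      if "continuous_on (Volterra_dom t1 T) (\<lambda>(t, x, y). q t x y)" for q
    proof -
      have "continuous_on ({t1..T} \<times> cbox 0 x) (\<lambda>r. (\<lambda>(t, x, y). q t x y) (fst r, x, snd r))"
        by (rule continuous_on_compose2[OF that])
          (use x in \<open>auto simp: Volterra_dom_def intro!: continuous_intros\<close>)
      then show ?thesis by (simp add: split_beta)
    qed
    have "continuous_on ({t1..T} \<times> cbox 0 x) (\<lambda>(t, y). u t y)" "continuous_on ({t1..T} \<times> cbox 0 x) (\<lambda>(t, y). ut t y)"
      by (rule continuous_on_subset[OF cu] continuous_on_subset[OF cut]; use x in auto)+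
    with *[OF cp] *[OF cpt]
    show "continuous_on ({t1..T} \<times> cbox 0 x) (\<lambda>(t, y). pt t x y * u t y + p t x y * ut t y)"
      unfolding split_beta by - (intro continuous_intros; assumption)+
  qed (use t in auto)
  moreover have "integral {0..x} (\<lambda>y. pt t x y * u t y + p t x y * ut t y)
    = integral {0..x} (\<lambda>y. pt t x y * u t y) + integral {0..x} (\<lambda>y. p t x y * ut t y)"
    using x by (intro integral_add integrable_continuous_real continuous_intros Volterra_dom_slice(2)[OF cp t]
       Volterra_dom_slice(2)[OF cpt t] continuous_on_subset[OF slices(1)[OF t]] continuous_on_subset[OF slices(4)[OF t]]) auto
  ultimately have "((\<lambda>t. integral {0..x} (\<lambda>y. p t x y * u t y)) has_real_derivative
     integral {0..x} (\<lambda>y. pt t x y * u t y) + integral {0..x} (\<lambda>y. p t x y * ut t y)) (at t within {t1..T})"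
    by simp
  from DERIV_diff[OF dut[OF t x] DERIV_mult[OF dl[OF t] this]]
  show "((\<lambda>t. z t x) has_real_derivative zt t x) (at t within {t1..T})"
    unfolding z_def zt_def by (rule DERIV_cong) (simp add: mult.commute)
qed

lemma continuous_residual:
  assumes t: "t \<in> {t1..T}" and x: "x \<in> {0..1}"
  shows "continuous_on {0..x} (residual t x)"
  unfolding residual_def using x
  by (intro continuous_intros Volterra_dom_slice(2)[OF cp t] Volterra_dom_slice(2)[OF cpX t]
    Volterra_dom_slice(2)[OF cpY t] Volterra_dom_slice(2)[OF cpXX t] Volterra_dom_slice(2)[OF cpYY t]
    Volterra_dom_slice(2)[OF cpt t] continuous_on_subset[OF clm[OF t]]) auto

text \<open>In the time derivative of the Volterra integral, \<open>ut\<close> is replaced by the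
  equation for u and two integrations by parts move the derivatives to p. At y = x the boundary
  terms combine with those of \<open>zxx\<close> into the derivative of p along the diagonal; at y =
  0, where u vanishes, only \<open>p t x 0 * ux t 0\<close> remains.\<close>

lemma pde_z:
  assumes t: "t \<in> {t1..T}" and x: "x \<in> {0..1}"
  shows "zt t x = a t * zxx t x + dl t / l t * (x * zx t x) - c * z t x + source t x"
proof -
  define b where "b = dl t / l t"
  have lb: "l t * b = dl t" using lpos[OF t] by (simp add: b_def)
  define I where "I = (\<lambda>q::real \<Rightarrow> real. integral {0..x} (\<lambda>y. q y * u t y))"
  have Ieq: "integral {0..x} (\<lambda>y. q y * u t y) = I q" for q by (simp add: I_def)
  have sub: "{0..x} \<subseteq> {0..1}" using x by auto
  note c = Volterra_dom_slice(2)[OF cp t x] Volterra_dom_slice(2)[OF cpX t x]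
    Volterra_dom_slice(2)[OF cpY t x] Volterra_dom_slice(2)[OF cpXX t x] Volterra_dom_slice(2)[OF cpYY t x]
    Volterra_dom_slice(2)[OF cpt t x]
    continuous_on_subset[OF slices(1)[OF t] sub] continuous_on_subset[OF slices(4)[OF t] sub]
    continuous_on_subset[OF clm[OF t] sub]
  have hI: "((\<lambda>y. q y * u t y) has_integral I q) {0..x}" if "continuous_on {0..x} q" for q
    unfolding I_def using that c by (intro integrable_integral integrable_continuous_real continuous_intros)
  \<comment> \<open>Derivative of \<open>a t * (p * ux - pY * u) + b * (y * p * u)\<close>: Green's
    identity for the diffusion together with the product rule for the drift.\<close>
  have "((\<lambda>y. a t * (p t x y * uxx t y - pYY t x y * u t y) + b * (p t x y * u t y + y * pY t x y * u t y + y * p t x y * ux t y)) has_integral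
      (a t * (p t x x * ux t x - pY t x x * u t x) + b * (x * p t x x * u t x))
      - (a t * (p t x 0 * ux t 0 - pY t x 0 * u t 0) + b * (0 * p t x 0 * u t 0))) {0..x}"
  proof (rule has_integral_real_derivative)
    fix y assume y: "y \<in> {0..x}"
    have "(u t has_real_derivative ux t y) (at y within {0..x})" "(ux t has_real_derivative uxx t y) (at y within {0..x})"
      using y sub by (auto intro!: DERIV_subset[OF dux[OF t]] DERIV_subset[OF duxx[OF t]])
    moreover have "((\<lambda>y. p t x y) has_real_derivative pY t x y) (at y within {0..x})"
      "((\<lambda>y. pY t x y) has_real_derivative pYY t x y) (at y within {0..x})"
      using y x by (auto intro!: dpY dpYY t)
    ultimately show "((\<lambda>y. a t * (p t x y * ux t y - pY t x y * u t y) + b * (y * p t x y * u t y)) has_real_derivative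
      a t * (p t x y * uxx t y - pYY t x y * u t y) + b * (p t x y * u t y + y * pY t x y * u t y + y * p t x y * ux t y)) (at y within {0..x})"
      by (auto intro!: derivative_eq_intros simp: algebra_simps)
  qed (use x in auto)
  then have "((\<lambda>y. (a t * (p t x y * uxx t y - pYY t x y * u t y) + b * (p t x y * u t y + y * pY t x y * u t y + y * p t x y * ux t y))
       + a t * (pYY t x y * u t y) - b * (p t x y * u t y) - b * ((y * pY t x y) * u t y) + (lm t y * p t x y) * u t y) has_integral
      ((a t * (p t x x * ux t x - pY t x x * u t x) + b * (x * p t x x * u t x))
      - (a t * (p t x 0 * ux t 0 - pY t x 0 * u t 0) + b * (0 * p t x 0 * u t 0)))
      + a t * I (pYY t x) - b * I (p t x) - b * I (\<lambda>y. y * pY t x y) + I (\<lambda>y. lm t y * p t x y)) {0..x}"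
    by (intro has_integral_add has_integral_diff has_integral_mult_right hI continuous_intros c)
  then have "((\<lambda>y. p t x y * ut t y) has_integral
      ((a t * (p t x x * ux t x - pY t x x * u t x) + b * (x * p t x x * u t x))
      - (a t * (p t x 0 * ux t 0 - pY t x 0 * u t 0) + b * (0 * p t x 0 * u t 0)))
      + a t * I (pYY t x) - b * I (p t x) - b * I (\<lambda>y. y * pY t x y) + I (\<lambda>y. lm t y * p t x y)) {0..x}"
  proof (rule has_integral_eq[rotated])
    fix y assume y: "y \<in> {0..x}"
    then have "y \<in> {0..1}" using x by auto
    from pde_u[OF t this]
    show "(a t * (p t x y * uxx t y - pYY t x y * u t y) + b * (p t x y * u t y + y * pY t x y * u t y + y * p t x y * ux t y))
       + a t * (pYY t x y * u t y) - b * (p t x y * u t y) - b * ((y * pY t x y) * u t y) + (lm t y * p t x y) * u t y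
       = p t x y * ut t y"
      unfolding b_def[symmetric] by (simp add: algebra_simps)
  qed
  then have Iut: "integral {0..x} (\<lambda>y. p t x y * ut t y) =
      (a t * (p t x x * ux t x - pY t x x * u t x) + b * (x * p t x x * u t x)) - a t * (p t x 0 * ux t 0)
      + a t * I (pYY t x) - b * I (p t x) - b * I (\<lambda>y. y * pY t x y) + I (\<lambda>y. lm t y * p t x y)"
    using u0[OF t] by (simp add: integral_unique)
  have "((\<lambda>y. pt t x y * u t y - a t * (pXX t x y * u t y - pYY t x y * u t y)
      - b * (x * (pX t x y * u t y) + (y * pY t x y) * u t y)
      + ((lm t y * p t x y) * u t y + c * (p t x y * u t y))) has_integral
      I (pt t x) - a t * (I (pXX t x) - I (pYY t x)) - b * (x * I (pX t x) + I (\<lambda>y. y * pY t x y))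
      + (I (\<lambda>y. lm t y * p t x y) + c * I (p t x))) {0..x}"
    by (intro has_integral_add has_integral_diff has_integral_mult_right hI continuous_intros c)
  moreover have "pt t x y * u t y - a t * (pXX t x y * u t y - pYY t x y * u t y)
      - b * (x * (pX t x y * u t y) + (y * pY t x y) * u t y)
      + ((lm t y * p t x y) * u t y + c * (p t x y * u t y)) = residual t x y * u t y" for y
    unfolding residual_def b_def[symmetric] by (simp add: algebra_simps)
  ultimately have Ires: "integral {0..x} (\<lambda>y. residual t x y * u t y) =
      I (pt t x) - a t * (I (pXX t x) - I (pYY t x)) - b * (x * I (pX t x) + I (\<lambda>y. y * pY t x y))
      + (I (\<lambda>y. lm t y * p t x y) + c * I (p t x))"
    by (simp add: integral_unique)
  show ?thesis
    unfolding zt_def zxx_def zx_def z_def source_def Iut Ires pde_u[OF t x]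
    unfolding b_def[symmetric] Ieq unfolding lb[symmetric]
    by (simp add: algebra_simps)
qed

lemma z_0: "t \<in> {t1..T} \<Longrightarrow> z t 0 = 0"
  by (simp add: z_def u0)

lemma zx_0: "t \<in> {t1..T} \<Longrightarrow> zx t 0 = ux t 0"
  by (simp add: zx_def u0)

text \<open>The hypothesis is the rescaled feedback law: its integral and trace terms are those that
  the transform produces at x = 1.\<close>

lemma zx_1:
  assumes "ux t 1 = - \<beta> * u t 1 + \<beta> * l t * integral {0..1} (\<lambda>y. p t 1 y * u t y)
     + l t * (p t 1 1 * u t 1 + integral {0..1} (\<lambda>y. pX t 1 y * u t y))"
  shows "zx t 1 = - \<beta> * z t 1"
  unfolding zx_def z_def using assms by (simp add: algebra_simps)

text \<open>Solving the equation for \<open>source\<close> expresses it through functions already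
  known to be continuous, so the dependence of the residual integral on x need not be
  examined.\<close>

lemma continuous_source:
  assumes t: "t \<in> {t1..T}"
  shows "continuous_on {0..1} (source t)"
proof -
  have "continuous_on {0..1} (\<lambda>x. zt t x - (a t * zxx t x + dl t / l t * (x * zx t x) - c * z t x))"
    using continuous_z[THEN continuous_on_slice, OF t] by (intro continuous_intros)
  then show ?thesis
    by (rule continuous_on_eq) (simp add: pde_z[OF t])
qed

end

section \<open>Norm bounds for the transformation and the source\<close>

lemma nrm2_integral_abs:
  assumes u: "continuous_on {0..1} u"
  shows "nrm2 (\<lambda>x. integral {0..x} (\<lambda>y. \<bar>u y\<bar>)) \<le> 2 / 3 * nrm2 u"
    and "continuous_on {0..1} (\<lambda>x. integral {0..x} (\<lambda>y. \<bar>u y\<bar>))"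
proof -
  have au: "continuous_on {0..1} (\<lambda>y. \<bar>u y\<bar>)" using u by (intro continuous_intros)
  note dU = integral_has_real_derivative[OF au]
  show "continuous_on {0..1} (\<lambda>x. integral {0..x} (\<lambda>y. \<bar>u y\<bar>))"
    using dU by (meson DERIV_continuous continuous_on_eq_continuous_within)
  have "nrm2 (\<lambda>x. integral {0..x} (\<lambda>y. \<bar>u y\<bar>)) \<le> 2 / 3 * nrm2 (\<lambda>y. \<bar>u y\<bar>)"
    by (rule Wirtinger_inequality[OF dU au]) simp_all
  then show "nrm2 (\<lambda>x. integral {0..x} (\<lambda>y. \<bar>u y\<bar>)) \<le> 2 / 3 * nrm2 u"
    by (simp add: nrm2_def)
qed

lemma abs_integral_mult_le:
  fixes k u :: "real \<Rightarrow> real"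
  assumes k: "continuous_on {0..x} k" and u: "continuous_on {0..x} u"
    and b: "\<And>y. y \<in> {0..x} \<Longrightarrow> \<bar>k y\<bar> \<le> \<tau>"
  shows "\<bar>integral {0..x} (\<lambda>y. k y * u y)\<bar> \<le> \<tau> * integral {0..x} (\<lambda>y. \<bar>u y\<bar>)"
proof -
  have "norm (integral {0..x} (\<lambda>y. k y * u y)) \<le> integral {0..x} (\<lambda>y. \<tau> * \<bar>u y\<bar>)"
  proof (rule integral_norm_bound_integral)
    show "(\<lambda>y. k y * u y) integrable_on {0..x}" "(\<lambda>y. \<tau> * \<bar>u y\<bar>) integrable_on {0..x}"
      using k u by (auto intro!: integrable_continuous_real continuous_intros)
    show "norm (k y * u y) \<le> \<tau> * \<bar>u y\<bar>" if "y \<in> {0..x}" for y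
      using b[OF that] by (auto simp: abs_mult intro!: mult_right_mono)
  qed
  then show ?thesis by simp
qed

text \<open>Pointwise, z and u differ by at most \<open>l * \<tau>\<close> times the primitive of
  |u|, which gives the first bound. The same inequality, read as a differential inequality for that
  primitive, lets Gronwall replace it by \<open>exp (l * \<tau>)\<close> times the primitive of |z|.
  The inverse is thereby bounded without its kernel.\<close>

lemma Volterra_norm_bounds:
  fixes k :: "real \<Rightarrow> real \<Rightarrow> real" and u z :: "real \<Rightarrow> real"
  assumes k: "\<And>x. x \<in> {0..1} \<Longrightarrow> continuous_on {0..x} (k x)"
    and b: "\<And>x y. 0 \<le> y \<Longrightarrow> y \<le> x \<Longrightarrow> x \<le> 1 \<Longrightarrow> \<bar>k x y\<bar> \<le> \<tau>"
    and l: "0 \<le> l" and u: "continuous_on {0..1} u" and z: "continuous_on {0..1} z"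
    and zu: "\<And>x. x \<in> {0..1} \<Longrightarrow> z x = u x - l * integral {0..x} (\<lambda>y. k x y * u y)"
  shows "nrm2 z \<le> (1 + 2 / 3 * (l * \<tau>)) * nrm2 u"
    and "nrm2 u \<le> (1 + 2 / 3 * (l * \<tau> * exp (l * \<tau>))) * nrm2 z"
proof -
  have \<tau>: "0 \<le> \<tau>" using b[of 0 0] by simp
  have l\<tau>: "0 \<le> l * \<tau>" using l \<tau> by simp
  define U where "U = (\<lambda>x. integral {0..x} (\<lambda>y. \<bar>u y\<bar>))"
  define Z where "Z = (\<lambda>x. integral {0..x} (\<lambda>y. \<bar>z y\<bar>))"
  have au: "continuous_on {0..1} (\<lambda>y. \<bar>u y\<bar>)" and az: "continuous_on {0..1} (\<lambda>y. \<bar>z y\<bar>)"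
    using u z by (auto intro!: continuous_intros)
  have dU: "(U has_real_derivative \<bar>u x\<bar>) (at x within {0..1})"
    and dZ: "(Z has_real_derivative \<bar>z x\<bar>) (at x within {0..1})" if "x \<in> {0..1}" for x
    unfolding U_def Z_def using integral_has_real_derivative[OF au that] integral_has_real_derivative[OF az that] by auto
  have cU: "continuous_on {0..1} U" and cZ: "continuous_on {0..1} Z"
    using dU dZ by (meson DERIV_continuous continuous_on_eq_continuous_within)+
  have U0: "U 0 = 0" "Z 0 = 0" by (simp_all add: U_def Z_def)
  have nabs: "nrm2 (\<lambda>y. \<bar>u y\<bar>) = nrm2 u" "nrm2 (\<lambda>y. \<bar>z y\<bar>) = nrm2 z" by (simp_all add: nrm2_def)
  have nU: "nrm2 U \<le> 2 / 3 * nrm2 u" and nZ: "nrm2 Z \<le> 2 / 3 * nrm2 z"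
    unfolding U_def Z_def by (rule nrm2_integral_abs(1)[OF u] nrm2_integral_abs(1)[OF z])+
  have diff: "\<bar>z x - u x\<bar> \<le> l * \<tau> * U x" if x: "x \<in> {0..1}" for x
  proof -
    have sub: "{0..x} \<subseteq> {0..1}" using x by auto
    have "\<bar>integral {0..x} (\<lambda>y. k x y * u y)\<bar> \<le> \<tau> * U x"
      unfolding U_def using b x
      by (intro abs_integral_mult_le k continuous_on_subset[OF u sub]) auto
    then show ?thesis using zu[OF x] l by (simp add: abs_mult mult_left_mono mult.assoc)
  qed
  have Uge: "0 \<le> U x" "0 \<le> Z x" if x: "x \<in> {0..1}" for x
    unfolding U_def Z_def using x
    by (auto intro!: integral_nonneg integrable_continuous_real continuous_intros continuous_on_subset[OF u] continuous_on_subset[OF z])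
  have "nrm2 z \<le> nrm2 (\<lambda>x. \<bar>u x\<bar> + l * \<tau> * U x)"
  proof (intro nrm2_mono continuous_intros u z cU)
    fix x :: real assume x: "x \<in> {0..1}"
    have "\<bar>z x\<bar> \<le> \<bar>u x\<bar> + l * \<tau> * U x" using diff[OF x] by linarith
    then show "\<bar>z x\<bar> \<le> \<bar>\<bar>u x\<bar> + l * \<tau> * U x\<bar>" by linarith
  qed
  also have "\<dots> \<le> nrm2 (\<lambda>x. \<bar>u x\<bar>) + nrm2 (\<lambda>x. l * \<tau> * U x)"
    by (intro nrm2_triangle continuous_intros u cU)
  also have "\<dots> = nrm2 u + l * \<tau> * nrm2 U"
    using l\<tau> by (simp add: nrm2_cmult nabs)
  also have "\<dots> \<le> nrm2 u + l * \<tau> * (2 / 3 * nrm2 u)"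
    using nU l\<tau> by (intro add_left_mono mult_left_mono) auto
  finally show "nrm2 z \<le> (1 + 2 / 3 * (l * \<tau>)) * nrm2 u" by (simp add: algebra_simps)
  have Gronwall: "U x \<le> exp (l * \<tau>) * Z x" if x: "x \<in> {0..1}" for x
  proof -
    \<comment> \<open>From |u| \<le> |z| + l \<tau> U, the derivative of exp (- l \<tau> x) U is at
      most |z|, the derivative of Z; so G decreases from G 0 = 0.\<close>
    define G where "G = (\<lambda>x. exp (- (l * \<tau>) * x) * U x - Z x)"
    have dG: "(G has_real_derivative exp (- (l * \<tau>) * r) * (\<bar>u r\<bar> - l * \<tau> * U r) - \<bar>z r\<bar>) (at r within {0..1})"
      if "r \<in> {0..1}" for r
      unfolding G_def using that by (auto intro!: derivative_eq_intros dU dZ simp: algebra_simps)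
    have "G x \<le> G 0"
    proof (rule DERIV_nonpos_imp_decreasing_open[of 0 x G])
      have "continuous_on {0..1} G" unfolding G_def by (intro continuous_intros cU cZ)
      then show "continuous_on {0..x} G" by (rule continuous_on_subset) (use x in auto)
      fix r assume r: "0 < r" "r < x"
      then have r': "r \<in> {0..1}" "r \<in> interior {0..1}" using x by auto
      have "exp (- (l * \<tau>) * r) * (\<bar>u r\<bar> - l * \<tau> * U r) \<le> exp (- (l * \<tau>) * r) * \<bar>z r\<bar>"
        using diff[OF r'(1)] by (intro mult_left_mono) auto
      also have "\<dots> \<le> 1 * \<bar>z r\<bar>"
        using l\<tau> r by (intro mult_right_mono) auto
      finally show "\<exists>y. (G has_real_derivative y) (at r) \<and> y \<le> 0"
        using dG[OF r'(1)] at_within_interior[OF r'(2)] by auto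
    qed (use x in auto)
    then have "exp (- (l * \<tau>) * x) * U x \<le> Z x" by (simp add: G_def U0)
    then have "exp (l * \<tau> * x) * (exp (- (l * \<tau>) * x) * U x) \<le> exp (l * \<tau> * x) * Z x"
      by (rule mult_left_mono) simp
    then have "U x \<le> exp (l * \<tau> * x) * Z x" by (simp add: exp_minus field_simps)
    also have "\<dots> \<le> exp (l * \<tau>) * Z x"
      using l\<tau> x Uge[OF x] by (intro mult_right_mono) (auto intro: mult_left_le)
    finally show ?thesis .
  qed
  define M where "M = l * \<tau> * exp (l * \<tau>)"
  have M: "0 \<le> M" using l\<tau> by (simp add: M_def)
  have "nrm2 u \<le> nrm2 (\<lambda>x. \<bar>z x\<bar> + M * Z x)"
  proof (intro nrm2_mono continuous_intros u z cZ)
    fix x :: real assume x: "x \<in> {0..1}"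
    have "l * \<tau> * U x \<le> l * \<tau> * (exp (l * \<tau>) * Z x)" using Gronwall[OF x] l\<tau> by (rule mult_left_mono)
    then have "\<bar>u x\<bar> \<le> \<bar>z x\<bar> + M * Z x" using diff[OF x] by (simp add: M_def mult.assoc)
    then show "\<bar>u x\<bar> \<le> \<bar>\<bar>z x\<bar> + M * Z x\<bar>" by linarith
  qed
  also have "\<dots> \<le> nrm2 (\<lambda>x. \<bar>z x\<bar>) + nrm2 (\<lambda>x. M * Z x)"
    by (intro nrm2_triangle continuous_intros z cZ)
  also have "\<dots> = nrm2 z + M * nrm2 Z"
    using M by (simp add: nrm2_cmult nabs)
  also have "\<dots> \<le> nrm2 z + M * (2 / 3 * nrm2 z)"
    using nZ M by (intro add_left_mono mult_left_mono) auto
  finally show "nrm2 u \<le> (1 + 2 / 3 * (l * \<tau> * exp (l * \<tau>))) * nrm2 z" by (simp add: M_def algebra_simps)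
qed

lemma (in rescaled_transform) nrm2_source_le:
  assumes t: "t \<in> {t1..T}" and \<epsilon>: "0 \<le> \<epsilon>" and a: "0 \<le> a t"
    and b1: "\<And>x. x \<in> {0..1} \<Longrightarrow> \<bar>lm t x + c + 2 * a t * l t * (pX t x x + pY t x x)\<bar> \<le> \<epsilon>"
    and b2: "\<And>x. x \<in> {0..1} \<Longrightarrow> \<bar>p t x 0\<bar> \<le> \<epsilon>"
    and b3: "\<And>x y. 0 \<le> y \<Longrightarrow> y \<le> x \<Longrightarrow> x \<le> 1 \<Longrightarrow> \<bar>residual t x y\<bar> \<le> \<epsilon>"
  shows "nrm2 (source t) \<le> \<epsilon> * ((1 + 2 / 3 * l t) * nrm2 (u t) + a t * l t * \<bar>ux t 0\<bar>)"
proof -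
  define U where "U = (\<lambda>x. integral {0..x} (\<lambda>y. \<bar>u t y\<bar>))"
  define g where "g = \<epsilon> * (a t * l t * \<bar>ux t 0\<bar>)"
  have l: "0 < l t" by (rule lpos[OF t])
  have g0: "0 \<le> g" using \<epsilon> a l by (simp add: g_def)
  note cu = slices(1)[OF t]
  note nU = nrm2_integral_abs[OF cu, folded U_def]
  have U0: "0 \<le> U x" if "x \<in> {0..1}" for x
    unfolding U_def using that
    by (intro integral_nonneg integrable_continuous_real continuous_intros continuous_on_subset[OF cu]) auto
  have "nrm2 (source t) \<le> nrm2 (\<lambda>x. (\<epsilon> * \<bar>u t x\<bar> + \<epsilon> * l t * U x) + g)"
  proof (intro nrm2_mono continuous_source continuous_intros cu nU t)
    fix x :: real assume x: "x \<in> {0..1}"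
    have "\<bar>integral {0..x} (\<lambda>y. residual t x y * u t y)\<bar> \<le> \<epsilon> * U x"
      unfolding U_def using b3 x
      by (intro abs_integral_mult_le continuous_residual continuous_on_subset[OF cu] t) auto
    then have "\<bar>l t * integral {0..x} (\<lambda>y. residual t x y * u t y)\<bar> \<le> \<epsilon> * l t * U x"
      using l by (simp add: abs_mult mult_left_mono mult.left_commute)
    moreover have "\<bar>(lm t x + c + 2 * a t * l t * (pX t x x + pY t x x)) * u t x\<bar> \<le> \<epsilon> * \<bar>u t x\<bar>"
      unfolding abs_mult by (intro mult_right_mono b1 x) simp
    moreover have "\<bar>a t * l t * p t x 0 * ux t 0\<bar> \<le> g"
    proof -
      have "\<bar>p t x 0\<bar> * (a t * l t * \<bar>ux t 0\<bar>) \<le> \<epsilon> * (a t * l t * \<bar>ux t 0\<bar>)"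
        using b2[OF x] a l by (intro mult_right_mono) auto
      then show ?thesis using a l by (simp add: g_def abs_mult mult_ac)
    qed
    ultimately have "\<bar>source t x\<bar> \<le> (\<epsilon> * \<bar>u t x\<bar> + \<epsilon> * l t * U x) + g"
      unfolding source_def by linarith
    then show "\<bar>source t x\<bar> \<le> \<bar>(\<epsilon> * \<bar>u t x\<bar> + \<epsilon> * l t * U x) + g\<bar>" by linarith
  qed
  also have "\<dots> \<le> nrm2 (\<lambda>x. \<epsilon> * \<bar>u t x\<bar> + \<epsilon> * l t * U x) + nrm2 (\<lambda>_. g)"
    by (intro nrm2_triangle continuous_intros cu nU)
  also have "nrm2 (\<lambda>_. g) \<le> g"
    using g0 by (intro nrm2_const_le) auto
  also have "nrm2 (\<lambda>x. \<epsilon> * \<bar>u t x\<bar> + \<epsilon> * l t * U x)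
      \<le> nrm2 (\<lambda>x. \<epsilon> * \<bar>u t x\<bar>) + nrm2 (\<lambda>x. \<epsilon> * l t * U x)"
    by (intro nrm2_triangle continuous_intros cu nU)
  also have "\<dots> = \<epsilon> * nrm2 (u t) + \<epsilon> * l t * nrm2 U"
  proof -
    have "nrm2 (\<lambda>x. \<bar>u t x\<bar>) = nrm2 (u t)" by (simp add: nrm2_def)
    then show ?thesis using \<epsilon> l by (simp only: nrm2_cmult) simp
  qed
  also have "\<dots> \<le> \<epsilon> * nrm2 (u t) + \<epsilon> * l t * (2 / 3 * nrm2 (u t))"
    using nU(1) \<epsilon> l by (intro add_left_mono mult_left_mono) auto
  finally show ?thesis by (simp add: g_def algebra_simps)
qed

section \<open>Kernels in rescaled coordinates\<close>

lemma has_real_derivative_transform: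
  fixes f g :: "real \<Rightarrow> real"
  assumes "x \<in> S" "\<And>y. y \<in> S \<Longrightarrow> g y = f y" "(f has_real_derivative D) (at x within S)"
  shows "(g has_real_derivative D) (at x within S)"
  using assms unfolding has_field_derivative_def by (rule has_derivative_transform)

lemma has_real_derivative_unique:
  fixes f :: "real \<Rightarrow> real"
  assumes "a < b" "x \<in> {a..b}"
    "(f has_real_derivative D) (at x within {a..b})" "(f has_real_derivative D') (at x within {a..b})"
  shows "D = D'"
  using assms unfolding has_real_derivative_iff_has_vector_derivative
  by (intro vector_derivative_unique_within_closed_interval[of a b x f]) (simp_all add: cbox_interval)

text \<open>Segments from p stay in S, so one-sided derivatives along them determine
  \<open>D (y - p)\<close> for all y in S. Subtracting two such values with y in a ball inside S
  recovers D in every direction. This also covers corners of S, where few directions are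
  admissible.\<close>

lemma has_derivative_unique_convex:
  fixes f :: "'a::real_normed_vector \<Rightarrow> 'b::real_normed_vector"
  assumes S: "convex S" "interior S \<noteq> {}" and p: "p \<in> S"
    and D1: "(f has_derivative D1) (at p within S)" and D2: "(f has_derivative D2) (at p within S)"
  shows "D1 = D2"
proof
  interpret D1: bounded_linear D1 using D1 by (rule has_derivative_bounded_linear)
  interpret D2: bounded_linear D2 using D2 by (rule has_derivative_bounded_linear)
  have dir: "D1 (y - p) = D2 (y - p)" if y: "y \<in> S" for y
  proof -
    have sub: "(\<lambda>s. p + s *\<^sub>R (y - p)) ` {0..1} \<subseteq> S"
    proof safe
      fix s :: real assume s: "s \<in> {0..1}"
      have "p + s *\<^sub>R (y - p) = (1 - s) *\<^sub>R p + s *\<^sub>R y" by (simp add: algebra_simps)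
      also have "\<dots> \<in> S" using S(1) p y s by (intro convexD) auto
      finally show "p + s *\<^sub>R (y - p) \<in> S" .
    qed
    have "((\<lambda>s. f (p + s *\<^sub>R (y - p))) has_vector_derivative D (y - p)) (at 0 within {0..1})"
      if D: "(f has_derivative D) (at p within S)" for D
    proof -
      have lin: "bounded_linear D" using D by (rule has_derivative_bounded_linear)
      have "((\<lambda>s. p + s *\<^sub>R (y - p)) has_derivative (\<lambda>s. s *\<^sub>R (y - p))) (at 0 within {0..1})"
        by (auto intro!: derivative_eq_intros)
      from has_derivative_in_compose[OF this, of f D] has_derivative_subset[OF D sub]
      show ?thesis
        unfolding has_vector_derivative_def
        by (simp add: linear_simps(5)[OF lin])
    qed
    from this[OF D1] this[OF D2] show ?thesis
      by (intro vector_derivative_unique_within_closed_interval[of 0 1 0]) (auto simp: cbox_interval)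
  qed
  obtain q r where r: "0 < r" "ball q r \<subseteq> S"
    using S(2) by (auto simp: mem_interior ex_in_conv[symmetric])
  fix v
  show "D1 v = D2 v"
  proof (cases "v = 0")
    case False
    define s where "s = r / (2 * norm v)"
    have s: "0 < s" using False r by (simp add: s_def)
    have "q + s *\<^sub>R v \<in> ball q r" using False r s by (simp add: s_def dist_norm)
    then have "D1 (q + s *\<^sub>R v - p) = D2 (q + s *\<^sub>R v - p)" "D1 (q - p) = D2 (q - p)"
      using r by (auto intro!: dir)
    then have "D1 ((q + s *\<^sub>R v - p) - (q - p)) = D2 ((q + s *\<^sub>R v - p) - (q - p))"
      by (simp only: D1.diff D2.diff)
    then have "s *\<^sub>R D1 v = s *\<^sub>R D2 v" by (simp add: D1.scaleR D2.scaleR)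
    then show ?thesis using s by simp
  qed (simp add: D1.zero D2.zero)
qed

lemma pd_eqI:
  fixes f :: "'a::real_normed_vector \<Rightarrow> 'b::real_normed_vector"
  assumes "convex S" "interior S \<noteq> {}" "p \<in> S" "(f has_derivative D) (at p within S)"
  shows "pd S w f p = D w"
proof -
  have "(f has_derivative frechet_derivative f (at p within S)) (at p within S)"
    using assms(4) by (auto simp: frechet_derivative_works[symmetric] differentiable_def)
  from has_derivative_unique_convex[OF assms(1-3) this assms(4)] show ?thesis
    by (simp add: pd_def)
qed

text \<open>Writing f as \<open>f x c\<close> plus the integral of \<open>fy\<close> and
  differentiating under the integral gives \<open>fx x y = fx x c\<close> plus the integral of
  \<open>B x\<close> from c to y; the derivative of this in y is B. Of the two mixed derivatives
  only B has to be continuous.\<close>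

lemma mixed_derivatives_eq_rectangle:
  fixes f fx fy A B :: "real \<Rightarrow> real \<Rightarrow> real"
  assumes ab: "a < b" "c < d"
    and fx: "\<And>x y. x \<in> {a..b} \<Longrightarrow> y \<in> {c..d} \<Longrightarrow> ((\<lambda>x. f x y) has_real_derivative fx x y) (at x within {a..b})"
    and fy: "\<And>x y. x \<in> {a..b} \<Longrightarrow> y \<in> {c..d} \<Longrightarrow> (f x has_real_derivative fy x y) (at y within {c..d})"
    and A: "\<And>x y. x \<in> {a..b} \<Longrightarrow> y \<in> {c..d} \<Longrightarrow> (fx x has_real_derivative A x y) (at y within {c..d})"
    and B: "\<And>x y. x \<in> {a..b} \<Longrightarrow> y \<in> {c..d} \<Longrightarrow> ((\<lambda>x. fy x y) has_real_derivative B x y) (at x within {a..b})"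
    and cB: "continuous_on ({a..b} \<times> {c..d}) (\<lambda>(x, y). B x y)"
    and cfy: "continuous_on ({a..b} \<times> {c..d}) (\<lambda>(x, y). fy x y)"
    and xy: "x \<in> {a..b}" "y \<in> {c..d}"
  shows "A x y = B x y"
proof -
  have rep: "fx x y = fx x c + integral {c..y} (B x)" if y: "y \<in> {c..d}" for y
  proof -
    have sub: "{c..y} \<subseteq> {c..d}" using y by auto
    have "((\<lambda>x. integral (cbox c y) (fy x)) has_real_derivative integral (cbox c y) (B x)) (at x within {a..b})"
    proof (rule leibniz_rule_field_derivative)
      show "((\<lambda>x. fy x t) has_real_derivative B x t) (at x within {a..b})" if "x \<in> {a..b}" "t \<in> cbox c y" for x t
        using that sub by (intro B) auto
      show "fy x integrable_on cbox c y" if "x \<in> {a..b}" for x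
        unfolding cbox_interval using continuous_on_slice[OF cfy that] sub
        by (auto intro!: integrable_continuous_real elim: continuous_on_subset)
      show "continuous_on ({a..b} \<times> cbox c y) (\<lambda>(x, y). B x y)"
        by (rule continuous_on_subset[OF cB]) (use sub in auto)
    qed (use xy in auto)
    then have "((\<lambda>x. f x c + integral {c..y} (fy x)) has_real_derivative fx x c + integral {c..y} (B x)) (at x within {a..b})"
      using fx[OF xy(1), of c] ab by (auto intro!: derivative_intros)
    moreover have eq: "f x y = f x c + integral {c..y} (fy x)" if x: "x \<in> {a..b}" for x
    proof -
      have "(fy x has_integral f x y - f x c) {c..y}"
        using y sub by (intro has_integral_real_derivative DERIV_subset[OF fy[OF x]]) auto
      then show ?thesis by (simp add: integral_unique)
    qed
    ultimately have "((\<lambda>x. f x y) has_real_derivative fx x c + integral {c..y} (B x)) (at x within {a..b})"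
      by (intro has_real_derivative_transform[OF xy(1) eq])
    with fx[OF xy(1) y] show ?thesis
      by (rule has_real_derivative_unique[OF ab(1) xy(1)])
  qed
  have "((\<lambda>y. fx x c + integral {c..y} (B x)) has_real_derivative 0 + B x y) (at y within {c..d})"
    by (intro DERIV_add DERIV_const integral_has_real_derivative continuous_on_slice[OF cB] xy)
  then have "(fx x has_real_derivative B x y) (at y within {c..d})"
    by (intro has_real_derivative_transform[OF xy(2) rep]) simp_all
  with A[OF xy] show ?thesis
    by (rule has_real_derivative_unique[OF ab(2) xy(2)])
qed

lemma has_real_derivative_along:
  fixes F :: "'a::real_normed_vector \<Rightarrow> real" and \<gamma> :: "real \<Rightarrow> 'a"
  assumes "(F has_derivative F') (at (\<gamma> s) within D)"
    and "(\<gamma> has_vector_derivative w) (at s within A)" and "\<gamma> ` A \<subseteq> D"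
  shows "((\<lambda>s. F (\<gamma> s)) has_real_derivative F' w) (at s within A)"
proof -
  have lin: "bounded_linear F'" using assms(1) by (rule has_derivative_bounded_linear)
  have "((\<lambda>s. F (\<gamma> s)) has_derivative (\<lambda>r. F' (r *\<^sub>R w))) (at s within A)"
    by (rule has_derivative_in_compose[OF assms(2)[unfolded has_vector_derivative_def]
      has_derivative_subset[OF assms(1,3)]])
  then show ?thesis
    unfolding has_field_derivative_def
    by (rule has_derivative_eq_rhs) (simp add: fun_eq_iff linear_simps(5)[OF lin] mult.commute)
qed

section \<open>The kernel domain and twice differentiable functions on it\<close>

lemma Dom_iff: "(\<xi>, \<eta>, t) \<in> Dom t0 T \<longleftrightarrow> 0 \<le> \<eta> \<and> \<eta> \<le> \<xi> \<and> \<xi> \<le> 2 - \<eta> \<and> t0 \<le> t \<and> t \<le> T"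
  by (auto simp: Dom_def Sbar_def)

lemma convex_Dom: "convex (Dom t0 T)"
proof (rule convexI)
  fix p q and r s :: real
  assume pq: "p \<in> Dom t0 T" "q \<in> Dom t0 T" and rs: "0 \<le> r" "0 \<le> s" "r + s = 1"
  obtain a b c where p: "p = (a, b, c)" by (cases p) auto
  obtain a' b' c' where q: "q = (a', b', c')" by (cases q) auto
  have s: "s = 1 - r" using rs by simp
  have comb: "r * x + s * x' \<le> r * y + s * y'" if "x \<le> y" "x' \<le> y'" for x x' y y' :: real
    using that rs by (intro add_mono mult_left_mono) auto
  show "r *\<^sub>R p + s *\<^sub>R q \<in> Dom t0 T"
    using pq comb[of 0 b 0 b'] comb[of b a b' a'] comb[of a "2 - b" a' "2 - b'"] comb[of t0 c t0 c'] comb[of c T c' T]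
    unfolding p q by (simp add: Dom_iff s algebra_simps)
qed

lemma closed_Dom: "closed (Dom t0 T)"
proof -
  have "Dom t0 T = {p. 0 \<le> fst (snd p)} \<inter> {p. fst (snd p) \<le> fst p} \<inter> {p. fst p \<le> 2 - fst (snd p)}
     \<inter> {p. t0 \<le> snd (snd p)} \<inter> {p. snd (snd p) \<le> T}"
    by (auto simp: Dom_iff)
  also have "closed \<dots>"
    by (intro closed_Int closed_Collect_le continuous_intros)
  finally show ?thesis .
qed

lemma interior_Dom:
  assumes "t0 < T" shows "interior (Dom t0 T) \<noteq> {}"
proof -
  have "{9/10<..<11/10::real} \<times> {1/5<..<3/10::real} \<times> {t0<..<T} \<subseteq> interior (Dom t0 T)"
    by (intro interior_maximal open_Times) (auto simp: Dom_iff)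
  moreover have "(1, 1/4, (t0 + T) / 2) \<in> {9/10<..<11/10::real} \<times> {1/5<..<3/10::real} \<times> {t0<..<T}"
    using assms by auto
  ultimately show ?thesis by blast
qed

lemma compact_Dom: "compact (Dom t0 T)"
proof -
  have "Dom t0 T \<subseteq> {0..2} \<times> {0..2} \<times> {t0..T}" by (auto simp: Dom_iff)
  moreover have "bounded ({0..2::real} \<times> {0..2::real} \<times> {t0..T})"
    by (intro bounded_Times bounded_closed_interval)
  ultimately show ?thesis using closed_Dom bounded_subset compact_eq_bounded_closed by blast
qed

text \<open>\<open>C2_on\<close> with its existential witnesses exposed, so that the derivatives of
  a kernel and of a difference of kernels can be named.\<close>

definition C2_with :: "(real \<times> real \<times> real \<Rightarrow> real) \<Rightarrow> (real \<times> real \<times> real \<Rightarrow> (real \<times> real \<times> real) \<Rightarrow>\<^sub>L real)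
    \<Rightarrow> (real \<times> real \<times> real \<Rightarrow> (real \<times> real \<times> real) \<Rightarrow>\<^sub>L (real \<times> real \<times> real) \<Rightarrow>\<^sub>L real)
    \<Rightarrow> (real \<times> real \<times> real) set \<Rightarrow> bool" where
  "C2_with F F' F'' S \<longleftrightarrow> (\<forall>p\<in>S. (F has_derivative blinfun_apply (F' p)) (at p within S)) \<and>
     (\<forall>p\<in>S. (F' has_derivative blinfun_apply (F'' p)) (at p within S)) \<and>
     continuous_on S F' \<and> continuous_on S F''"

context
  fixes F F' F'' t0 T
  assumes C2: "C2_with F F' F'' (Dom t0 T)" and t0T: "t0 < T"
begin

lemma C2_has_derivative:
  assumes "p \<in> Dom t0 T"
  shows "(F has_derivative blinfun_apply (F' p)) (at p within Dom t0 T)"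
    and "((\<lambda>p. F' p w) has_derivative (\<lambda>h. F'' p h w)) (at p within Dom t0 T)"
proof -
  show "(F has_derivative blinfun_apply (F' p)) (at p within Dom t0 T)"
    using C2 assms by (simp add: C2_with_def)
  have "(F' has_derivative blinfun_apply (F'' p)) (at p within Dom t0 T)"
    using C2 assms by (simp add: C2_with_def)
  then show "((\<lambda>p. F' p w) has_derivative (\<lambda>h. F'' p h w)) (at p within Dom t0 T)"
    by (auto intro!: derivative_eq_intros)
qed

lemma C2_continuous_on:
  "continuous_on (Dom t0 T) F" "continuous_on (Dom t0 T) (\<lambda>p. F' p w)"
  "continuous_on (Dom t0 T) (\<lambda>p. F'' p w w')"
proof -
  show "continuous_on (Dom t0 T) F"
    unfolding continuous_on_eq_continuous_within
    using has_derivative_continuous[OF C2_has_derivative(1)] by blast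
  show "continuous_on (Dom t0 T) (\<lambda>p. F' p w)" "continuous_on (Dom t0 T) (\<lambda>p. F'' p w w')"
    using C2 by (auto simp: C2_with_def intro!: continuous_intros)
qed

lemma C2_pd:
  assumes p: "p \<in> Dom t0 T"
  shows "pd (Dom t0 T) w F p = F' p w" and "pd (Dom t0 T) w (pd (Dom t0 T) w' F) p = F'' p w w'"
proof -
  have *: "pd (Dom t0 T) w F p = F' p w" if p: "p \<in> Dom t0 T" for p w
    by (rule pd_eqI[OF convex_Dom interior_Dom[OF t0T] p C2_has_derivative(1)[OF p]])
  have "(pd (Dom t0 T) w' F has_derivative (\<lambda>h. F'' p h w')) (at p within Dom t0 T)"
    by (rule has_derivative_transform[OF p _ C2_has_derivative(2)[OF p]]) (rule *)
  then show "pd (Dom t0 T) w (pd (Dom t0 T) w' F) p = F'' p w w'"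
    by (rule pd_eqI[OF convex_Dom interior_Dom[OF t0T] p])
  show "pd (Dom t0 T) w F p = F' p w" by (rule *[OF p])
qed

text \<open>At interior points symmetry holds on a small rectangle; a closed convex set with
  nonempty interior is the closure of its interior, so continuity carries it to the boundary.
  Symmetry is what turns \<open>pXX - pYY\<close> into a multiple of the one mixed derivative that
  the residual contains.\<close>

lemma C2_symmetric:
  assumes p: "p \<in> Dom t0 T"
  shows "F'' p (1, 0, 0) (0, 1, 0) = F'' p (0, 1, 0) (1, 0, 0)"
proof -
  let ?e1 = "(1, 0, 0) :: real \<times> real \<times> real" and ?e2 = "(0, 1, 0) :: real \<times> real \<times> real"
  have inner: "F'' q ?e1 ?e2 - F'' q ?e2 ?e1 = 0" if q: "q \<in> interior (Dom t0 T)" for q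
  proof -
    obtain x y t where xyt: "q = (x, y, t)" by (cases q) auto
    obtain r where r: "0 < r" "ball q r \<subseteq> Dom t0 T" using q by (auto simp: mem_interior)
    define \<delta> where "\<delta> = r / 2"
    have \<delta>: "0 < \<delta>" using r by (simp add: \<delta>_def)
    have D: "(x', y', t) \<in> Dom t0 T" if "x' \<in> {x - \<delta>/2..x + \<delta>/2}" "y' \<in> {y - \<delta>/2..y + \<delta>/2}" for x' y'
    proof -
      have "dist q (x', y', t) \<le> \<bar>x - x'\<bar> + \<bar>y - y'\<bar>"
        using norm_Pair_le[of "x - x'" "(y - y', 0::real)"] norm_Pair_le[of "y - y'" "0::real"]
        by (simp add: xyt dist_norm)
      also have "\<dots> < r" using that \<delta> by (auto simp: \<delta>_def abs_le_iff)
      finally show ?thesis using r by auto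
    qed
    have d1: "((\<lambda>x. G (x, y', t)) has_real_derivative G' ?e1) (at x' within {x - \<delta>/2..x + \<delta>/2})"
      and d2: "((\<lambda>y. G (x', y, t)) has_real_derivative G' ?e2) (at y' within {y - \<delta>/2..y + \<delta>/2})"
      if "x' \<in> {x - \<delta>/2..x + \<delta>/2}" "y' \<in> {y - \<delta>/2..y + \<delta>/2}" "(G has_derivative G') (at (x', y', t) within Dom t0 T)"
      for x' y' and G :: "real \<times> real \<times> real \<Rightarrow> real" and G'
      by (rule has_real_derivative_along[where \<gamma> = "\<lambda>x. (x, y', t)" and s = x', OF that(3)]
          has_real_derivative_along[where \<gamma> = "\<lambda>y. (x', y, t)" and s = y', OF that(3)];
        use that D in \<open>auto intro!: derivative_eq_intros simp: has_vector_derivative_def zero_prod_def\<close>)+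
    have c: "continuous_on ({x - \<delta>/2..x + \<delta>/2} \<times> {y - \<delta>/2..y + \<delta>/2}) (\<lambda>(x, y). G (x, y, t))"
      if "continuous_on (Dom t0 T) G" for G :: "real \<times> real \<times> real \<Rightarrow> real"
      unfolding split_beta
      by (rule continuous_on_compose2[OF that]) (use D in \<open>auto intro!: continuous_intros\<close>)
    have "F'' (x, y, t) ?e2 ?e1 = F'' (x, y, t) ?e1 ?e2"
    proof (rule mixed_derivatives_eq_rectangle[where f = "\<lambda>x y. F (x, y, t)" and fx = "\<lambda>x y. F' (x, y, t) ?e1"
          and fy = "\<lambda>x y. F' (x, y, t) ?e2" and A = "\<lambda>x y. F'' (x, y, t) ?e2 ?e1" and B = "\<lambda>x y. F'' (x, y, t) ?e1 ?e2"
          and a = "x - \<delta>/2" and b = "x + \<delta>/2" and c = "y - \<delta>/2" and d = "y + \<delta>/2"])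
      show "continuous_on ({x - \<delta>/2..x + \<delta>/2} \<times> {y - \<delta>/2..y + \<delta>/2}) (\<lambda>(x, y). F'' (x, y, t) ?e1 ?e2)"
        "continuous_on ({x - \<delta>/2..x + \<delta>/2} \<times> {y - \<delta>/2..y + \<delta>/2}) (\<lambda>(x, y). F' (x, y, t) ?e2)"
        by (intro c C2_continuous_on)+
    qed (use \<delta> in \<open>auto intro!: d1 d2 C2_has_derivative D\<close>)
    then show ?thesis by (simp add: xyt)
  qed
  have cl: "closure (interior (Dom t0 T)) = Dom t0 T"
    using convex_closure_interior[OF convex_Dom interior_Dom[OF t0T]] closed_Dom by simp
  have "F'' p ?e1 ?e2 - F'' p ?e2 ?e1 = 0"
  proof (rule continuous_constant_on_closure[where S = "interior (Dom t0 T)" and x = p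
      and f = "\<lambda>q. F'' q ?e1 ?e2 - F'' q ?e2 ?e1"])
    show "continuous_on (closure (interior (Dom t0 T))) (\<lambda>q. F'' q ?e1 ?e2 - F'' q ?e2 ?e1)"
      unfolding cl by (intro continuous_intros C2_continuous_on)
  qed (use inner p cl in auto)
  then show ?thesis by simp
qed

end

section \<open>Kernels as functions of x = (\<xi> + \<eta>) / 2 and y = (\<xi> - \<eta>) / 2\<close>

lemma kernel_coordinates_Dom:
  assumes "t \<in> {t0..T}" "0 \<le> y" "y \<le> x" "x \<le> 1"
  shows "(x + y, x - y, t) \<in> Dom t0 T"
  using assms by (auto simp: Dom_iff)

text \<open>The directions are the velocities of the coordinate lines: moving x raises both \<xi>
  and \<eta>, moving y raises \<xi> and lowers \<eta>, and along the diagonal \<xi> grows at rate 2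
  while \<eta> stays 0.\<close>

lemma has_real_derivative_rescaled_kernel:
  assumes G: "\<And>q. q \<in> Dom t0 T \<Longrightarrow> (G has_derivative G' q) (at q within Dom t0 T)"
    and t: "t \<in> {t1..T}" and t1: "t0 \<le> t1" and xy: "0 \<le> y" "y \<le> x" "x \<le> 1"
  shows "((\<lambda>x. G (x + y, x - y, t)) has_real_derivative G' (x + y, x - y, t) (1, 1, 0)) (at x within {y..1})"
    and "((\<lambda>y. G (x + y, x - y, t)) has_real_derivative G' (x + y, x - y, t) (1, -1, 0)) (at y within {0..x})"
    and "((\<lambda>t. G (x + y, x - y, t)) has_real_derivative G' (x + y, x - y, t) (0, 0, 1)) (at t within {t1..T})"
    and "((\<lambda>x. G (x + x, x - x, t)) has_real_derivative G' (x + x, x - x, t) (2, 0, 0)) (at x within {0..1})"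
proof -
  note D = kernel_coordinates_Dom[of _ t0 T]
  show "((\<lambda>x. G (x + y, x - y, t)) has_real_derivative G' (x + y, x - y, t) (1, 1, 0)) (at x within {y..1})"
    by (rule has_real_derivative_along[where \<gamma> = "\<lambda>x. (x + y, x - y, t)" and s = x, OF G])
      (use t t1 xy D in \<open>auto intro!: derivative_eq_intros simp: has_vector_derivative_def zero_prod_def\<close>)
  show "((\<lambda>y. G (x + y, x - y, t)) has_real_derivative G' (x + y, x - y, t) (1, -1, 0)) (at y within {0..x})"
    by (rule has_real_derivative_along[where \<gamma> = "\<lambda>y. (x + y, x - y, t)" and s = y, OF G])
      (use t t1 xy D in \<open>auto intro!: derivative_eq_intros simp: has_vector_derivative_def zero_prod_def\<close>)
  show "((\<lambda>t. G (x + y, x - y, t)) has_real_derivative G' (x + y, x - y, t) (0, 0, 1)) (at t within {t1..T})"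
    by (rule has_real_derivative_along[where \<gamma> = "\<lambda>t. (x + y, x - y, t)" and s = t, OF G])
      (use t t1 xy D in \<open>auto intro!: derivative_eq_intros simp: has_vector_derivative_def zero_prod_def\<close>)
  show "((\<lambda>x. G (x + x, x - x, t)) has_real_derivative G' (x + x, x - x, t) (2, 0, 0)) (at x within {0..1})"
    by (rule has_real_derivative_along[where \<gamma> = "\<lambda>x. (x + x, x - x, t)" and s = x, OF G])
      (use t t1 xy in \<open>auto intro!: derivative_eq_intros simp: has_vector_derivative_def zero_prod_def Dom_iff\<close>)
qed

lemma continuous_on_rescaled_kernel:
  assumes G: "continuous_on (Dom t0 T) G" and t1: "t0 \<le> t1"
  shows "continuous_on (Volterra_dom t1 T) (\<lambda>(t, x, y). G (x + y, x - y, t))"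
  unfolding split_beta
  by (rule continuous_on_compose2[OF G])
    (use t1 in \<open>auto intro!: continuous_intros simp: Volterra_dom_def Dom_iff\<close>)

lemma C2_with_diff:
  assumes "C2_with F F' F'' S" "C2_with G G' G'' S"
  shows "C2_with (\<lambda>p. F p - G p) (\<lambda>p. F' p - G' p) (\<lambda>p. F'' p - G'' p) S"
  unfolding C2_with_def
proof (intro conjI ballI)
  fix p assume p: "p \<in> S"
  have 1: "(F has_derivative blinfun_apply (F' p)) (at p within S)" "(G has_derivative blinfun_apply (G' p)) (at p within S)"
    "(F' has_derivative blinfun_apply (F'' p)) (at p within S)" "(G' has_derivative blinfun_apply (G'' p)) (at p within S)"
    using assms p by (auto simp: C2_with_def)
  show "((\<lambda>p. F p - G p) has_derivative blinfun_apply (F' p - G' p)) (at p within S)"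
    by (rule has_derivative_eq_rhs[OF has_derivative_diff[OF 1(1,2)]]) (simp add: fun_eq_iff blinfun.diff_left)
  show "((\<lambda>p. F' p - G' p) has_derivative blinfun_apply (F'' p - G'' p)) (at p within S)"
    by (rule has_derivative_eq_rhs[OF has_derivative_diff[OF 1(3,4)]]) (simp add: fun_eq_iff blinfun.diff_left)
qed (use assms in \<open>auto simp: C2_with_def intro!: continuous_intros\<close>)

lemma fbd_derivative:
  assumes "\<alpha> \<noteq> 0"
  shows "((\<lambda>\<xi>. fbd \<alpha> lam0 c l \<xi> t) has_real_derivative
    l t / (4 * \<alpha>) * ((2 * (deriv l t)\<^sup>2 + \<xi> * l t * deriv (deriv l) t) / (8 * \<alpha>) - (lam0 + c))
    + \<xi> * l t / (4 * \<alpha>) * (l t * deriv (deriv l) t / (8 * \<alpha>))) (at \<xi> within A)"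
  unfolding fbd_def using assms
  by (auto intro!: derivative_eq_intros simp: field_simps power2_eq_square)

section \<open>Defects of the approximate kernel\<close>

context
  fixes t0 T \<alpha> lam0 c \<epsilon> :: real and l :: "real \<Rightarrow> real" and K F F' F''
  assumes t0T: "t0 < T" and \<alpha>: "0 < \<alpha>" and lpos: "\<And>t. t \<in> {t0..T} \<Longrightarrow> 0 < l t"
    and K: "kernel_solution \<alpha> lam0 c l t0 T K"
    and F: "C2_with F F' F'' (Dom t0 T)"
    and close: "\<And>\<xi> \<eta> t. (\<xi>, \<eta>, t) \<in> Dom t0 T \<Longrightarrow>
          \<bar>K (\<xi>, \<eta>, t) - F (\<xi>, \<eta>, t)\<bar>
          + \<bar>4 * \<alpha> / l t * pd (Dom t0 T) (1, 0, 0) (\<lambda>p. K p - F p) (\<xi>, 0, t)\<bar>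
          + \<bar>kernel_residual \<alpha> lam0 c l t0 T (\<lambda>p. K p - F p) \<xi> \<eta> t\<bar> < \<epsilon>"
begin

lemma kernel_closeness:
  assumes "(\<xi>, \<eta>, t) \<in> Dom t0 T"
  shows "\<bar>K (\<xi>, \<eta>, t) - F (\<xi>, \<eta>, t)\<bar> \<le> \<epsilon>"
    and "\<bar>4 * \<alpha> / l t * pd (Dom t0 T) (1, 0, 0) (\<lambda>p. K p - F p) (\<xi>, 0, t)\<bar> \<le> \<epsilon>"
    and "\<bar>kernel_residual \<alpha> lam0 c l t0 T (\<lambda>p. K p - F p) \<xi> \<eta> t\<bar> \<le> \<epsilon>"
proof -
  have "\<bar>r\<bar> \<le> \<epsilon> \<and> \<bar>s\<bar> \<le> \<epsilon> \<and> \<bar>w\<bar> \<le> \<epsilon>" if "\<bar>r\<bar> + \<bar>s\<bar> + \<bar>w\<bar> < \<epsilon>" for r s w :: real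
    using that abs_ge_zero[of r] abs_ge_zero[of s] abs_ge_zero[of w] by linarith
  from this[OF close[OF assms]]
  show "\<bar>K (\<xi>, \<eta>, t) - F (\<xi>, \<eta>, t)\<bar> \<le> \<epsilon>"
    "\<bar>4 * \<alpha> / l t * pd (Dom t0 T) (1, 0, 0) (\<lambda>p. K p - F p) (\<xi>, 0, t)\<bar> \<le> \<epsilon>"
    "\<bar>kernel_residual \<alpha> lam0 c l t0 T (\<lambda>p. K p - F p) \<xi> \<eta> t\<bar> \<le> \<epsilon>"
    by blast+
qed

text \<open>K satisfies the kernel equation and both boundary conditions exactly, so up to sign each
  defect of F is one of the quantities that closeness bounds for K - F.\<close>

lemma kernel_defects:
  assumes t: "t \<in> {t0..T}" and xy: "0 \<le> y" "y \<le> x" "x \<le> 1"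
  shows "\<bar>F' (x + y, x - y, t) (0, 0, 1)
      - \<alpha> / (l t)\<^sup>2 * (F'' (x + y, x - y, t) (1, 1, 0) (1, 1, 0) - F'' (x + y, x - y, t) (1, -1, 0) (1, -1, 0))
      - deriv l t / l t * (x * F' (x + y, x - y, t) (1, 1, 0) + y * F' (x + y, x - y, t) (1, -1, 0))
      + (lam \<alpha> lam0 l (l t * y) t + c) * F (x + y, x - y, t)\<bar> \<le> \<epsilon>"
    and "\<bar>lam \<alpha> lam0 l (l t * x) t + c
      + 2 * (\<alpha> / (l t)\<^sup>2) * l t * (F' (x + x, x - x, t) (1, 1, 0) + F' (x + x, x - x, t) (1, -1, 0))\<bar> \<le> \<epsilon>"
    and "\<bar>F (x + y, x - y, t) - K (x + y, x - y, t)\<bar> \<le> \<epsilon>"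
    and "\<bar>F (x + 0, x - 0, t)\<bar> \<le> \<epsilon>"
proof -
  let ?e1 = "(1, 0, 0) :: real \<times> real \<times> real" and ?e2 = "(0, 1, 0) :: real \<times> real \<times> real"
  obtain K' K'' where K2: "C2_with K K' K'' (Dom t0 T)"
    using K unfolding kernel_solution_def C2_on_def C2_with_def by blast
  note D2 = C2_with_diff[OF K2 F]
  have q: "(x + y, x - y, t) \<in> Dom t0 T" using kernel_coordinates_Dom[OF t xy] .
  define q where "q = (x + y, x - y, t)"
  have qD: "q \<in> Dom t0 T" using q by (simp add: q_def)
  have split: "(1, 1, 0) = ?e1 + ?e2" "(1, -1, 0) = ?e1 - ?e2" by simp_all
  have lb: "lambar \<alpha> lam0 c l (x + y) (x - y) t = lam \<alpha> lam0 l (l t * y) t + c"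
    using \<alpha> by (simp add: lambar_def lam_def field_simps)
  have "K' q (0, 0, 1) = 4 * \<alpha> / (l t)\<^sup>2 * K'' q ?e1 ?e2
      + deriv l t / l t * ((x + y) * K' q ?e1 + (x - y) * K' q ?e2)
      - (lam \<alpha> lam0 l (l t * y) t + c) * K q"
    unfolding C2_pd[OF K2 t0T qD, symmetric] lb[symmetric]
    using K q unfolding kernel_solution_def q_def by blast
  moreover have "kernel_residual \<alpha> lam0 c l t0 T (\<lambda>p. K p - F p) (x + y) (x - y) t
    = (K' q (0, 0, 1) - F' q (0, 0, 1)) - 4 * \<alpha> / (l t)\<^sup>2 * (K'' q ?e1 ?e2 - F'' q ?e1 ?e2)
      - deriv l t / l t * ((x + y) * (K' q ?e1 - F' q ?e1) + (x - y) * (K' q ?e2 - F' q ?e2))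
      + (lam \<alpha> lam0 l (l t * y) t + c) * (K q - F q)"
    unfolding kernel_residual_def lb q_def[symmetric] C2_pd[OF D2 t0T qD]
    by (simp add: blinfun.diff_left)
  ultimately have "F' q (0, 0, 1)
      - \<alpha> / (l t)\<^sup>2 * (4 * F'' q ?e1 ?e2)
      - deriv l t / l t * ((x + y) * F' q ?e1 + (x - y) * F' q ?e2)
      + (lam \<alpha> lam0 l (l t * y) t + c) * F q
    = - kernel_residual \<alpha> lam0 c l t0 T (\<lambda>p. K p - F p) (x + y) (x - y) t"
    by (simp add: algebra_simps)
  \<comment> \<open>The square of \<partial>\<xi> + \<partial>\<eta> minus that of \<partial>\<xi> -
    \<partial>\<eta> is four times the mixed derivative, once the two orders of differentiation
    agree.\<close>
  moreover have "F'' q (1, 1, 0) (1, 1, 0) - F'' q (1, -1, 0) (1, -1, 0) = 4 * F'' q ?e1 ?e2"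
    unfolding split blinfun.add_left blinfun.add_right blinfun.diff_left blinfun.diff_right
    using C2_symmetric[OF F t0T qD] by simp
  moreover have "x * F' q (1, 1, 0) + y * F' q (1, -1, 0) = (x + y) * F' q ?e1 + (x - y) * F' q ?e2"
    unfolding split blinfun.add_right blinfun.diff_right by (simp add: algebra_simps)
  ultimately show "\<bar>F' (x + y, x - y, t) (0, 0, 1)
      - \<alpha> / (l t)\<^sup>2 * (F'' (x + y, x - y, t) (1, 1, 0) (1, 1, 0) - F'' (x + y, x - y, t) (1, -1, 0) (1, -1, 0))
      - deriv l t / l t * (x * F' (x + y, x - y, t) (1, 1, 0) + y * F' (x + y, x - y, t) (1, -1, 0))
      + (lam \<alpha> lam0 l (l t * y) t + c) * F (x + y, x - y, t)\<bar> \<le> \<epsilon>"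
    using kernel_closeness(3)[OF q] unfolding q_def[symmetric] by (simp only: abs_minus_cancel)
  show "\<bar>F (x + y, x - y, t) - K (x + y, x - y, t)\<bar> \<le> \<epsilon>"
    using kernel_closeness(1)[OF q] by (simp only: abs_minus_commute)
  have "(x + 0, x - 0, t) \<in> Dom t0 T" using kernel_coordinates_Dom[OF t, of 0 x] xy by simp
  from kernel_closeness(1)[OF this] have "\<bar>K (x, x, t) - F (x, x, t)\<bar> \<le> \<epsilon>" by simp
  moreover have "K (x, x, t) = 0" using K xy t unfolding kernel_solution_def by auto
  ultimately show "\<bar>F (x + 0, x - 0, t)\<bar> \<le> \<epsilon>" by simp
  \<comment> \<open>The diagonal point y = x lies at \<xi> = 2 x on the edge \<eta> = 0. There the
    prescribed values \<open>fbd\<close> determine the \<xi>-derivative of K.\<close>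
  define r where "r = (2 * x, 0 :: real, t)"
  have rD: "r \<in> Dom t0 T" using xy t by (simp add: Dom_iff r_def)
  have "((\<lambda>\<xi>. K (\<xi>, 0, t)) has_real_derivative K' r ?e1) (at (2 * x) within {0..2})"
    unfolding r_def
    by (rule has_real_derivative_along[where \<gamma> = "\<lambda>\<xi>. (\<xi>, 0, t)" and s = "2 * x", OF C2_has_derivative(1)[OF K2 t0T]])
      (use t xy in \<open>auto intro!: derivative_eq_intros simp: has_vector_derivative_def zero_prod_def Dom_iff\<close>)
  moreover have "((\<lambda>\<xi>. K (\<xi>, 0, t)) has_real_derivative
    l t / (4 * \<alpha>) * ((2 * (deriv l t)\<^sup>2 + (2 * x) * l t * deriv (deriv l) t) / (8 * \<alpha>) - (lam0 + c))
    + (2 * x) * l t / (4 * \<alpha>) * (l t * deriv (deriv l) t / (8 * \<alpha>))) (at (2 * x) within {0..2})"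
    by (rule has_real_derivative_transform[OF _ _ fbd_derivative])
      (use \<alpha> K t xy in \<open>auto simp: kernel_solution_def\<close>)
  ultimately have "K' r ?e1 = l t / (4 * \<alpha>) * ((2 * (deriv l t)\<^sup>2 + (2 * x) * l t * deriv (deriv l) t) / (8 * \<alpha>) - (lam0 + c))
    + (2 * x) * l t / (4 * \<alpha>) * (l t * deriv (deriv l) t / (8 * \<alpha>))"
    by (intro has_real_derivative_unique[of 0 2 "2 * x"]) (use xy in auto)
  \<comment> \<open>The boundary values of K are those for which this derivative cancels the
    reaction coefficient on the diagonal.\<close>
  then have K'r: "4 * \<alpha> / l t * K' r ?e1 = - (lam \<alpha> lam0 l (l t * x) t + c)"
    using lpos[OF t] \<alpha> by (simp add: lam_def field_simps power2_eq_square)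
  have two: "(1, 1, 0) + (1, -1, 0) = 2 *\<^sub>R ?e1" by simp
  have "F' r (1, 1, 0) + F' r (1, -1, 0) = 2 * F' r ?e1"
    unfolding blinfun.add_right[symmetric] two blinfun.scaleR_right by simp
  then have "2 * (\<alpha> / (l t)\<^sup>2) * l t * (F' r (1, 1, 0) + F' r (1, -1, 0)) = 4 * \<alpha> / l t * F' r ?e1"
    using lpos[OF t] by (simp add: power2_eq_square)
  moreover have "pd (Dom t0 T) ?e1 (\<lambda>p. K p - F p) r = K' r ?e1 - F' r ?e1"
    unfolding C2_pd[OF D2 t0T rD] by (simp add: blinfun.diff_left)
  then have "lam \<alpha> lam0 l (l t * x) t + c + 4 * \<alpha> / l t * F' r ?e1
    = - (4 * \<alpha> / l t * pd (Dom t0 T) ?e1 (\<lambda>p. K p - F p) r)"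
    using K'r by (simp add: right_diff_distrib)
  ultimately have "\<bar>lam \<alpha> lam0 l (l t * x) t + c + 2 * (\<alpha> / (l t)\<^sup>2) * l t * (F' r (1, 1, 0) + F' r (1, -1, 0))\<bar>
     = \<bar>4 * \<alpha> / l t * pd (Dom t0 T) ?e1 (\<lambda>p. K p - F p) (2 * x, 0, t)\<bar>"
    by (simp add: r_def)
  also have "\<dots> \<le> \<epsilon>"
    by (rule kernel_closeness(2)[OF rD[unfolded r_def]])
  finally show "\<bar>lam \<alpha> lam0 l (l t * x) t + c
      + 2 * (\<alpha> / (l t)\<^sup>2) * l t * (F' (x + x, x - x, t) (1, 1, 0) + F' (x + x, x - x, t) (1, -1, 0))\<bar> \<le> \<epsilon>"
    by (simp add: r_def)
qed

end

text \<open>A supremum of reals is an upper bound only for a set bounded above; continuity on the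
  compact \<open>Dom\<close> provides that. The second supremum is nonnegative and can then be
  dropped.\<close>

lemma kernel_sup_bound:
  assumes t0T: "t0 < T" and K: "C2_with K K' K'' (Dom t0 T)"
    and M: "(SUP (\<xi>, \<eta>)\<in>Sbar. \<bar>K (\<xi>, \<eta>, t)\<bar>)
           + (SUP (\<xi>, \<eta>)\<in>Sbar. \<bar>pd (Dom t0 T) (0, 0, 1) K (\<xi>, \<eta>, t)\<bar>) \<le> M"
    and q: "(\<xi>, \<eta>, t) \<in> Dom t0 T"
  shows "\<bar>K (\<xi>, \<eta>, t)\<bar> \<le> M"
proof -
  have bdd: "bdd_above ((\<lambda>(\<xi>, \<eta>). \<bar>G (\<xi>, \<eta>, t)\<bar>) ` Sbar)" if "continuous_on (Dom t0 T) G"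
    for G :: "real \<times> real \<times> real \<Rightarrow> real"
  proof -
    have "bounded (G ` Dom t0 T)"
      by (intro compact_imp_bounded compact_continuous_image that compact_Dom)
    then obtain B where "\<And>p. p \<in> Dom t0 T \<Longrightarrow> \<bar>G p\<bar> \<le> B" by (auto simp: bounded_iff)
    then show ?thesis using q by (intro bdd_aboveI2[where M = B]) (auto simp: Dom_def)
  qed
  have S: "(\<xi>, \<eta>) \<in> Sbar" using q by (simp add: Dom_def)
  have "continuous_on (Dom t0 T) (pd (Dom t0 T) (0, 0, 1) K)"
    by (rule continuous_on_eq[OF C2_continuous_on(2)[OF K t0T]]) (simp add: C2_pd(1)[OF K t0T])
  from cSUP_upper[OF S bdd[OF this]]
  have "0 \<le> (SUP (\<xi>, \<eta>)\<in>Sbar. \<bar>pd (Dom t0 T) (0, 0, 1) K (\<xi>, \<eta>, t)\<bar>)"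
    by (auto intro: order_trans[OF abs_ge_zero])
  moreover have "\<bar>K (\<xi>, \<eta>, t)\<bar> \<le> (SUP (\<xi>, \<eta>)\<in>Sbar. \<bar>K (\<xi>, \<eta>, t)\<bar>)"
    using cSUP_upper[OF S bdd[OF C2_continuous_on(1)[OF K t0T]]] by simp
  ultimately show ?thesis using M by linarith
qed

section \<open>Closed-loop solutions in rescaled coordinates\<close>

lemma real_analytic_power_series_deriv:
  fixes f :: "real \<Rightarrow> real"
  assumes s: "\<And>y. \<bar>y - x\<bar> < r \<Longrightarrow> (\<lambda>n. a n * (y - x) ^ n) sums f y" and y: "\<bar>y - x\<bar> < r"
  shows "(f has_real_derivative deriv f y) (at y)"
    and "(\<lambda>n. diffs a n * (y - x) ^ n) sums deriv f y"
proof -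
  have sm: "summable (\<lambda>n. a n * z ^ n)" if "norm z < r" for z :: real
    using s[of "x + z"] that by (auto simp: sums_iff)
  have yx: "norm (y - x) < r" using y by simp
  have "((\<lambda>z. \<Sum>n. a n * z ^ n) has_real_derivative (\<Sum>n. diffs a n * (y - x) ^ n)) (at (y - x))"
    by (rule termdiffs_strong'[OF sm yx])
  then have "((\<lambda>y. \<Sum>n. a n * (y - x) ^ n) has_real_derivative (\<Sum>n. diffs a n * (y - x) ^ n)) (at y)"
    using DERIV_shift[of "\<lambda>z. \<Sum>n. a n * z ^ n" _ y "- x"] by simp
  then have D: "(f has_real_derivative (\<Sum>n. diffs a n * (y - x) ^ n)) (at y)"
    by (rule has_field_derivative_transform_within_open[where S = "ball x r"])
      (use y s in \<open>auto simp: sums_iff dist_real_def abs_minus_commute\<close>)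
  then have "deriv f y = (\<Sum>n. diffs a n * (y - x) ^ n)" by (rule DERIV_imp_deriv)
  moreover from this show "(f has_real_derivative deriv f y) (at y)" using D by simp
  moreover have "summable (\<lambda>n. diffs a n * (y - x) ^ n)"
    by (rule termdiff_converges[OF yx sm])
  ultimately show "(\<lambda>n. diffs a n * (y - x) ^ n) sums deriv f y" by (simp add: sums_iff)
qed

text \<open>The series lemma holds at every point of the disc of convergence and represents the
  derivative again by a series on that disc, so it can be applied to f, f' and f'' in turn.\<close>

lemma real_analytic_on_derivatives:
  assumes "real_analytic_on f S" "x \<in> S"
  shows "(f has_real_derivative deriv f x) (at x)"
    and "(deriv f has_real_derivative deriv (deriv f) x) (at x)"
    and "isCont (deriv (deriv f)) x"
proof -
  obtain r a where r: "r > 0" and s: "\<And>y. \<bar>y - x\<bar> < r \<Longrightarrow> (\<lambda>n. a n * (y - x) ^ n) sums f y"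
    using assms unfolding real_analytic_on_def by blast
  have x: "\<bar>x - x\<bar> < r" using r by simp
  have s1: "(\<lambda>n. diffs a n * (y - x) ^ n) sums deriv f y" if "\<bar>y - x\<bar> < r" for y
    by (rule real_analytic_power_series_deriv(2)[OF s that])
  have s2: "(\<lambda>n. diffs (diffs a) n * (y - x) ^ n) sums deriv (deriv f) y" if "\<bar>y - x\<bar> < r" for y
    by (rule real_analytic_power_series_deriv(2)[OF s1 that])
  show "(f has_real_derivative deriv f x) (at x)"
    by (rule real_analytic_power_series_deriv(1)[OF s x])
  show "(deriv f has_real_derivative deriv (deriv f) x) (at x)"
    by (rule real_analytic_power_series_deriv(1)[OF s1 x])
  show "isCont (deriv (deriv f)) x"
    by (rule DERIV_isCont[OF real_analytic_power_series_deriv(1)[OF s2 x]])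
qed

section \<open>From the moving interval to the unit interval\<close>

lemma continuous_eq_on_unit_interval:
  fixes f g :: "real \<Rightarrow> real"
  assumes "continuous_on {0..1} f" "continuous_on {0..1} g"
    and "\<And>x. x \<in> {0<..<1} \<Longrightarrow> f x = g x" and "x \<in> {0..1}"
  shows "f x = g x"
proof -
  have "f x - g x = 0"
    by (rule continuous_constant_on_closure[where S = "{0<..<1}" and f = "\<lambda>x. f x - g x"])
      (use assms in \<open>auto intro!: continuous_intros\<close>)
  then show ?thesis by simp
qed

text \<open>For interior x, u is its value at a plus the time integral of \<open>ut\<close>. Both
  sides are continuous in x, so the representation extends to x = 0 and x = 1, where it can be
  differentiated again.\<close>

lemma has_real_derivative_time_closed_interval:
  fixes u ut :: "real \<Rightarrow> real \<Rightarrow> real"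
  assumes cu: "continuous_on ({a..b} \<times> {0..1}) (\<lambda>(t, x). u t x)"
    and cut: "continuous_on ({a..b} \<times> {0..1}) (\<lambda>(t, x). ut t x)"
    and d: "\<And>t x. t \<in> {a..b} \<Longrightarrow> x \<in> {0<..<1} \<Longrightarrow> ((\<lambda>s. u s x) has_real_derivative ut t x) (at t within {a..b})"
    and t: "t \<in> {a..b}" and x: "x \<in> {0..1}"
  shows "((\<lambda>s. u s x) has_real_derivative ut t x) (at t within {a..b})"
proof -
  have a: "a \<in> {a..b}" using t by auto
  have eq: "u s x = u a x + integral {a..s} (\<lambda>r. ut r x)" if s: "s \<in> {a..b}" for s
  proof (rule continuous_eq_on_unit_interval[OF _ _ _ x])
    show "continuous_on {0..1} (u s)" by (rule continuous_on_slice[OF cu s])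
    have "continuous_on ({0..1} \<times> cbox a s) (\<lambda>q. (\<lambda>(t, x). ut t x) (snd q, fst q))"
      by (rule continuous_on_compose2[OF cut]) (use s in \<open>auto intro!: continuous_intros\<close>)
    then have "continuous_on ({0..1} \<times> cbox a s) (\<lambda>(x, r). ut r x)" by (simp add: split_beta)
    from integral_continuous_on_param[OF this]
    show "continuous_on {0..1} (\<lambda>x. u a x + integral {a..s} (\<lambda>r. ut r x))"
      by (auto intro!: continuous_intros continuous_on_slice[OF cu a])
    fix x :: real assume x: "x \<in> {0<..<1}"
    have "((\<lambda>r. ut r x) has_integral u s x - u a x) {a..s}"
      using s x by (intro has_integral_real_derivative[of a s "\<lambda>r. u r x"] DERIV_subset[OF d]) auto
    then show "u s x = u a x + integral {a..s} (\<lambda>r. ut r x)" by (simp add: integral_unique)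
  qed
  have "((\<lambda>s. u a x + integral {a..s} (\<lambda>r. ut r x)) has_real_derivative 0 + ut t x) (at t within {a..b})"
    by (intro DERIV_add DERIV_const integral_has_real_derivative continuous_on_slice2[OF cut] t x)
  then show ?thesis
    by (intro has_real_derivative_transform[OF t eq]) simp_all
qed

text \<open>Chain rule along the curve s -> (s, l s * x). It needs the time derivative only at the
  single point of the curve, but continuity of \<open>vx\<close> on a product neighbourhood, whereas
  the domain of v is not a product.\<close>

lemma has_real_derivative_moving_point:
  fixes v vx vt :: "real \<Rightarrow> real \<Rightarrow> real" and l :: "real \<Rightarrow> real"
  assumes cvx: "continuous_on {(x, t). t0 < t \<and> t \<le> T \<and> 0 \<le> x \<and> x \<le> l t} (\<lambda>(x, t). vx x t)"
    and dx: "\<And>t x. t \<in> {t0<..T} \<Longrightarrow> x \<in> {0..l t} \<Longrightarrow> ((\<lambda>z. v z t) has_real_derivative vx x t) (at x within {0..l t})"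
    and dt: "((\<lambda>s. v (l t * x) s) has_real_derivative vt (l t * x) t) (at t within {t0<..T})"
    and dl: "(l has_real_derivative dl) (at t)" and lpos: "\<And>t. t \<in> {t0<..T} \<Longrightarrow> 0 < l t"
    and x: "x \<in> {0<..<1}" and t: "t \<in> {t1..T}" and t1: "t0 < t1"
  shows "((\<lambda>s. v (l s * x) s) has_real_derivative vt (l t * x) t + vx (l t * x) t * (dl * x)) (at t within {t1..T})"
proof -
  \<comment> \<open>The midpoint separates the curve from the boundary: for s near t it stays above
    \<open>l s * x\<close> and below \<open>l s\<close>, so the box \<open>A \<times> {0..m}\<close>
    lies in the domain and contains the curve.\<close>
  define m where "m = (l t * x + l t) / 2"
  have lt: "0 < l t" using lpos[of t] t t1 by auto
  have m: "l t * x < m" "m < l t" using lt x by (auto simp: m_def)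
  have "isCont l t" using dl by (rule DERIV_isCont)
  then have "(l \<longlongrightarrow> l t) (nhds t)" "((\<lambda>s. l s * x) \<longlongrightarrow> l t * x) (nhds t)"
    by (auto simp: isCont_def tendsto_at_iff_tendsto_nhds intro!: tendsto_intros)
  then have "\<forall>\<^sub>F s in nhds t. m < l s \<and> l s * x < m"
    using m by (intro eventually_conj order_tendstoD) auto
  then obtain d where d: "0 < d" "\<And>s. dist s t < d \<Longrightarrow> m < l s \<and> l s * x < m"
    by (auto simp: eventually_nhds_metric)
  define A where "A = {t1..T} \<inter> ball t d"
  have A: "A \<subseteq> {t0<..T}" "t \<in> A" "\<And>s. s \<in> A \<Longrightarrow> m < l s \<and> l s * x < m"
    using t t1 d by (auto simp: A_def dist_commute)
  have Q: "(y, s) \<in> {(x, t). t0 < t \<and> t \<le> T \<and> 0 \<le> x \<and> x \<le> l t}" if "s \<in> A" "y \<in> {0..m}" for s y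
    using A(1) A(3)[OF that(1)] that by auto
  have "((\<lambda>(s, y). v y s) has_derivative (\<lambda>(ts, ty). vt (l t * x) t * ts + blinfun_mult_right (vx (l t * x) t) ty))
     (at (t, l t * x) within A \<times> {0..m})"
  proof (rule has_derivative_partialsI[where fy = "\<lambda>s y. blinfun_mult_right (vx y s)"])
    show "((\<lambda>s. v (l t * x) s) has_derivative (*) (vt (l t * x) t)) (at t within A)"
      using DERIV_subset[OF dt A(1)] by (simp add: has_field_derivative_def)
    show "((\<lambda>y. v y s) has_derivative blinfun_mult_right (vx y s)) (at y within {0..m})"
      if s: "s \<in> A" "y \<in> {0..m}" for s y
      unfolding has_field_derivative_eq_has_derivative_blinfun[symmetric]
      by (rule DERIV_subset[OF dx]) (use A(1) A(3)[OF s(1)] s in auto)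
    have "continuous_on (A \<times> {0..m}) (\<lambda>q. (\<lambda>(x, t). vx x t) (snd q, fst q))"
      by (rule continuous_on_compose2[OF cvx]) (use Q in \<open>auto intro!: continuous_intros\<close>)
    then have "continuous_on (A \<times> {0..m}) (\<lambda>q. vx (snd q) (fst q))" by simp
    then have "continuous_on (A \<times> {0..m}) (\<lambda>q. blinfun_mult_right (vx (snd q) (fst q)))"
      by (rule bounded_linear.continuous_on[OF bounded_linear_blinfun_mult_right])
    moreover have "(t, l t * x) \<in> A \<times> {0..m}" using A(2) less_imp_le[OF m(1)] x lt by auto
    ultimately show "continuous (at (t, l t * x) within A \<times> {0..m}) (\<lambda>(s, y). blinfun_mult_right (vx y s))"
      unfolding continuous_on_eq_continuous_within split_beta by blast
  qed (use m x lt in auto)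
  then have c1: "((\<lambda>(s, y). v y s) has_derivative (\<lambda>(ts, ty). vt (l t * x) t * ts + blinfun_mult_right (vx (l t * x) t) ty))
     (at (t, l t * x) within (\<lambda>s. (s, l s * x)) ` A)"
  proof (rule has_derivative_subset)
    have "0 \<le> l s * x" "l s * x \<le> m" if "s \<in> A" for s
      using A(1) A(3)[OF that] that x lpos[of s] by auto
    then show "(\<lambda>s. (s, l s * x)) ` A \<subseteq> A \<times> {0..m}" by auto
  qed
  have c2: "((\<lambda>s. (s, l s * x)) has_derivative (\<lambda>h. (h, dl * h * x))) (at t within A)"
  proof -
    have "(l has_derivative (*) dl) (at t within A)"
      using dl unfolding has_field_derivative_def by (rule has_derivative_at_withinI)
    then show ?thesis by (intro has_derivative_Pair has_derivative_ident has_derivative_mult_left)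
  qed
  have "((\<lambda>s. (\<lambda>(s, y). v y s) (s, l s * x)) has_derivative
     (\<lambda>h. (\<lambda>(ts, ty). vt (l t * x) t * ts + blinfun_mult_right (vx (l t * x) t) ty) (h, dl * h * x))) (at t within A)"
    by (rule has_derivative_in_compose[OF c2 c1])
  moreover have "(\<lambda>h. (\<lambda>(ts, ty). vt (l t * x) t * ts + blinfun_mult_right (vx (l t * x) t) ty) (h, dl * h * x))
     = (*) (vt (l t * x) t + vx (l t * x) t * (dl * x))"
    by (simp add: fun_eq_iff algebra_simps)
  ultimately have "((\<lambda>s. v (l s * x) s) has_real_derivative vt (l t * x) t + vx (l t * x) t * (dl * x)) (at t within A)"
    by (simp add: has_field_derivative_def)
  moreover have "at t within A = at t within {t1..T}"
    by (rule at_within_nhd[where S = "ball t d"]) (use d in \<open>auto simp: A_def\<close>)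
  ultimately show ?thesis by simp
qed

lemma L2norm_rescale:
  assumes g: "continuous_on {0..b} g" and b: "0 < b"
  shows "L2norm b g = sqrt b * nrm2 (\<lambda>x. g (b * x))"
proof -
  have g2: "continuous_on {0..b} (\<lambda>x. (g x)\<^sup>2)" using g by (intro continuous_intros)
  have "set_integrable lborel {0<..<b} (\<lambda>x. (g x)\<^sup>2)"
    by (rule set_integrable_subset[OF borel_integrable_atLeastAtMost'[OF g2]]) auto
  then have "(LINT x:{0<..<b}|lborel. (g x)\<^sup>2) = integral {0<..<b} (\<lambda>x. (g x)\<^sup>2)"
    by (rule set_borel_integral_eq_integral)
  also have "\<dots> = integral {0..b} (\<lambda>x. (g x)\<^sup>2)"
    by (simp add: integral_open_interval_real)
  also have "\<dots> = b * integral {0..1} (\<lambda>x. (g (b * x))\<^sup>2)"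
    using integral_rescale[OF g2] b by simp
  finally show ?thesis by (simp add: L2norm_def nrm2_def real_sqrt_mult)
qed

section \<open>The feedback law in rescaled coordinates\<close>

lemma convex_Stri: "convex (Stri l t)"
proof (rule convexI)
  fix p q and r s :: real
  assume pq: "p \<in> Stri l t" "q \<in> Stri l t" and rs: "0 \<le> r" "0 \<le> s" "r + s = 1"
  obtain a b where p: "p = (a, b)" by (cases p)
  obtain a' b' where q: "q = (a', b')" by (cases q)
  have s: "s = 1 - r" using rs by simp
  have comb: "r * x + s * x' \<le> r * y + s * y'" if "x \<le> y" "x' \<le> y'" for x x' y y' :: real
    using that rs by (intro add_mono mult_left_mono) auto
  show "r *\<^sub>R p + s *\<^sub>R q \<in> Stri l t"
    using pq comb[of 0 b 0 b'] comb[of b a b' a'] comb[of a "l t" a' "l t"]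
    unfolding p q by (simp add: Stri_def s algebra_simps)
qed

lemma interior_Stri:
  assumes "0 < l t" shows "interior (Stri l t) \<noteq> {}"
proof -
  have "{l t / 2<..<l t} \<times> {0<..<l t / 2} \<subseteq> interior (Stri l t)"
    by (intro interior_maximal open_Times) (auto simp: Stri_def)
  moreover have "(3 * l t / 4, l t / 4) \<in> {l t / 2<..<l t} \<times> {0<..<l t / 2}"
    using assms by auto
  ultimately show ?thesis by blast
qed

text \<open>The kernel is F composed with an affine map that sends the direction (1, 0) to (1, 1, 0)
  / l. The points with x = l lie on the boundary of the triangle, hence the derivative within
  it.\<close>

lemma pd_orig_kernel:
  assumes F: "\<And>q. q \<in> Dom t0 T \<Longrightarrow> (F has_derivative blinfun_apply (F' q)) (at q within Dom t0 T)"
    and t: "t \<in> {t0..T}" and l: "0 < l t" and y: "y \<in> {0..l t}"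
  shows "pd (Stri l t) (1, 0) (\<lambda>(x, z). orig_kernel l F x z t) (l t, y)
    = F' (1 + y / l t, 1 - y / l t, t) (1, 1, 0) / l t"
proof -
  define J where "J = (\<lambda>(x, z). ((x + z) / l t, (x - z) / l t, t))"
  define J' where "J' = (\<lambda>(x, z). ((x + z) / l t, (x - z) / l t, 0 :: real))"
  have q: "J (l t, y) = (1 + y / l t, 1 - y / l t, t)"
    using l by (simp add: J_def add_divide_distrib diff_divide_distrib)
  have sub: "J ` Stri l t \<subseteq> Dom t0 T"
    using l t by (auto simp: J_def Stri_def Dom_iff field_simps)
  have S: "(l t, y) \<in> Stri l t" using y by (auto simp: Stri_def)
  have dJ: "(J has_derivative J') (at (l t, y) within Stri l t)"
    unfolding J_def J'_def split_beta using l by (auto intro!: derivative_eq_intros simp: fun_eq_iff)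
  have "((\<lambda>r. F (J r)) has_derivative (\<lambda>h. F' (J (l t, y)) (J' h))) (at (l t, y) within Stri l t)"
    by (rule has_derivative_in_compose[OF dJ has_derivative_subset[OF F sub]]) (use S sub in auto)
  moreover have "(\<lambda>r. F (J r)) = (\<lambda>(x, z). orig_kernel l F x z t)"
    by (simp add: fun_eq_iff orig_kernel_def J_def)
  ultimately have "((\<lambda>(x, z). orig_kernel l F x z t) has_derivative (\<lambda>h. F' (J (l t, y)) (J' h))) (at (l t, y) within Stri l t)"
    by simp
  from pd_eqI[OF convex_Stri interior_Stri[of l t, OF l] S this, of "(1, 0)"]
  have "pd (Stri l t) (1, 0) (\<lambda>(x, z). orig_kernel l F x z t) (l t, y)
    = F' (1 + y / l t, 1 - y / l t, t) ((1 / l t) *\<^sub>R (1, 1, 0))"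
    by (simp add: q J'_def)
  then show ?thesis by (simp only: blinfun.scaleR_right) simp
qed

text \<open>After the substitution y = l \<sigma> the Jacobian l cancels the factor 1 / l of the
  x-derivative of the kernel and stays in front of the undifferentiated kernel.\<close>

lemma feedback_rescale:
  assumes F: "C2_with F F' F'' (Dom t0 T)" and t0T: "t0 < T"
    and t: "t \<in> {t0..T}" and l: "0 < l t" and v: "continuous_on {0..l t} (\<lambda>x. v x t)"
  shows "feedback \<alpha> l (orig_kernel l F) v t =
     deriv l t / (2 * \<alpha>) * l t * integral {0..1} (\<lambda>y. F (1 + y, 1 - y, t) * v (l t * y) t)
     + integral {0..1} (\<lambda>y. F' (1 + y, 1 - y, t) (1, 1, 0) * v (l t * y) t) + F (2, 0, t) * v (l t) t"
proof -
  define G where "G = (\<lambda>y. (deriv l t / (2 * \<alpha>) * F (1 + y / l t, 1 - y / l t, t)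
    + F' (1 + y / l t, 1 - y / l t, t) (1, 1, 0) / l t) * v y t)"
  define \<kappa> where "\<kappa> = deriv l t / (2 * \<alpha>) * l t"
  have D: "(1 + y, 1 - y, t) \<in> Dom t0 T" if "y \<in> {0..1}" for y
    using that t by (simp add: Dom_iff)
  have c: "continuous_on {0..1} (\<lambda>y. H (1 + y, 1 - y, t))" if "continuous_on (Dom t0 T) H"
    for H :: "real \<times> real \<times> real \<Rightarrow> real"
    by (rule continuous_on_compose2[OF that]) (use D in \<open>auto intro!: continuous_intros\<close>)
  have c': "continuous_on {0..l t} (\<lambda>y. H (1 + y / l t, 1 - y / l t, t))" if "continuous_on (Dom t0 T) H"
    for H :: "real \<times> real \<times> real \<Rightarrow> real"
    by (rule continuous_on_compose2[OF c[OF that], of _ "\<lambda>y. y / l t"]) (use l in \<open>auto intro!: continuous_intros\<close>)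
  have cG: "continuous_on {0..l t} G"
    unfolding G_def using l by (intro continuous_intros c' C2_continuous_on[OF F t0T] v) auto
  have cv: "continuous_on {0..1} (\<lambda>y. v (l t * y) t)"
    by (rule continuous_on_compose2[OF v]) (use l mult_left_le[of _ "l t"] in \<open>auto intro!: continuous_intros\<close>)
  have "(LINT y:{0..l t}|lborel. (deriv l t / (2 * \<alpha>) * orig_kernel l F (l t) y t
         + pd (Stri l t) (1, 0) (\<lambda>(x, z). orig_kernel l F x z t) (l t, y)) * v y t)
    = (LINT y:{0..l t}|lborel. G y)"
  proof (rule set_lebesgue_integral_cong)
    show "\<forall>y. y \<in> {0..l t} \<longrightarrow> (deriv l t / (2 * \<alpha>) * orig_kernel l F (l t) y t
         + pd (Stri l t) (1, 0) (\<lambda>(x, z). orig_kernel l F x z t) (l t, y)) * v y t = G y"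
    proof (intro allI impI)
      fix y assume y: "y \<in> {0..l t}"
      have pdk: "pd (Stri l t) (1, 0) (\<lambda>(x, z). orig_kernel l F x z t) (l t, y)
        = F' (1 + y / l t, 1 - y / l t, t) (1, 1, 0) / l t"
        by (rule pd_orig_kernel[where l = l and t = t and y = y, OF C2_has_derivative(1)[OF F t0T] t l y])
      show "(deriv l t / (2 * \<alpha>) * orig_kernel l F (l t) y t
         + pd (Stri l t) (1, 0) (\<lambda>(x, z). orig_kernel l F x z t) (l t, y)) * v y t = G y"
        unfolding pdk
        using l by (simp add: G_def orig_kernel_def add_divide_distrib diff_divide_distrib)
    qed
  qed simp
  also have "\<dots> = integral {0..l t} G"
    by (rule set_borel_integral_eq_integral(2)[OF borel_integrable_atLeastAtMost'[OF cG]])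
  also have "\<dots> = integral {0..1} (\<lambda>y. l t * G (l t * y))"
    using cG l by (intro integral_rescale) auto
  also have "\<dots> = integral {0..1} (\<lambda>y. \<kappa> * (F (1 + y, 1 - y, t) * v (l t * y) t)
     + F' (1 + y, 1 - y, t) (1, 1, 0) * v (l t * y) t)"
    using l by (intro integral_cong) (simp add: G_def \<kappa>_def distrib_left distrib_right)
  also have "\<dots> = \<kappa> * integral {0..1} (\<lambda>y. F (1 + y, 1 - y, t) * v (l t * y) t)
     + integral {0..1} (\<lambda>y. F' (1 + y, 1 - y, t) (1, 1, 0) * v (l t * y) t)"
    by (subst integral_add) (auto intro!: integrable_continuous_real continuous_intros c C2_continuous_on[OF F t0T] cv)
  finally show ?thesis
    using l by (simp add: feedback_def orig_kernel_def \<kappa>_def)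
qed

text \<open>The drift \<open>deriv l t / l t * (x * ux t x)\<close> is the contribution of the
  moving point to the time derivative. Time derivative and equation are first obtained for interior
  x and then extended to the end points by continuity.\<close>

lemma closed_loop_rescaled:
  assumes sol: "closed_loop_solution \<alpha> lam0 l t0 T k v0 v"
    and \<alpha>: "0 < \<alpha>" and t1: "t0 < t1" and lpos: "\<And>t. t \<in> {t0..T} \<Longrightarrow> 0 < l t"
    and dl: "\<And>t. t \<in> {t0..T} \<Longrightarrow> (l has_real_derivative deriv l t) (at t)"
    and cdl: "continuous_on {t0..T} (deriv l)"
    and u_def: "u = (\<lambda>t x. v (l t * x) t)"
  obtains ux uxx ut where
    "continuous_on ({t1..T} \<times> {0..1}) (\<lambda>(t, x). u t x)"
    "continuous_on ({t1..T} \<times> {0..1}) (\<lambda>(t, x). ux t x)"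
    "continuous_on ({t1..T} \<times> {0..1}) (\<lambda>(t, x). uxx t x)"
    "continuous_on ({t1..T} \<times> {0..1}) (\<lambda>(t, x). ut t x)"
    "\<And>t x. t \<in> {t1..T} \<Longrightarrow> x \<in> {0..1} \<Longrightarrow> ((\<lambda>s. u s x) has_real_derivative ut t x) (at t within {t1..T})"
    "\<And>t x. t \<in> {t1..T} \<Longrightarrow> x \<in> {0..1} \<Longrightarrow> (u t has_real_derivative ux t x) (at x within {0..1})"
    "\<And>t x. t \<in> {t1..T} \<Longrightarrow> x \<in> {0..1} \<Longrightarrow> (ux t has_real_derivative uxx t x) (at x within {0..1})"
    "\<And>t x. t \<in> {t1..T} \<Longrightarrow> x \<in> {0..1} \<Longrightarrow>
      ut t x = \<alpha> / (l t)\<^sup>2 * uxx t x + deriv l t / l t * (x * ux t x) + lam \<alpha> lam0 l (l t * x) t * u t x"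
    "\<And>t. t \<in> {t1..T} \<Longrightarrow> u t 0 = 0"
    "\<And>t. t \<in> {t1..T} \<Longrightarrow> ux t 1 / l t + deriv l t / (2 * \<alpha>) * u t 1 = feedback \<alpha> l k v t"
proof -
  define Q where "Q = {(x, t). t0 < t \<and> t \<le> T \<and> 0 \<le> x \<and> x \<le> l t}"
  define P where "P = (\<lambda>vx vxx vt. (continuous_on Q (\<lambda>(x, t). v x t) \<and> continuous_on Q (\<lambda>(x, t). vx x t) \<and>
      continuous_on Q (\<lambda>(x, t). vxx x t) \<and> continuous_on Q (\<lambda>(x, t). vt x t)) \<and>
      (\<forall>t\<in>{t0<..T}.
           (\<forall>x\<in>{0..l t}.
              ((\<lambda>z. v z t) has_real_derivative vx x t) (at x within {0..l t}) \<and>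
              ((\<lambda>z. vx z t) has_real_derivative vxx x t) (at x within {0..l t})) \<and>
           (\<forall>x\<in>{0<..<l t}.
              ((\<lambda>s. v x s) has_real_derivative vt x t) (at t within {t0<..T}) \<and>
              vt x t = \<alpha> * vxx x t + lam \<alpha> lam0 l x t * v x t) \<and>
           v 0 t = 0 \<and>
           vx (l t) t + deriv l t / (2 * \<alpha>) * v (l t) t = feedback \<alpha> l k v t))"
  have "\<exists>vx vxx vt. P vx vxx vt"
    using sol unfolding closed_loop_solution_def Let_def P_def Q_def by (rule conjunct1)
  then obtain vx vxx vt where P: "P vx vxx vt" by blast
  note big = conjunct1[OF P[unfolded P_def]] and tm = conjunct2[OF P[unfolded P_def]]
  from big have c: "continuous_on Q (\<lambda>(x, t). v x t)" "continuous_on Q (\<lambda>(x, t). vx x t)"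
    "continuous_on Q (\<lambda>(x, t). vxx x t)" "continuous_on Q (\<lambda>(x, t). vt x t)"
    by simp_all
  have d: "((\<lambda>z. v z t) has_real_derivative vx x t) (at x within {0..l t})"
    "((\<lambda>z. vx z t) has_real_derivative vxx x t) (at x within {0..l t})"
    if "t \<in> {t0<..T}" "x \<in> {0..l t}" for t x
    using bspec[OF tm that(1)] that(2) by blast+
  have dt: "((\<lambda>s. v x s) has_real_derivative vt x t) (at t within {t0<..T})"
    and pde: "vt x t = \<alpha> * vxx x t + lam \<alpha> lam0 l x t * v x t"
    if "t \<in> {t0<..T}" "x \<in> {0<..<l t}" for t x
    using bspec[OF tm that(1)] that(2) by blast+
  have bc: "v 0 t = 0" "vx (l t) t + deriv l t / (2 * \<alpha>) * v (l t) t = feedback \<alpha> l k v t"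
    if "t \<in> {t0<..T}" for t
    using bspec[OF tm that(1)] by simp_all
  define ux where "ux = (\<lambda>t x. l t * vx (l t * x) t)"
  define uxx where "uxx = (\<lambda>t x. (l t)\<^sup>2 * vxx (l t * x) t)"
  define ut where "ut = (\<lambda>t x. vt (l t * x) t + vx (l t * x) t * (deriv l t * x))"
  have tt: "t \<in> {t0<..T}" "t \<in> {t0..T}" if "t \<in> {t1..T}" for t using that t1 by auto
  have cl: "continuous_on {t1..T} l"
    using dl tt by (meson DERIV_isCont continuous_at_imp_continuous_on)
  have cl1: "continuous_on ({t1..T} \<times> {0..1::real}) (\<lambda>r. l (fst r))"
    by (rule continuous_on_compose2[OF cl]) (auto intro!: continuous_intros)
  have cdl1: "continuous_on ({t1..T} \<times> {0..1::real}) (\<lambda>r. deriv l (fst r))"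
    by (rule continuous_on_compose2[OF cdl]) (use tt in \<open>auto intro!: continuous_intros\<close>)
  have mem: "l t * x \<in> {0..l t}" if "t \<in> {t1..T}" "x \<in> {0..1}" for t x
    using that lpos[OF tt(2)[OF that(1)]] by (auto intro: mult_left_le)
  have memo: "l t * x \<in> {0<..<l t}" if "t \<in> {t1..T}" "x \<in> {0<..<1}" for t x
    using that lpos[OF tt(2)[OF that(1)]] by auto
  have cc: "continuous_on ({t1..T} \<times> {0..1}) (\<lambda>r. w (l (fst r) * snd r) (fst r))"
    if "continuous_on Q (\<lambda>(x, t). w x t)" for w
  proof -
    have "continuous_on ({t1..T} \<times> {0..1}) (\<lambda>r. (\<lambda>(x, t). w x t) (l (fst r) * snd r, fst r))"
      by (rule continuous_on_compose2[OF that])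
        (use mem tt in \<open>auto intro!: continuous_intros cl1 simp: Q_def\<close>)
    then show ?thesis by simp
  qed
  have cont: "continuous_on ({t1..T} \<times> {0..1}) (\<lambda>(t, x). u t x)"
    "continuous_on ({t1..T} \<times> {0..1}) (\<lambda>(t, x). ux t x)"
    "continuous_on ({t1..T} \<times> {0..1}) (\<lambda>(t, x). uxx t x)"
    "continuous_on ({t1..T} \<times> {0..1}) (\<lambda>(t, x). ut t x)"
    unfolding u_def ux_def uxx_def ut_def split_beta
    by (intro continuous_intros cc c cl1 cdl1)+
  have dx: "((\<lambda>x. w (l t * x) t) has_real_derivative l t * wx (l t * x) t) (at x within {0..1})"
    if t: "t \<in> {t1..T}" and x: "x \<in> {0..1}"
      and w: "\<And>t x. t \<in> {t0<..T} \<Longrightarrow> x \<in> {0..l t} \<Longrightarrow> ((\<lambda>z. w z t) has_real_derivative wx x t) (at x within {0..l t})"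
    for w wx t x
  proof -
    have "((\<lambda>z. w z t) has_real_derivative wx (l t * x) t) (at (l t * x) within (*) (l t) ` {0..1})"
      by (rule DERIV_subset[OF w[OF tt(1)[OF t] mem[OF t x]]]) (use mem[OF t] in auto)
    moreover have "((*) (l t) has_real_derivative l t) (at x within {0..1})"
      by (auto intro!: derivative_eq_intros)
    ultimately have "((\<lambda>z. w z t) \<circ> (*) (l t) has_real_derivative wx (l t * x) t * l t) (at x within {0..1})"
      by (rule DERIV_image_chain)
    then show ?thesis by (simp add: o_def mult.commute)
  qed
  show thesis
  proof (rule that[OF cont])
    show "(u t has_real_derivative ux t x) (at x within {0..1})" if "t \<in> {t1..T}" "x \<in> {0..1}" for t x
      unfolding u_def ux_def by (rule dx[OF that d(1)])
    show "(ux t has_real_derivative uxx t x) (at x within {0..1})" if "t \<in> {t1..T}" "x \<in> {0..1}" for t x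
      unfolding uxx_def ux_def power2_eq_square mult.assoc by (intro DERIV_cmult dx[OF that d(2)])
    show "((\<lambda>s. u s x) has_real_derivative ut t x) (at t within {t1..T})" if t: "t \<in> {t1..T}" "x \<in> {0..1}" for t x
    proof (rule has_real_derivative_time_closed_interval[OF cont(1,4) _ t])
      fix t x :: real assume tx: "t \<in> {t1..T}" "x \<in> {0<..<1}"
      show "((\<lambda>s. u s x) has_real_derivative ut t x) (at t within {t1..T})"
        unfolding u_def ut_def
        by (rule has_real_derivative_moving_point[where v = v and vx = vx and vt = vt and l = l and x = x and t = t, OF c(2)[unfolded Q_def] d(1) dt[OF tt(1)[OF tx(1)] memo[OF tx]] dl[OF tt(2)[OF tx(1)]] _ tx(2,1) t1])
          (use lpos in auto)
    qed
    show "ut t x = \<alpha> / (l t)\<^sup>2 * uxx t x + deriv l t / l t * (x * ux t x) + lam \<alpha> lam0 l (l t * x) t * u t x"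
      if t: "t \<in> {t1..T}" and x: "x \<in> {0..1}" for t x
    proof (rule continuous_eq_on_unit_interval[OF _ _ _ x])
      show "continuous_on {0..1} (ut t)" by (rule continuous_on_slice[OF cont(4) t])
      show "continuous_on {0..1} (\<lambda>x. \<alpha> / (l t)\<^sup>2 * uxx t x + deriv l t / l t * (x * ux t x) + lam \<alpha> lam0 l (l t * x) t * u t x)"
        unfolding lam_def using \<alpha> by (intro continuous_intros cont[THEN continuous_on_slice, OF t]) auto
      fix x :: real assume x: "x \<in> {0<..<1}"
      show "ut t x = \<alpha> / (l t)\<^sup>2 * uxx t x + deriv l t / l t * (x * ux t x) + lam \<alpha> lam0 l (l t * x) t * u t x"
        using pde[OF tt(1)[OF t] memo[OF t x]] lpos[OF tt(2)[OF t]]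
        by (simp add: ut_def uxx_def ux_def u_def)
    qed
    show "u t 0 = 0" if "t \<in> {t1..T}" for t using bc(1)[OF tt(1)[OF that]] by (simp add: u_def)
    show "ux t 1 / l t + deriv l t / (2 * \<alpha>) * u t 1 = feedback \<alpha> l k v t" if "t \<in> {t1..T}" for t
      using bc(2)[OF tt(1)[OF that]] lpos[OF tt(2)[OF that]] by (simp add: u_def ux_def)
  qed
qed

lemma closed_loop_continuous_on:
  assumes sol: "closed_loop_solution \<alpha> lam0 l t0 T k v0 v"
    and \<alpha>: "0 < \<alpha>" and l_pos: "\<And>t. t \<in> {t0..T} \<Longrightarrow> 0 < l t"
    and dl: "\<And>t. t \<in> {t0..T} \<Longrightarrow> (l has_real_derivative deriv l t) (at t)"
    and cdl: "continuous_on {t0..T} (deriv l)" and t: "t \<in> {t0<..T}"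
  shows "continuous_on {0..l t} (\<lambda>x. v x t)"
proof (rule closed_loop_rescaled[where ?t1.0 = t, OF sol \<alpha> _ l_pos dl cdl refl])
  assume c: "continuous_on ({t..T} \<times> {0..1}) (\<lambda>(t, x). v (l t * x) t)"
  have t': "t \<in> {t..T}" and l: "0 < l t" using t l_pos[of t] by auto
  have "continuous_on {0..l t} (\<lambda>x. v (l t * (x / l t)) t)"
    using l by (intro continuous_on_compose2[OF continuous_on_slice[OF c t']]) (auto intro!: continuous_intros)
  then show ?thesis using l by simp
qed (use t in auto)

section \<open>Decay of closed-loop solutions\<close>

lemma two_thirds_le: "(2 / 3 :: real) \<le> 1 / sqrt 2"
proof -
  have "sqrt 2 \<le> (3 / 2 :: real)" by (rule real_le_lsqrt) (auto simp: power2_eq_square)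
  then show ?thesis by (simp add: field_simps)
qed

text \<open>Passing from u to z at \<open>t1\<close> and back at t costs the two norms of the
  transform, and the energy estimate loses the factor exp (600 H^10 \<epsilon>) / (1 - \<epsilon>
  H^7). Its square root is covered by \<rho>, and the last condition on \<rho> says that the slack
  in \<open>CD\<close> can pay for it.\<close>

lemma decay_between:
  fixes t0 T \<alpha> lam0 c lstar M H \<epsilon> \<rho> t1 t :: real and l :: "real \<Rightarrow> real"
  assumes t0T: "t0 < T" and \<alpha>: "0 < \<alpha>" and lstar: "0 < lstar" and M: "0 < M"
    and l_pos: "\<And>t. t \<in> {t0..T} \<Longrightarrow> 0 < l t" and lle: "\<And>t. t \<in> {t0..T} \<Longrightarrow> l t \<le> lstar"
    and l_deriv: "\<And>t. t \<in> {t0..T} \<Longrightarrow> (l has_real_derivative deriv l t) (at t)"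
    and ddl: "\<And>t. t \<in> {t0..T} \<Longrightarrow> (deriv l has_real_derivative deriv (deriv l) t) (at t)"
    and K: "kernel_solution \<alpha> lam0 c l t0 T K"
    and KM: "\<And>q. q \<in> Dom t0 T \<Longrightarrow> \<bar>K q\<bar> \<le> M"
    and F: "C2_with F F' F'' (Dom t0 T)"
    and close: "\<And>\<xi> \<eta> t. (\<xi>, \<eta>, t) \<in> Dom t0 T \<Longrightarrow>
          \<bar>K (\<xi>, \<eta>, t) - F (\<xi>, \<eta>, t)\<bar>
          + \<bar>4 * \<alpha> / l t * pd (Dom t0 T) (1, 0, 0) (\<lambda>p. K p - F p) (\<xi>, 0, t)\<bar>
          + \<bar>kernel_residual \<alpha> lam0 c l t0 T (\<lambda>p. K p - F p) \<xi> \<eta> t\<bar> < \<epsilon>"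
    and sol: "closed_loop_solution \<alpha> lam0 l t0 T (orig_kernel l F) v0 v"
    and H: "1 \<le> H" "T - t0 \<le> H"
    and bl: "\<And>t. t \<in> {t0..T} \<Longrightarrow> 1 / H \<le> l t" "\<And>t. t \<in> {t0..T} \<Longrightarrow> l t \<le> H"
    and ba: "\<And>t. t \<in> {t0..T} \<Longrightarrow> 1 / H \<le> \<alpha> / (l t)\<^sup>2" "\<And>t. t \<in> {t0..T} \<Longrightarrow> \<alpha> / l t \<le> H"
    and bb: "\<And>t. t \<in> {t0..T} \<Longrightarrow> \<bar>deriv l t / l t\<bar> \<le> H"
    and b\<beta>: "\<And>t. t \<in> {t0..T} \<Longrightarrow> \<bar>l t * deriv l t / (2 * \<alpha>)\<bar> \<le> H"
    and b\<beta>': "\<And>t. t \<in> {t0..T} \<Longrightarrow> \<bar>((deriv l t)\<^sup>2 + l t * deriv (deriv l) t) / (2 * \<alpha>)\<bar> \<le> H"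
    and bc: "\<bar>c\<bar> \<le> H" and b\<mu>: "\<bar>mu0 \<alpha> c lstar\<bar> \<le> H"
    and bC: "(1 + lstar) * CI M lstar \<epsilon> \<le> H"
    and \<epsilon>: "0 < \<epsilon>" "300 * H^9 * \<epsilon> \<le> 1"
    and \<rho>: "0 < \<rho>" "exp (600 * H^10 * \<epsilon>) \<le> \<rho>\<^sup>2 * (1 - \<epsilon> * H^7)"
      "\<rho> * (1 + 2 / 3 * (lstar * tauK M \<epsilon>)) \<le> CD M lstar \<epsilon>"
    and t1: "t0 < t1" "t1 < T" and t: "t \<in> {t1..T}"
  shows "L2norm (l t) (\<lambda>x. v x t) \<le> CI M lstar \<epsilon> * CD M lstar \<epsilon> * exp (- mu0 \<alpha> c lstar / 2 * (t - t1))
     * L2norm (l t1) (\<lambda>x. v x t1)"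
proof -
  define u where "u = (\<lambda>t x. v (l t * x) t)"
  have cdl: "continuous_on {t0..T} (deriv l)"
    using ddl by (meson DERIV_isCont continuous_at_imp_continuous_on)
  show ?thesis
  proof (rule closed_loop_rescaled[OF sol \<alpha> t1(1) l_pos l_deriv cdl u_def])
    fix ux uxx ut
    assume cu: "continuous_on ({t1..T} \<times> {0..1}) (\<lambda>(t, x). u t x)"
      "continuous_on ({t1..T} \<times> {0..1}) (\<lambda>(t, x). ux t x)"
      "continuous_on ({t1..T} \<times> {0..1}) (\<lambda>(t, x). uxx t x)"
      "continuous_on ({t1..T} \<times> {0..1}) (\<lambda>(t, x). ut t x)"
      and du: "\<And>t x. t \<in> {t1..T} \<Longrightarrow> x \<in> {0..1} \<Longrightarrow> ((\<lambda>s. u s x) has_real_derivative ut t x) (at t within {t1..T})"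
      "\<And>t x. t \<in> {t1..T} \<Longrightarrow> x \<in> {0..1} \<Longrightarrow> (u t has_real_derivative ux t x) (at x within {0..1})"
      "\<And>t x. t \<in> {t1..T} \<Longrightarrow> x \<in> {0..1} \<Longrightarrow> (ux t has_real_derivative uxx t x) (at x within {0..1})"
      and pde: "\<And>t x. t \<in> {t1..T} \<Longrightarrow> x \<in> {0..1} \<Longrightarrow>
        ut t x = \<alpha> / (l t)\<^sup>2 * uxx t x + deriv l t / l t * (x * ux t x) + lam \<alpha> lam0 l (l t * x) t * u t x"
      and u0: "\<And>t. t \<in> {t1..T} \<Longrightarrow> u t 0 = 0"
      and u1: "\<And>t. t \<in> {t1..T} \<Longrightarrow> ux t 1 / l t + deriv l t / (2 * \<alpha>) * u t 1 = feedback \<alpha> l (orig_kernel l F) v t"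
    have tt: "t \<in> {t0..T}" if "t \<in> {t1..T}" for t using that t1 by auto
    have sub: "{t1..T} \<subseteq> {t0..T}" using t1 by auto
    have cv: "continuous_on {0..l t} (\<lambda>x. v x t)" if t: "t \<in> {t1..T}" for t
      by (rule closed_loop_continuous_on[OF sol \<alpha> l_pos l_deriv cdl]) (use t t1 in auto)
    note dF = C2_has_derivative[OF F t0T] and cF = C2_continuous_on[OF F t0T]
    have t01: "t0 \<le> t1" using t1 by simp
    define p where "p = (\<lambda>t x y. F (x + y, x - y, t))"
    define pX where "pX = (\<lambda>t x y. F' (x + y, x - y, t) (1, 1, 0))"
    define pY where "pY = (\<lambda>t x y. F' (x + y, x - y, t) (1, -1, 0))"
    define pt where "pt = (\<lambda>t x y. F' (x + y, x - y, t) (0, 0, 1))"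
    define pXX where "pXX = (\<lambda>t x y. F'' (x + y, x - y, t) (1, 1, 0) (1, 1, 0))"
    define pYY where "pYY = (\<lambda>t x y. F'' (x + y, x - y, t) (1, -1, 0) (1, -1, 0))"
    interpret rescaled_transform t1 T c l "deriv l" "\<lambda>t. \<alpha> / (l t)\<^sup>2" "\<lambda>t x. lam \<alpha> lam0 l (l t * x) t"
      u ux uxx ut p pX pY pt pXX pYY
    proof
      show "(l has_real_derivative deriv l t) (at t within {t1..T})" if "t \<in> {t1..T}" for t
        by (rule has_field_derivative_at_within[OF l_deriv[OF tt[OF that]]])
      show "continuous_on {t1..T} (deriv l)" by (rule continuous_on_subset[OF cdl sub])
      show "0 < l t" if "t \<in> {t1..T}" for t by (rule l_pos[OF tt[OF that]])
      show "continuous_on {0..1} (\<lambda>x. lam \<alpha> lam0 l (l t * x) t)" for t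
        unfolding lam_def using \<alpha> by (intro continuous_intros) auto
      show "continuous_on (Volterra_dom t1 T) (\<lambda>(t, x, y). p t x y)"
        "continuous_on (Volterra_dom t1 T) (\<lambda>(t, x, y). pX t x y)"
        "continuous_on (Volterra_dom t1 T) (\<lambda>(t, x, y). pY t x y)"
        "continuous_on (Volterra_dom t1 T) (\<lambda>(t, x, y). pt t x y)"
        "continuous_on (Volterra_dom t1 T) (\<lambda>(t, x, y). pXX t x y)"
        "continuous_on (Volterra_dom t1 T) (\<lambda>(t, x, y). pYY t x y)"
        unfolding p_def pX_def pY_def pt_def pXX_def pYY_def
        by (rule continuous_on_rescaled_kernel[OF cF(1) t01] continuous_on_rescaled_kernel[OF cF(2) t01]
          continuous_on_rescaled_kernel[OF cF(3) t01])+
      fix t x y :: real assume t: "t \<in> {t1..T}"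
      {
        assume xy: "0 \<le> y" "y \<le> x" "x \<le> 1"
        note d1 = has_real_derivative_rescaled_kernel[OF dF(1) t t01 xy]
          and d2 = has_real_derivative_rescaled_kernel[OF dF(2) t t01 xy]
        show "((\<lambda>x. p t x y) has_real_derivative pX t x y) (at x within {y..1})"
          unfolding p_def pX_def by (rule d1(1))
        show "((\<lambda>x. pX t x y) has_real_derivative pXX t x y) (at x within {y..1})"
          unfolding pX_def pXX_def by (rule d2(1))
        show "((\<lambda>y. p t x y) has_real_derivative pY t x y) (at y within {0..x})"
          unfolding p_def pY_def by (rule d1(2))
        show "((\<lambda>y. pY t x y) has_real_derivative pYY t x y) (at y within {0..x})"
          unfolding pY_def pYY_def by (rule d2(2))
        show "((\<lambda>t. p t x y) has_real_derivative pt t x y) (at t within {t1..T})"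
          unfolding p_def pt_def by (rule d1(3))
      }
      assume x: "x \<in> {0..1}"
      have "((2, 0, 0) :: real \<times> real \<times> real) = (1, 1, 0) + (1, -1, 0)" by simp
      then have "F' (x + x, x - x, t) (2, 0, 0) = pX t x x + pY t x x"
        unfolding pX_def pY_def by (simp only: blinfun.add_right)
      with has_real_derivative_rescaled_kernel(4)[OF dF(1) t t01, of x x]
      show "((\<lambda>x. p t x x) has_real_derivative pX t x x + pY t x x) (at x within {0..1})"
        using x by (simp add: p_def)
    qed (use cu du pde u0 in auto)
    define \<tau> where "\<tau> = tauK M \<epsilon>"
    have \<tau>: "0 < \<tau>" using M \<epsilon> by (simp add: \<tau>_def tauK_def)
    have CI1: "1 \<le> CI M lstar \<epsilon>"
      using \<tau> lstar by (simp add: CI_def tauQ_def \<tau>_def[symmetric])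
    have pb: "\<bar>p t x y\<bar> \<le> \<tau>" if "t \<in> {t1..T}" "0 \<le> y" "y \<le> x" "x \<le> 1" for t x y
    proof -
      have "\<bar>p t x y - K (x + y, x - y, t)\<bar> \<le> \<epsilon>"
        unfolding p_def by (rule kernel_defects(3)[OF t0T \<alpha> l_pos K F close tt[OF that(1)] that(2-4)])
      moreover have "\<bar>K (x + y, x - y, t)\<bar> \<le> M"
        by (rule KM[OF kernel_coordinates_Dom[OF tt[OF that(1)] that(2-4)]])
      ultimately show ?thesis by (simp add: \<tau>_def tauK_def)
    qed
    have norms: "nrm2 (z t) \<le> (1 + 2 / 3 * (lstar * \<tau>)) * nrm2 (u t)"
      "nrm2 (u t) \<le> CI M lstar \<epsilon> * nrm2 (z t)" if t: "t \<in> {t1..T}" for t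
    proof -
      note V = Volterra_norm_bounds[of "p t" \<tau> "l t" "u t" "z t", OF Volterra_dom_slice(2)[OF cp t] pb[OF t]
        less_imp_le[OF l_pos[OF tt[OF t]]] continuous_on_slice[OF cu(1) t] continuous_on_slice[OF continuous_z(1) t] z_def]
      have l\<tau>: "l t * \<tau> \<le> lstar * \<tau>" "0 \<le> l t * \<tau>"
        using lle[OF tt[OF t]] l_pos[OF tt[OF t]] \<tau> by auto
      note nn = nrm2_nonneg[OF continuous_on_slice[OF cu(1) t]] nrm2_nonneg[OF continuous_on_slice[OF continuous_z(1) t]]
      have "1 + 2 / 3 * (l t * \<tau>) \<le> 1 + 2 / 3 * (lstar * \<tau>)" using l\<tau>(1) by linarith
      from mult_right_mono[OF this nn(1)] have "(1 + 2 / 3 * (l t * \<tau>)) * nrm2 (u t) \<le> (1 + 2 / 3 * (lstar * \<tau>)) * nrm2 (u t)" .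
      moreover have "nrm2 (z t) \<le> (1 + 2 / 3 * (l t * \<tau>)) * nrm2 (u t)" by (rule V(1))
      ultimately show "nrm2 (z t) \<le> (1 + 2 / 3 * (lstar * \<tau>)) * nrm2 (u t)" by linarith
      have "l t * \<tau> * exp (l t * \<tau>) \<le> lstar * \<tau> * exp (lstar * \<tau>)"
        by (rule mult_mono) (use l\<tau> in auto)
      \<comment> \<open>For the inverse transform the slack is given away by rounding 2/3 up to 1 /
        sqrt 2; only the slack of the forward transform is kept for \<rho>.\<close>
      from mult_mono[OF two_thirds_le this]
      have "2 / 3 * (l t * \<tau> * exp (l t * \<tau>)) \<le> 1 / sqrt 2 * (lstar * \<tau> * exp (lstar * \<tau>))"
        using l\<tau> by simp
      then have "1 + 2 / 3 * (l t * \<tau> * exp (l t * \<tau>)) \<le> CI M lstar \<epsilon>"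
        by (simp add: CI_def tauQ_def \<tau>_def[symmetric] mult_ac)
      from mult_right_mono[OF this nn(2)] V(2) show "nrm2 (u t) \<le> CI M lstar \<epsilon> * nrm2 (z t)"
        by linarith
    qed
    have bS: "nrm2 (source t) \<le> \<epsilon> * H * (\<bar>zx t 0\<bar> + nrm2 (z t))" if t: "t \<in> {t1..T}" for t
    proof -
      note kd = kernel_defects[OF t0T \<alpha> l_pos K F close tt[OF t]]
      have l: "0 < l t" by (rule l_pos[OF tt[OF t]])
      have "nrm2 (source t) \<le> \<epsilon> * ((1 + 2 / 3 * l t) * nrm2 (u t) + \<alpha> / (l t)\<^sup>2 * l t * \<bar>ux t 0\<bar>)"
      proof (rule nrm2_source_le[OF t])
        show "\<bar>lam \<alpha> lam0 l (l t * x) t + c + 2 * (\<alpha> / (l t)\<^sup>2) * l t * (pX t x x + pY t x x)\<bar> \<le> \<epsilon>"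
          if "x \<in> {0..1}" for x
          unfolding pX_def pY_def by (rule kd(2)[where y = 0]) (use that in auto)
        show "\<bar>p t x 0\<bar> \<le> \<epsilon>" if "x \<in> {0..1}" for x
          unfolding p_def by (rule kd(4)[where y = 0]) (use that in auto)
        show "\<bar>residual t x y\<bar> \<le> \<epsilon>" if "0 \<le> y" "y \<le> x" "x \<le> 1" for x y
          unfolding residual_def unfolding p_def pX_def pY_def pt_def pXX_def pYY_def by (rule kd(1)) (use that in auto)
      qed (use \<epsilon> \<alpha> l in auto)
      \<comment> \<open>The bound for u in terms of z enters through \<open>bC\<close>; the
        coefficient of the trace is \<open>\<alpha> / l t\<close>, and the trace itself is unchanged
        by the transform since u vanishes at 0.\<close>
      also have "\<dots> \<le> \<epsilon> * (H * nrm2 (z t) + H * \<bar>zx t 0\<bar>)"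
      proof (intro mult_left_mono add_mono)
        note nn = nrm2_nonneg[OF continuous_on_slice[OF cu(1) t]] nrm2_nonneg[OF continuous_on_slice[OF continuous_z(1) t]]
        have "(1 + 2 / 3 * l t) * nrm2 (u t) \<le> (1 + lstar) * (CI M lstar \<epsilon> * nrm2 (z t))"
          using norms(2)[OF t] lle[OF tt[OF t]] l nn by (intro mult_mono) auto
        also have "\<dots> \<le> H * nrm2 (z t)"
          using bC nn by (simp add: mult.assoc[symmetric] mult_right_mono)
        finally show "(1 + 2 / 3 * l t) * nrm2 (u t) \<le> H * nrm2 (z t)" .
        show "\<alpha> / (l t)\<^sup>2 * l t * \<bar>ux t 0\<bar> \<le> H * \<bar>zx t 0\<bar>"
          using mult_right_mono[OF ba(2)[OF tt[OF t]] abs_ge_zero[of "ux t 0"]] l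
          by (simp add: zx_0[OF t] power2_eq_square)
      qed (use \<epsilon> in auto)
      finally show ?thesis by (simp add: algebra_simps)
    qed
    have z1: "zx t 1 = - (l t * deriv l t / (2 * \<alpha>)) * z t 1" if t: "t \<in> {t1..T}" for t
    proof (rule zx_1)
      have l: "0 < l t" by (rule l_pos[OF tt[OF t]])
      define I where "I = integral {0..1} (\<lambda>y. p t 1 y * u t y)"
      define I' where "I' = integral {0..1} (\<lambda>y. pX t 1 y * u t y)"
      have "ux t 1 / l t + deriv l t / (2 * \<alpha>) * u t 1 = deriv l t / (2 * \<alpha>) * l t * I + I' + p t 1 1 * u t 1"
        unfolding u1[OF t] feedback_rescale[where l = l and t = t and v = v, OF F t0T tt[OF t] l cv[OF t]] I_def I'_def
        by (simp add: p_def pX_def u_def)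
      then have "ux t 1 / l t = - (deriv l t / (2 * \<alpha>)) * u t 1 + deriv l t / (2 * \<alpha>) * l t * I + I' + p t 1 1 * u t 1"
        by simp
      then have "ux t 1 = l t * (- (deriv l t / (2 * \<alpha>)) * u t 1 + deriv l t / (2 * \<alpha>) * l t * I + I' + p t 1 1 * u t 1)"
        using l by (simp add: field_simps)
      then show "ux t 1 = - (l t * deriv l t / (2 * \<alpha>)) * u t 1
        + l t * deriv l t / (2 * \<alpha>) * l t * integral {0..1} (\<lambda>y. p t 1 y * u t y)
        + l t * (p t 1 1 * u t 1 + integral {0..1} (\<lambda>y. pX t 1 y * u t y))"
        unfolding I_def[symmetric] I'_def[symmetric] by (simp add: algebra_simps)
    qed
    define \<mu> where "\<mu> = mu0 \<alpha> c lstar"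
    have energy: "(1 - \<epsilon> * H^7) * (l t * (nrm2 (z t))\<^sup>2)
      \<le> exp (600 * H^10 * \<epsilon> - \<mu> * (t - t1)) * (l t1 * (nrm2 (z t1))\<^sup>2)"
    proof (rule energy_estimate[where z = z and zx = zx and zxx = zxx and zt = zt and S = source and l = l
        and dl = "deriv l" and ddl = "deriv (deriv l)" and L = lstar and T = T and c = c, OF \<alpha> H(1) _ \<epsilon> t1(2)])
      show "T - t1 \<le> H" using H t1 by simp
      show "\<And>t. t \<in> {t1..T} \<Longrightarrow> (deriv l has_real_derivative deriv (deriv l) t) (at t within {t1..T})"
        by (rule has_field_derivative_at_within[OF ddl[OF tt]])
      show "\<And>t. t \<in> {t1..T} \<Longrightarrow> 1 / H \<le> l t \<and> l t \<le> H \<and> l t \<le> lstar"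
        using bl lle tt by blast
      show "\<And>t. t \<in> {t1..T} \<Longrightarrow> 1 / H \<le> \<alpha> / (l t)\<^sup>2" using ba tt by blast
      show "\<And>t. t \<in> {t1..T} \<Longrightarrow> \<bar>deriv l t / l t\<bar> \<le> H" using bb tt by blast
      show "\<And>t. t \<in> {t1..T} \<Longrightarrow> \<bar>l t * deriv l t / (2 * \<alpha>)\<bar> \<le> H" using b\<beta> tt by blast
      show "\<And>t. t \<in> {t1..T} \<Longrightarrow> \<bar>((deriv l t)\<^sup>2 + l t * deriv (deriv l) t) / (2 * \<alpha>)\<bar> \<le> H"
        using b\<beta>' tt by blast
      show "\<bar>\<mu>\<bar> \<le> H" using b\<mu> by (simp add: \<mu>_def)
      show "\<mu> = 4 * \<alpha> / lstar\<^sup>2 + 2 * c" by (simp add: \<mu>_def mu0_def)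
    qed (fact dl bc continuous_z has_real_derivative_z z_0 z1 continuous_source pde_z bS t)+
    have t1': "t1 \<in> {t1..T}" using t1 by simp
    have l: "0 < l t" "0 < l t1" using l_pos tt t t1' by auto
    note nn = nrm2_nonneg[OF continuous_on_slice[OF continuous_z(1) t]] nrm2_nonneg[OF continuous_on_slice[OF cu(1) t1']]
      nrm2_nonneg[OF continuous_on_slice[OF continuous_z(1) t1']]
    define E where "E = (\<lambda>s. sqrt (l s) * nrm2 (z s))"
    have "\<epsilon> * H^7 < 1"
    proof -
      have "\<epsilon> * H^7 \<le> \<epsilon> * H^9" using \<epsilon> H by (intro mult_left_mono power_increasing) auto
      moreover have "300 * (\<epsilon> * H^9) \<le> 1" using \<epsilon>(2) by (simp add: ac_simps)
      ultimately show ?thesis by linarith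
    qed
    have "exp (600 * H^10 * \<epsilon> - \<mu> * (t - t1)) = exp (600 * H^10 * \<epsilon>) * exp (- \<mu> * (t - t1))"
      by (simp add: exp_add[symmetric])
    with energy have "(1 - \<epsilon> * H^7) * (E t)\<^sup>2 \<le> exp (600 * H^10 * \<epsilon>) * (exp (- \<mu> * (t - t1)) * (E t1)\<^sup>2)"
      using l by (simp add: E_def power_mult_distrib mult_ac)
    also have "\<dots> \<le> (\<rho>\<^sup>2 * (1 - \<epsilon> * H^7)) * (exp (- \<mu> * (t - t1)) * (E t1)\<^sup>2)"
      using \<rho>(2) by (intro mult_right_mono) auto
    finally have "(1 - \<epsilon> * H^7) * (E t)\<^sup>2 \<le> (1 - \<epsilon> * H^7) * (\<rho>\<^sup>2 * (exp (- \<mu> * (t - t1)) * (E t1)\<^sup>2))"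
      by (simp add: mult_ac)
    then have "(E t)\<^sup>2 \<le> \<rho>\<^sup>2 * (exp (- \<mu> * (t - t1)) * (E t1)\<^sup>2)"
      using \<open>\<epsilon> * H^7 < 1\<close> by simp
    also have "\<dots> = (\<rho> * exp (- \<mu> / 2 * (t - t1)) * E t1)\<^sup>2"
      by (simp add: power_mult_distrib power2_eq_square exp_add[symmetric] field_simps)
    finally have Et: "E t \<le> \<rho> * exp (- \<mu> / 2 * (t - t1)) * E t1"
      by (rule power2_le_imp_le) (use \<rho> l nn in \<open>simp add: E_def\<close>)
    have "L2norm (l t) (\<lambda>x. v x t) = sqrt (l t) * nrm2 (u t)"
      using L2norm_rescale[OF cv[OF t] l(1)] by (simp add: u_def)
    also have "\<dots> \<le> sqrt (l t) * (CI M lstar \<epsilon> * nrm2 (z t))"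
      using norms(2)[OF t] l by (intro mult_left_mono) auto
    also have "\<dots> = CI M lstar \<epsilon> * E t" by (simp add: E_def)
    also have "\<dots> \<le> CI M lstar \<epsilon> * (\<rho> * exp (- \<mu> / 2 * (t - t1)) * E t1)"
      using Et CI1 by (intro mult_left_mono) auto
    also have "E t1 \<le> sqrt (l t1) * ((1 + 2 / 3 * (lstar * \<tau>)) * nrm2 (u t1))"
      unfolding E_def using norms(1)[OF t1'] l by (intro mult_left_mono) auto
    also have "sqrt (l t1) * ((1 + 2 / 3 * (lstar * \<tau>)) * nrm2 (u t1)) = (1 + 2 / 3 * (lstar * \<tau>)) * L2norm (l t1) (\<lambda>x. v x t1)"
      using L2norm_rescale[OF cv[OF t1'] l(2)] by (simp add: u_def)
    finally have "L2norm (l t) (\<lambda>x. v x t) \<le> CI M lstar \<epsilon> * exp (- \<mu> / 2 * (t - t1))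
        * ((\<rho> * (1 + 2 / 3 * (lstar * \<tau>))) * L2norm (l t1) (\<lambda>x. v x t1))"
      using CI1 \<rho>(1) by (simp add: mult_ac)
    \<comment> \<open>The loss \<rho> disappears into \<open>CD\<close> at the starting
      time.\<close>
    also have "\<dots> \<le> CI M lstar \<epsilon> * exp (- \<mu> / 2 * (t - t1)) * (CD M lstar \<epsilon> * L2norm (l t1) (\<lambda>x. v x t1))"
    proof -
      have "0 \<le> L2norm (l t1) (\<lambda>x. v x t1)"
        using L2norm_rescale[OF cv[OF t1'] l(2)] nn l by (simp add: u_def)
      then show ?thesis
        using \<rho>(3) CI1 by (intro mult_left_mono mult_right_mono) (auto simp: \<tau>_def)
    qed
    finally show ?thesis by (simp add: \<mu>_def mult_ac)
  qed
qed

section \<open>Passage to the initial time\<close>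

lemma L2_square_le:
  fixes f g :: "real \<Rightarrow> real"
  assumes m: "f \<in> borel_measurable lborel" "g \<in> borel_measurable lborel"
    and i: "integrable lborel (\<lambda>x. (f x)\<^sup>2)" "integrable lborel (\<lambda>x. (g x)\<^sup>2)" and \<eta>: "0 < \<eta>"
  shows "(LINT x|lborel. (f x)\<^sup>2) \<le> (1 + \<eta>) * (LINT x|lborel. (g x)\<^sup>2) + (1 + 1 / \<eta>) * (LINT x|lborel. (f x - g x)\<^sup>2)"
proof -
  have diff: "integrable lborel (\<lambda>x. (f x - g x)\<^sup>2)"
  proof (rule Bochner_Integration.integrable_bound)
    show "integrable lborel (\<lambda>x. 2 * (f x)\<^sup>2 + 2 * (g x)\<^sup>2)" using i by simp
    show "(\<lambda>x. (f x - g x)\<^sup>2) \<in> borel_measurable lborel" using m by simp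
    have "(f x - g x)\<^sup>2 \<le> 2 * (f x)\<^sup>2 + 2 * (g x)\<^sup>2" for x
      using zero_le_power2[of "f x + g x"] by (simp add: power2_eq_square algebra_simps)
    then show "AE x in lborel. norm ((f x - g x)\<^sup>2) \<le> norm (2 * (f x)\<^sup>2 + 2 * (g x)\<^sup>2)" by simp
  qed
  \<comment> \<open>Young's inequality with a free parameter \<eta>: the weight of the reference
    function can be brought as close to 1 as desired while the large weight falls on the
    difference.\<close>
  have pw: "(f x)\<^sup>2 \<le> (1 + \<eta>) * (g x)\<^sup>2 + (1 + 1 / \<eta>) * (f x - g x)\<^sup>2" for x
  proof -
    define d where "d = f x - g x"
    have "0 \<le> (\<eta> * g x - d)\<^sup>2 / \<eta>" using \<eta> by simp
    also have "\<dots> = \<eta> * (g x)\<^sup>2 - 2 * (g x * d) + d\<^sup>2 / \<eta>"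
      using \<eta> by (simp add: power2_eq_square field_simps)
    finally have "(g x + d)\<^sup>2 \<le> (1 + \<eta>) * (g x)\<^sup>2 + (1 + 1 / \<eta>) * d\<^sup>2"
      by (simp add: power2_eq_square algebra_simps)
    then show ?thesis by (simp add: d_def)
  qed
  have "(LINT x|lborel. (f x)\<^sup>2) \<le> (LINT x|lborel. (1 + \<eta>) * (g x)\<^sup>2 + (1 + 1 / \<eta>) * (f x - g x)\<^sup>2)"
    using i diff pw by (intro integral_mono) auto
  also have "\<dots> = (1 + \<eta>) * (LINT x|lborel. (g x)\<^sup>2) + (1 + 1 / \<eta>) * (LINT x|lborel. (f x - g x)\<^sup>2)"
    using i diff by simp
  finally show ?thesis .
qed

lemma L2norm_nonneg: "0 \<le> L2norm b g"
  unfolding L2norm_def set_lebesgue_integral_def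
  by (intro real_sqrt_ge_zero integral_nonneg_AE) auto

text \<open>Extension by zero turns norms over different intervals into integrals over the whole
  line, where they can be compared.\<close>

lemma in_L2_indicator:
  assumes "in_L2 b g"
  shows "(\<lambda>x. indicator {0<..<b} x * g x) \<in> borel_measurable lborel"
    and "integrable lborel (\<lambda>x. (indicator {0<..<b} x * g x)\<^sup>2)"
    and "(LINT x|lborel. (indicator {0<..<b} x * g x)\<^sup>2) = (L2norm b g)\<^sup>2"
proof -
  have eq: "(\<lambda>x. (indicator {0<..<b} x * g x)\<^sup>2) = (\<lambda>x. indicator {0<..<b} x *\<^sub>R (g x)\<^sup>2)"
    by (auto simp: fun_eq_iff indicator_def)
  show "(\<lambda>x. indicator {0<..<b} x * g x) \<in> borel_measurable lborel"
    using assms by (simp add: in_L2_def set_borel_measurable_def)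
  show "integrable lborel (\<lambda>x. (indicator {0<..<b} x * g x)\<^sup>2)"
    unfolding eq using assms by (simp add: in_L2_def set_integrable_def)
  have "0 \<le> (LINT x:{0<..<b}|lborel. (g x)\<^sup>2)"
    unfolding set_lebesgue_integral_def by (intro integral_nonneg_AE) auto
  then show "(LINT x|lborel. (indicator {0<..<b} x * g x)\<^sup>2) = (L2norm b g)\<^sup>2"
    unfolding eq by (simp add: L2norm_def set_lebesgue_integral_def)
qed

lemma continuous_on_imp_in_L2:
  assumes g: "continuous_on {0..b} g"
  shows "in_L2 b g"
proof -
  have sub: "{0<..<b} \<subseteq> {0..b}" by auto
  have g2: "continuous_on {0..b} (\<lambda>x. (g x)\<^sup>2)" using g by (intro continuous_intros)
  have "set_integrable lborel {0<..<b} g" "set_integrable lborel {0<..<b} (\<lambda>x. (g x)\<^sup>2)"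
    by (rule set_integrable_subset[OF borel_integrable_atLeastAtMost'[OF g]]
        set_integrable_subset[OF borel_integrable_atLeastAtMost'[OF g2]]; use sub in simp)+
  then show ?thesis
    by (auto simp: in_L2_def set_integrable_def set_borel_measurable_def)
qed

text \<open>For fixed \<eta> the bound at time s is compared with the initial value at the cost
  \<open>(1 + 1 / \<eta>) * D s\<close>, which vanishes as s tends to \<open>t0\<close>; then \<eta>
  tends to 0. Working with squares keeps the comparison free of the triangle inequality.\<close>

lemma le_L2norm_initial:
  fixes X :: real and \<phi> :: "real \<Rightarrow> real"
  assumes v0: "in_L2 (l t0) v0"
    and lim: "((\<lambda>t. LINT x|lborel. (indicator {0<..<l t} x * v x t - indicator {0<..<l t0} x * v0 x)\<^sup>2)
        \<longlongrightarrow> 0) (at_right t0)"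
    and c: "\<And>s. s \<in> {t0<..<t} \<Longrightarrow> continuous_on {0..l s} (\<lambda>x. v x s)"
    and X: "0 \<le> X" "\<And>s. s \<in> {t0<..<t} \<Longrightarrow> X \<le> \<phi> s * L2norm (l s) (\<lambda>x. v x s)"
    and \<phi>: "(\<phi> \<longlongrightarrow> \<phi>0) (at_right t0)" "0 \<le> \<phi>0" and t: "t0 < t"
  shows "X \<le> \<phi>0 * L2norm (l t0) v0"
proof -
  define D where "D = (\<lambda>t. LINT x|lborel. (indicator {0<..<l t} x * v x t - indicator {0<..<l t0} x * v0 x)\<^sup>2)"
  define N where "N = L2norm (l t0) v0"
  have "X\<^sup>2 \<le> \<phi>0\<^sup>2 * ((1 + \<eta>) * N\<^sup>2)" if \<eta>: "0 < \<eta>" for \<eta>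
  proof (rule tendsto_lowerbound)
    have "((\<lambda>s. (\<phi> s)\<^sup>2 * ((1 + \<eta>) * N\<^sup>2 + (1 + 1 / \<eta>) * D s)) \<longlongrightarrow> \<phi>0\<^sup>2 * ((1 + \<eta>) * N\<^sup>2 + (1 + 1 / \<eta>) * 0)) (at_right t0)"
      using lim unfolding D_def[symmetric] by (intro tendsto_intros \<phi>)
    then show "((\<lambda>s. (\<phi> s)\<^sup>2 * ((1 + \<eta>) * N\<^sup>2 + (1 + 1 / \<eta>) * D s)) \<longlongrightarrow> \<phi>0\<^sup>2 * ((1 + \<eta>) * N\<^sup>2)) (at_right t0)"
      by simp
    have "X\<^sup>2 \<le> (\<phi> s)\<^sup>2 * ((1 + \<eta>) * N\<^sup>2 + (1 + 1 / \<eta>) * D s)" if s: "s \<in> {t0<..<t}" for s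
    proof -
      note i = in_L2_indicator[OF continuous_on_imp_in_L2[OF c[OF s]]] and i0 = in_L2_indicator[OF v0]
      have "X\<^sup>2 \<le> (\<phi> s * L2norm (l s) (\<lambda>x. v x s))\<^sup>2"
        using X(1) X(2)[OF s] by (intro power_mono) auto
      also have "\<dots> = (\<phi> s)\<^sup>2 * (L2norm (l s) (\<lambda>x. v x s))\<^sup>2" by (simp add: power_mult_distrib)
      also have "(L2norm (l s) (\<lambda>x. v x s))\<^sup>2 \<le> (1 + \<eta>) * N\<^sup>2 + (1 + 1 / \<eta>) * D s"
        unfolding D_def N_def i(3)[symmetric] i0(3)[symmetric]
        by (rule L2_square_le[OF i(1) i0(1) i(2) i0(2) \<eta>])
      finally show ?thesis by (simp add: mult_left_mono)
    qed
    then show "\<forall>\<^sub>F s in at_right t0. X\<^sup>2 \<le> (\<phi> s)\<^sup>2 * ((1 + \<eta>) * N\<^sup>2 + (1 + 1 / \<eta>) * D s)"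
      using eventually_at_right_real[OF t] by (auto elim: eventually_mono)
  qed simp
  \<comment> \<open>The difference term has disappeared in the first limit, so \<eta> may now go to
    0.\<close>
  then have "\<forall>\<^sub>F \<eta> in at_right 0. X\<^sup>2 \<le> \<phi>0\<^sup>2 * ((1 + \<eta>) * N\<^sup>2)"
    using eventually_at_right_real[of 0 1] by (auto elim: eventually_mono)
  moreover have "((\<lambda>\<eta>. \<phi>0\<^sup>2 * ((1 + \<eta>) * N\<^sup>2)) \<longlongrightarrow> \<phi>0\<^sup>2 * ((1 + 0) * N\<^sup>2)) (at_right 0)"
    by (intro tendsto_intros)
  ultimately have "X\<^sup>2 \<le> \<phi>0\<^sup>2 * ((1 + 0) * N\<^sup>2)"
    by (intro tendsto_lowerbound[where F = "at_right 0"]) auto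
  then have "X\<^sup>2 \<le> (\<phi>0 * N)\<^sup>2" by (simp add: power_mult_distrib)
  then show ?thesis
    unfolding N_def[symmetric] by (rule power2_le_imp_le) (simp add: \<phi> N_def L2norm_nonneg)
qed

section \<open>Choice of the constants and conclusion\<close>

lemma bounded_on_interval:
  fixes f :: "real \<Rightarrow> real"
  assumes "continuous_on {a..b} f"
  obtains B where "0 \<le> B" "\<And>t. t \<in> {a..b} \<Longrightarrow> \<bar>f t\<bar> \<le> B"
proof -
  have "bounded (f ` {a..b})"
    by (intro compact_imp_bounded compact_continuous_image assms compact_Icc)
  then obtain B where B: "\<forall>t\<in>{a..b}. \<bar>f t\<bar> \<le> B" by (auto simp: bounded_iff)
  show thesis
  proof (rule that[of "\<bar>B\<bar>"])
    show "\<bar>f t\<bar> \<le> \<bar>B\<bar>" if "t \<in> {a..b}" for t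
      using bspec[OF B that] by linarith
  qed simp
qed

text \<open>Used to bound \<open>CI\<close> by its value at \<epsilon> = 1, since H has to be fixed
  before \<epsilon>.\<close>

lemma CI_mono:
  assumes "0 \<le> M" "0 \<le> L" "0 \<le> \<epsilon>" "\<epsilon> \<le> \<epsilon>'"
  shows "CI M L \<epsilon> \<le> CI M L \<epsilon>'"
  unfolding CI_def tauQ_def tauK_def using assms
  by (intro add_left_mono divide_right_mono mult_right_mono mult_mono) (auto intro!: mult_right_mono)

theorem theorem3p2:
  fixes t0 T \<alpha> lam0 c Dbar lstar M :: real
    and l :: "real \<Rightarrow> real"
    and K :: "real \<times> real \<times> real \<Rightarrow> real"
  assumes "0 \<le> t0" and "t0 < T" and "0 < \<alpha>" and "0 < lam0"
    and "\<forall>t\<ge>t0. 0 < l t"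
    and "real_analytic_on l {t0..}"
    and "0 < Dbar"
    and "\<forall>t>t0. \<forall>j::nat. \<bar>(deriv ^^ j) l t\<bar> \<le> Dbar ^ (j + 1) * fact j"
    and "0 < lstar" and "\<forall>t\<ge>t0. l t \<le> lstar"
    and "kernel_solution \<alpha> lam0 c l t0 T K"
    and "0 < M"
    and "\<forall>t\<in>{t0..T}.
           (SUP (\<xi>, \<eta>)\<in>Sbar. \<bar>K (\<xi>, \<eta>, t)\<bar>)
           + (SUP (\<xi>, \<eta>)\<in>Sbar. \<bar>pd (Dom t0 T) (0, 0, 1) K (\<xi>, \<eta>, t)\<bar>) \<le> M"
  shows "\<exists>\<epsilon>star>0. \<forall>\<epsilon>. 0 < \<epsilon> \<and> \<epsilon> < \<epsilon>star \<longrightarrow>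
    (\<forall>Khat :: real \<times> real \<times> real \<Rightarrow> real.
       C2_on Khat (Dom t0 T) \<longrightarrow>
       (\<forall>\<xi> \<eta> t. (\<xi>, \<eta>, t) \<in> Dom t0 T \<longrightarrow>
          \<bar>K (\<xi>, \<eta>, t) - Khat (\<xi>, \<eta>, t)\<bar>
          + \<bar>4 * \<alpha> / l t * pd (Dom t0 T) (1, 0, 0) (\<lambda>p. K p - Khat p) (\<xi>, 0, t)\<bar>
          + \<bar>kernel_residual \<alpha> lam0 c l t0 T (\<lambda>p. K p - Khat p) \<xi> \<eta> t\<bar> < \<epsilon>) \<longrightarrow>
       (\<forall>v0 v. closed_loop_solution \<alpha> lam0 l t0 T (orig_kernel l Khat) v0 v \<longrightarrow>
          (\<forall>t\<in>{t0..T}.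
             L2norm (l t) (\<lambda>x. v x t)
             \<le> CI M lstar \<epsilon> * CD M lstar \<epsilon>
                * exp (- ((mu0 \<alpha> c lstar - C0 M lstar \<epsilon> * \<epsilon>) / 2) * (t - t0))
                * L2norm (l t0) (\<lambda>x. v x t0))))"
proof -
  note t0T = assms(2) and \<alpha> = assms(3) and lstar = assms(9) and K = assms(11) and M = assms(12)
  have l_pos: "0 < l t" and l_le: "l t \<le> lstar" if "t \<in> {t0..T}" for t
    using assms(5,10) that by auto
  have dl: "(l has_real_derivative deriv l t) (at t)"
    and ddl: "(deriv l has_real_derivative deriv (deriv l) t) (at t)"
    and cont: "isCont (deriv (deriv l)) t" if "t \<in> {t0..T}" for t
    using real_analytic_on_derivatives[OF assms(6), of t] that by auto
  have cl: "continuous_on {t0..T} l" "continuous_on {t0..T} (deriv l)" "continuous_on {t0..T} (deriv (deriv l))"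
    using dl ddl cont by (meson DERIV_isCont continuous_at_imp_continuous_on)+
  have l_neq: "l t \<noteq> 0" if "t \<in> {t0..T}" for t using l_pos[OF that] by simp
  \<comment> \<open>One bound for each coefficient of the energy estimate. \<open>B2\<close> and
    \<open>B3\<close> bound reciprocals and so give the lower bounds on \<open>l t\<close> and on
    \<open>\<alpha> / (l t)^2\<close>.\<close>
  obtain B1 where B1: "0 \<le> B1" "\<And>t. t \<in> {t0..T} \<Longrightarrow> \<bar>l t\<bar> \<le> B1"
    by (rule bounded_on_interval[OF cl(1)]) blast
  obtain B2 where B2: "0 \<le> B2" "\<And>t. t \<in> {t0..T} \<Longrightarrow> \<bar>1 / l t\<bar> \<le> B2"
    by (rule bounded_on_interval[of t0 T "\<lambda>t. 1 / l t"]) (use cl l_neq in \<open>auto intro!: continuous_intros\<close>)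
  obtain B3 where B3: "0 \<le> B3" "\<And>t. t \<in> {t0..T} \<Longrightarrow> \<bar>(l t)\<^sup>2 / \<alpha>\<bar> \<le> B3"
    by (rule bounded_on_interval[of t0 T "\<lambda>t. (l t)\<^sup>2 / \<alpha>"]) (use cl \<alpha> in \<open>auto intro!: continuous_intros\<close>)
  obtain B4 where B4: "0 \<le> B4" "\<And>t. t \<in> {t0..T} \<Longrightarrow> \<bar>\<alpha> / l t\<bar> \<le> B4"
    by (rule bounded_on_interval[of t0 T "\<lambda>t. \<alpha> / l t"]) (use cl l_neq in \<open>auto intro!: continuous_intros\<close>)
  obtain B5 where B5: "0 \<le> B5" "\<And>t. t \<in> {t0..T} \<Longrightarrow> \<bar>deriv l t / l t\<bar> \<le> B5"
    by (rule bounded_on_interval[of t0 T "\<lambda>t. deriv l t / l t"]) (use cl l_neq in \<open>auto intro!: continuous_intros\<close>)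
  obtain B6 where B6: "0 \<le> B6" "\<And>t. t \<in> {t0..T} \<Longrightarrow> \<bar>l t * deriv l t / (2 * \<alpha>)\<bar> \<le> B6"
    by (rule bounded_on_interval[of t0 T "\<lambda>t. l t * deriv l t / (2 * \<alpha>)"]) (use cl \<alpha> in \<open>auto intro!: continuous_intros\<close>)
  obtain B7 where B7: "0 \<le> B7" "\<And>t. t \<in> {t0..T} \<Longrightarrow> \<bar>((deriv l t)\<^sup>2 + l t * deriv (deriv l) t) / (2 * \<alpha>)\<bar> \<le> B7"
    by (rule bounded_on_interval[of t0 T "\<lambda>t. ((deriv l t)\<^sup>2 + l t * deriv (deriv l) t) / (2 * \<alpha>)"])
      (use cl \<alpha> in \<open>auto intro!: continuous_intros\<close>)
  define C where "C = (1 + lstar) * CI M lstar 1"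
  have C: "0 \<le> C" using M lstar by (simp add: C_def CI_def tauQ_def tauK_def)
  define H where "H = 1 + (T - t0) + B1 + B2 + B3 + B4 + B5 + B6 + B7 + C + \<bar>c\<bar> + \<bar>mu0 \<alpha> c lstar\<bar>"
  have H: "1 \<le> H" "T - t0 \<le> H" "B1 \<le> H" "B2 \<le> H" "B3 \<le> H" "B4 \<le> H" "B5 \<le> H" "B6 \<le> H" "B7 \<le> H" "C \<le> H"
    "\<bar>c\<bar> \<le> H" "\<bar>mu0 \<alpha> c lstar\<bar> \<le> H"
    using t0T B1(1) B2(1) B3(1) B4(1) B5(1) B6(1) B7(1) C by (auto simp: H_def)
  have bounds: "1 / H \<le> l t" "l t \<le> H" "1 / H \<le> \<alpha> / (l t)\<^sup>2" "\<alpha> / l t \<le> H" "\<bar>deriv l t / l t\<bar> \<le> H"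
    "\<bar>l t * deriv l t / (2 * \<alpha>)\<bar> \<le> H" "\<bar>((deriv l t)\<^sup>2 + l t * deriv (deriv l) t) / (2 * \<alpha>)\<bar> \<le> H"
    if t: "t \<in> {t0..T}" for t
  proof -
    have "1 / l t \<le> H" "(l t)\<^sup>2 / \<alpha> \<le> H"
      using B2(2)[OF t] B3(2)[OF t] H by linarith+
    then show "1 / H \<le> l t" "1 / H \<le> \<alpha> / (l t)\<^sup>2"
      using l_pos[OF t] \<alpha> H(1) by (simp_all add: field_simps)
    show "l t \<le> H" "\<alpha> / l t \<le> H" "\<bar>deriv l t / l t\<bar> \<le> H"
      "\<bar>l t * deriv l t / (2 * \<alpha>)\<bar> \<le> H" "\<bar>((deriv l t)\<^sup>2 + l t * deriv (deriv l) t) / (2 * \<alpha>)\<bar> \<le> H"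
      using B1(2)[OF t] B4(2)[OF t] B5(2)[OF t] B6(2)[OF t] B7(2)[OF t] H by linarith+
  qed
  \<comment> \<open>The ratio at \<epsilon> = 0 between \<open>CD\<close> and the norm bound of the
    forward transform. It exceeds 1 because sqrt 2 < 3/2, and this excess is the slack that will
    cover the energy loss.\<close>
  define \<rho> where "\<rho> = (1 + M * lstar / sqrt 2) / (1 + 2 / 3 * (lstar * M))"
  have den: "0 < 1 + 2 / 3 * (lstar * M)" using M lstar by (simp add: add_pos_pos)
  have strict: "2 / 3 * lstar < lstar / sqrt 2"
  proof -
    have "sqrt 2 < (3 / 2 :: real)" by (rule real_less_lsqrt) (auto simp: power2_eq_square)
    then show ?thesis using lstar by (simp add: field_simps)
  qed
  have "2 / 3 * (lstar * M) < M * lstar / sqrt 2"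
    using mult_strict_right_mono[OF strict M] by (simp add: mult_ac)
  then have \<rho>1: "1 < \<rho>" using den by (simp add: \<rho>_def)
  \<comment> \<open>With s > r the ratio (1 + s \<tau>) / (1 + r \<tau>) increases in \<tau>, so its
    value \<rho> at \<tau> = M is a lower bound for the one at \<tau> = M + \<epsilon>.\<close>
  have \<rho>CD: "\<rho> * (1 + 2 / 3 * (lstar * tauK M \<epsilon>)) \<le> CD M lstar \<epsilon>" if "0 < \<epsilon>" for \<epsilon>
  proof -
    define r s where "r = 2 / 3 * lstar" and "s = lstar / sqrt 2"
    have "(s - r) * (M - tauK M \<epsilon>) \<le> 0"
      using strict that by (intro mult_nonneg_nonpos) (auto simp: r_def s_def tauK_def)
    then have "(1 + s * M) * (1 + r * tauK M \<epsilon>) \<le> (1 + s * tauK M \<epsilon>) * (1 + r * M)"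
      by (simp add: algebra_simps)
    moreover have "0 < 1 + r * M" using den by (simp add: r_def mult.assoc)
    ultimately have "(1 + s * M) / (1 + r * M) * (1 + r * tauK M \<epsilon>) \<le> 1 + s * tauK M \<epsilon>"
      by (simp add: pos_divide_le_eq)
    then show ?thesis by (simp add: \<rho>_def CD_def r_def s_def mult_ac)
  qed
  have KM: "\<bar>K q\<bar> \<le> M" if q: "q \<in> Dom t0 T" for q
  proof -
    obtain K' K'' where K2: "C2_with K K' K'' (Dom t0 T)"
      using K unfolding kernel_solution_def C2_on_def C2_with_def by blast
    obtain \<xi> \<eta> t where q': "q = (\<xi>, \<eta>, t)" by (cases q) auto
    have "t \<in> {t0..T}" using q q' by (simp add: Dom_iff)
    with kernel_sup_bound[OF t0T K2 _ q[unfolded q']] assms(13) show ?thesis by (simp add: q')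
  qed
  \<comment> \<open>At \<epsilon> = 0 the required inequality reads 1 < \<rho>^2, a strict one, so
    by continuity it persists for small \<epsilon>. The threshold depends only on H and \<rho>,
    hence not on the approximate kernel or the solution.\<close>
  have "((\<lambda>\<epsilon>. exp (600 * H^10 * \<epsilon>) - \<rho>\<^sup>2 * (1 - \<epsilon> * H^7)) \<longlongrightarrow> exp (600 * H^10 * 0) - \<rho>\<^sup>2 * (1 - 0 * H^7)) (at_right 0)"
    by (intro tendsto_intros)
  moreover have "exp (600 * H^10 * 0) - \<rho>\<^sup>2 * (1 - 0 * H^7) < 0"
    using \<rho>1 by (simp add: one_less_power)
  ultimately have "\<forall>\<^sub>F \<epsilon> in at_right 0. exp (600 * H^10 * \<epsilon>) - \<rho>\<^sup>2 * (1 - \<epsilon> * H^7) < 0"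
    by (rule order_tendstoD(2))
  moreover have "((\<lambda>\<epsilon>. 300 * H^9 * \<epsilon>) \<longlongrightarrow> 300 * H^9 * 0) (at_right 0)"
    by (intro tendsto_intros)
  then have "\<forall>\<^sub>F \<epsilon> in at_right 0. 300 * H^9 * \<epsilon> < 1"
    by (rule order_tendstoD(2)) simp
  moreover have "\<forall>\<^sub>F \<epsilon> in at_right 0. \<epsilon> < (1 :: real)"
    by (rule order_tendstoD(2)[OF tendsto_ident_at]) simp
  ultimately have "\<forall>\<^sub>F \<epsilon> in at_right 0. exp (600 * H^10 * \<epsilon>) \<le> \<rho>\<^sup>2 * (1 - \<epsilon> * H^7) \<and> 300 * H^9 * \<epsilon> \<le> 1 \<and> \<epsilon> \<le> 1"
    by eventually_elim auto
  then obtain \<epsilon>star where \<epsilon>star: "0 < \<epsilon>star"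
    and small: "\<And>\<epsilon>. 0 < \<epsilon> \<Longrightarrow> \<epsilon> < \<epsilon>star \<Longrightarrow>
      exp (600 * H^10 * \<epsilon>) \<le> \<rho>\<^sup>2 * (1 - \<epsilon> * H^7) \<and> 300 * H^9 * \<epsilon> \<le> 1 \<and> \<epsilon> \<le> 1"
    by (auto simp: eventually_at_right_field)
  show ?thesis
  proof (intro exI[of _ \<epsilon>star] conjI \<epsilon>star allI impI ballI)
    fix \<epsilon> and F :: "real \<times> real \<times> real \<Rightarrow> real" and v0 v t
    assume \<epsilon>: "0 < \<epsilon> \<and> \<epsilon> < \<epsilon>star" and F: "C2_on F (Dom t0 T)"
      and close: "\<forall>\<xi> \<eta> t. (\<xi>, \<eta>, t) \<in> Dom t0 T \<longrightarrow>
          \<bar>K (\<xi>, \<eta>, t) - F (\<xi>, \<eta>, t)\<bar>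
          + \<bar>4 * \<alpha> / l t * pd (Dom t0 T) (1, 0, 0) (\<lambda>p. K p - F p) (\<xi>, 0, t)\<bar>
          + \<bar>kernel_residual \<alpha> lam0 c l t0 T (\<lambda>p. K p - F p) \<xi> \<eta> t\<bar> < \<epsilon>"
      and sol: "closed_loop_solution \<alpha> lam0 l t0 T (orig_kernel l F) v0 v" and t: "t \<in> {t0..T}"
    have \<epsilon>0: "0 < \<epsilon>" using \<epsilon> by simp
    note sm = small[OF \<epsilon>0 conjunct2[OF \<epsilon>]]
    obtain F' F'' where F2: "C2_with F F' F'' (Dom t0 T)"
      using F unfolding C2_on_def C2_with_def by blast
    have "(1 + lstar) * CI M lstar \<epsilon> \<le> C"
      unfolding C_def using lstar M \<epsilon>0 sm by (intro mult_left_mono CI_mono) auto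
    then have bC: "(1 + lstar) * CI M lstar \<epsilon> \<le> H" using H by simp
    have CI1: "1 \<le> CI M lstar \<epsilon>" "1 \<le> CD M lstar \<epsilon>"
      using M lstar \<epsilon>0 by (simp_all add: CI_def CD_def tauQ_def tauK_def)
    have C0: "0 \<le> C0 M lstar \<epsilon> * \<epsilon>"
      using CI1 lstar \<epsilon>0 by (simp add: C0_def)
    have init: "\<forall>x\<in>{0<..<l t0}. v x t0 = v0 x" "in_L2 (l t0) v0"
      and lim: "((\<lambda>t. LINT x|lborel. (indicator {0<..<l t} x * v x t - indicator {0<..<l t0} x * v0 x)\<^sup>2)
        \<longlongrightarrow> 0) (at_right t0)"
      using sol[unfolded closed_loop_solution_def, THEN conjunct2] by simp_all
    have init_norm: "L2norm (l t0) (\<lambda>x. v x t0) = L2norm (l t0) v0"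
      unfolding L2norm_def using init(1) by (intro arg_cong[where f = sqrt] set_lebesgue_integral_cong) auto
    show "L2norm (l t) (\<lambda>x. v x t)
             \<le> CI M lstar \<epsilon> * CD M lstar \<epsilon>
                * exp (- ((mu0 \<alpha> c lstar - C0 M lstar \<epsilon> * \<epsilon>) / 2) * (t - t0))
                * L2norm (l t0) (\<lambda>x. v x t0)"
    proof (cases "t = t0")
      case True
      \<comment> \<open>At the initial time the claim only says that both constants are at least
        1.\<close>
      have "1 * L2norm (l t0) (\<lambda>x. v x t0) \<le> CI M lstar \<epsilon> * CD M lstar \<epsilon> * L2norm (l t0) (\<lambda>x. v x t0)"
        using CI1 mult_mono[OF CI1] by (intro mult_right_mono L2norm_nonneg) auto
      then show ?thesis using True by simp
    next
      case False
      then have tt: "t0 < t" using t by simp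
      \<comment> \<open>The decay factor from time s, to be continued to s = \<open>t0\<close>. The
        estimate holds for every s strictly between \<open>t0\<close> and t.\<close>
      define \<phi> where "\<phi> = (\<lambda>s. CI M lstar \<epsilon> * CD M lstar \<epsilon> * exp (- mu0 \<alpha> c lstar / 2 * (t - s)))"
      have "L2norm (l t) (\<lambda>x. v x t) \<le> \<phi> t0 * L2norm (l t0) v0"
      proof (rule le_L2norm_initial[OF init(2) lim _ L2norm_nonneg _ _ _ tt])
        show "L2norm (l t) (\<lambda>x. v x t) \<le> \<phi> s * L2norm (l s) (\<lambda>x. v x s)" if s: "s \<in> {t0<..<t}" for s
          unfolding \<phi>_def
        proof (rule decay_between[where H = H and \<rho> = \<rho> and F = F and F' = F' and F'' = F'' and K = K and ?t1.0 = s and T = T,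
            OF t0T \<alpha> lstar M l_pos l_le dl ddl K KM F2])
          show "(1 + lstar) * CI M lstar \<epsilon> \<le> H" by (rule bC)
          show "0 < \<rho>" using \<rho>1 by simp
        qed (use close sol H bounds sm \<epsilon>0 \<rho>CD[OF \<epsilon>0] s t in auto)
        show "(\<phi> \<longlongrightarrow> \<phi> t0) (at_right t0)" unfolding \<phi>_def by (intro tendsto_intros) auto
        show "0 \<le> \<phi> t0" using CI1 by (simp add: \<phi>_def)
        show "continuous_on {0..l s} (\<lambda>x. v x s)" if s: "s \<in> {t0<..<t}" for s
          by (rule closed_loop_continuous_on[OF sol \<alpha> l_pos dl cl(2)]) (use s t in auto)
      qed
      also have "\<phi> t0 \<le> CI M lstar \<epsilon> * CD M lstar \<epsilon> * exp (- ((mu0 \<alpha> c lstar - C0 M lstar \<epsilon> * \<epsilon>) / 2) * (t - t0))"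
      proof -
        \<comment> \<open>The rate obtained is \<open>mu0\<close> itself, which is at least the
          claimed one because \<open>C0 * \<epsilon>\<close> is nonnegative.\<close>
        have "- mu0 \<alpha> c lstar / 2 * (t - t0) \<le> - ((mu0 \<alpha> c lstar - C0 M lstar \<epsilon> * \<epsilon>) / 2) * (t - t0)"
          using C0 tt by (intro mult_right_mono) auto
        then show ?thesis unfolding \<phi>_def using CI1 by (intro mult_left_mono) auto
      qed
      finally show ?thesis by (simp add: init_norm mult_right_mono L2norm_nonneg)
    qed
  qed
qed

end
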